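(* Let $X$ be a smooth complex curve with effective divisor $D$, and let $(\mathcal{E},\nabla)$ be a holomorphic vector bundle of rank $r$ on $X$ with a meromorphic connection whose poles are bounded by $D$. Let $\Psi:s^*\mathcal{E}\to t^*\mathcal{E}$ be the representation of the groupoid $\Pi_1(X,D)$ integrating $(\mathcal{E},\nabla)$, where $s,t:\Pi_1(X,D)\to X$ are the source and target maps. For any fundamental solution $\psi:\mathcal{O}_X^r\to\mathcal{E}$ of $(\mathcal{E},\nabla)$, the expression $$\delta\psi=t^*\psi\circ(s^*\psi)^{-1}$$ extends holomorphically to $\Pi_1(X,D)$ and coincides with the representation $\Psi$. The apparent multivaluedness of $\delta\psi$ is resolved by requiring $\delta\psi=1$ over the identity bisection.
   Context: A fundamental solution is the choice of a flat basis of $\mathcal{E}$, i.e. a flat isomorphism $\psi:\mathcal{O}_X^r\to\mathcal{E}$ (flat with respect to the trivial connection on $\mathcal{O}_X^r$ and $\nabla$ on $\mathcal{E}$), which is in general multivalued on $U=X\setminus D$ and singular along $D$. $\mathcal{T}_X(-D)$ is the sheaf of holomorphic vector fields vanishing along $D$, a Lie algebroid with anchor the inclusion in $\mathcal{T}_X$. A vector bundle with meromorphic connection with poles bounded by $D$ is the same as a representation of this Lie algebroid. $\Pi_1(X,D)$ is the source-simply connected Lie groupoid over $X$ (source fibres connected and simply connected) whose Lie algebroid is $\mathcal{T}_X(-D)$; it exists and is unique up to isomorphism. The Lie algebroid of a Lie groupoid is the normal bundle to the identity bisection, identified with right-invariant vector fields tangent to source fibres, with anchor the derivative of $t$. The composition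 $gh$ is defined when $s(g)=t(h)$. A representation of a Lie groupoid $G$ on $\mathcal{E}$ is a holomorphic isomorphism $\Psi:s^*\mathcal{E}\to t^*\mathcal{E}$ over $G$ with $\Psi(gh)=\Psi(g)\Psi(h)$ for composable $g,h$; every representation of $\mathcal{T}_X(-D)$ integrates to a unique representation of $\Pi_1(X,D)$. The identity bisection is the image of the identity embedding $X\to\Pi_1(X,D)$. *)

theory Defs
  imports "HOL-Analysis.Analysis"
begin

section \<open>Complex manifolds\<close>

text \<open>A manifold is the universe of a type of class topological_space together with an atlas of
  charts \<open>(V, \<phi>)\<close>, where \<open>\<phi>\<close> matters only on \<open>V\<close>. No separation axiom is part of the notion:
  Lie groupoids need not be Hausdorff. The base curve is taken in class t2_space.\<close>

type_synonym ('m, 'n) chart = "'m set \<times> ('m \<Rightarrow> complex ^ 'n)"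
type_synonym ('m, 'n) atlas = "('m, 'n) chart set"

definition holo_cn :: "(complex ^ 'n \<Rightarrow> complex) \<Rightarrow> (complex ^ 'n) set \<Rightarrow> bool" where
  "holo_cn f S \<longleftrightarrow> open S \<and>
     (\<forall>z\<in>S. \<exists>L. (f has_derivative L) (at z) \<and> (\<forall>c v. L (c *s v) = c * L v))"

definition complex_atlas :: "('m::topological_space, 'n::finite) atlas \<Rightarrow> bool" where
  "complex_atlas A \<longleftrightarrow>
     (\<Union>(V, \<phi>)\<in>A. V) = UNIV \<and>
     (\<forall>(V, \<phi>)\<in>A. open V \<and> open (\<phi> ` V) \<and> homeomorphism V (\<phi> ` V) \<phi> (inv_into V \<phi>)) \<and>
     (\<forall>(V, \<phi>)\<in>A. \<forall>(W, \<theta>)\<in>A. \<forall>i. holo_cn (\<lambda>z. \<theta> (inv_into V \<phi> z) $ i) (\<phi> ` (V \<inter> W)))"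

definition holo_fun ::
  "('m::topological_space, 'n::finite) atlas \<Rightarrow> ('m \<Rightarrow> complex) \<Rightarrow> 'm set \<Rightarrow> bool" where
  "holo_fun A f W \<longleftrightarrow> open W \<and> (\<forall>(V, \<phi>)\<in>A. holo_cn (\<lambda>z. f (inv_into V \<phi> z)) (\<phi> ` (V \<inter> W)))"

definition holo_near ::
  "('m::topological_space, 'n::finite) atlas \<Rightarrow> ('m \<Rightarrow> complex) \<Rightarrow> 'm \<Rightarrow> bool" where
  "holo_near A f p \<longleftrightarrow> (\<exists>W. p \<in> W \<and> holo_fun A f W)"

definition holo_map ::
  "('m::topological_space, 'n::finite) atlas \<Rightarrow> ('k::topological_space, 'l::finite) atlas
    \<Rightarrow> ('m \<Rightarrow> 'k) \<Rightarrow> 'm set \<Rightarrow> bool" where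
  "holo_map A B F W \<longleftrightarrow> open W \<and> continuous_on W F \<and>
     (\<forall>(V, \<phi>)\<in>B. \<forall>i. holo_fun A (\<lambda>p. \<phi> (F p) $ i) (W \<inter> F -` V))"

definition prod_atlas ::
  "('m, 'n::finite) atlas \<Rightarrow> ('k, 'l::finite) atlas \<Rightarrow> ('m \<times> 'k, 'n + 'l) atlas" where
  "prod_atlas A B =
     {(V \<times> W, \<lambda>(p, q). \<chi> i. case i of Inl a \<Rightarrow> \<phi> p $ a | Inr b \<Rightarrow> \<theta> q $ b) | V \<phi> W \<theta>.
        (V, \<phi>) \<in> A \<and> (W, \<theta>) \<in> B}"


section \<open>Tangent vectors and vector fields\<close>

text \<open>A tangent vector at \<open>p\<close> is a directional derivative of germs of holomorphic functions at
  \<open>p\<close>, taken in some chart. It is set to \<open>0\<close> on functions that are not holomorphic near \<open>p\<close>, so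
  that equality of tangent vectors is equality of functions.\<close>

type_synonym 'm tvec = "('m \<Rightarrow> complex) \<Rightarrow> complex"

definition chart_tvec ::
  "('m::topological_space, 'n::finite) atlas \<Rightarrow> ('m, 'n) chart \<Rightarrow> 'm \<Rightarrow> complex ^ 'n \<Rightarrow> 'm tvec" where
  "chart_tvec A C p w = (\<lambda>f. case C of (V, \<phi>) \<Rightarrow>
     if holo_near A f p then frechet_derivative (\<lambda>z. f (inv_into V \<phi> z)) (at (\<phi> p)) w else 0)"

definition tangent_space :: "('m::topological_space, 'n::finite) atlas \<Rightarrow> 'm \<Rightarrow> 'm tvec set" where
  "tangent_space A p = {chart_tvec A C p w | C w. C \<in> A \<and> p \<in> fst C}"

definition submersion ::
  "('m::topological_space, 'n::finite) atlas \<Rightarrow> ('k::topological_space, 'l::finite) atlas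
    \<Rightarrow> ('m \<Rightarrow> 'k) \<Rightarrow> bool" where
  "submersion A B F \<longleftrightarrow> holo_map A B F UNIV \<and>
     (\<forall>p. \<forall>w\<in>tangent_space B (F p). \<exists>v\<in>tangent_space A p.
        \<forall>f. holo_near B f (F p) \<longrightarrow> v (\<lambda>q. f (F q)) = w f)"

text \<open>A vector field on an open set \<open>V\<close> is extended by \<open>0\<close> outside \<open>V\<close>.\<close>

type_synonym 'm vfield = "'m \<Rightarrow> 'm tvec"

definition holo_vfield ::
  "('m::topological_space, 'n::finite) atlas \<Rightarrow> 'm set \<Rightarrow> 'm vfield \<Rightarrow> bool" where
  "holo_vfield A V v \<longleftrightarrow> open V \<and> (\<forall>p\<in>V. v p \<in> tangent_space A p) \<and> (\<forall>p. p \<notin> V \<longrightarrow> v p = (\<lambda>f. 0)) \<and>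
     (\<forall>W f. W \<subseteq> V \<and> holo_fun A f W \<longrightarrow> holo_fun A (\<lambda>p. v p f) W)"

definition vf_comb ::
  "('m \<Rightarrow> complex) \<Rightarrow> 'm vfield \<Rightarrow> ('m \<Rightarrow> complex) \<Rightarrow> 'm vfield \<Rightarrow> 'm vfield" where
  "vf_comb a v b w = (\<lambda>p f. a p * v p f + b p * w p f)"

definition vf_restrict :: "'m vfield \<Rightarrow> 'm set \<Rightarrow> 'm vfield" where
  "vf_restrict v W = (\<lambda>p. if p \<in> W then v p else (\<lambda>f. 0))"

definition vf_bracket ::
  "('m::topological_space, 'n::finite) atlas \<Rightarrow> 'm vfield \<Rightarrow> 'm vfield \<Rightarrow> 'm vfield" where
  "vf_bracket A v w =
     (\<lambda>p f. if holo_near A f p then v p (\<lambda>q. w q f) - w p (\<lambda>q. v q f) else 0)"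


section \<open>Curves, effective divisors, and the Lie algebroid \<open>T\<^sub>X(-D)\<close>\<close>

definition support :: "('x \<Rightarrow> nat) \<Rightarrow> 'x set" where
  "support D = {x. D x \<noteq> 0}"

definition effective_divisor :: "('x::topological_space \<Rightarrow> nat) \<Rightarrow> bool" where
  "effective_divisor D \<longleftrightarrow> (\<forall>x. \<exists>W. open W \<and> x \<in> W \<and> finite (W \<inter> support D))"

definition vanishes_to_order ::
  "('x::topological_space, 1) atlas \<Rightarrow> nat \<Rightarrow> ('x \<Rightarrow> complex) \<Rightarrow> 'x \<Rightarrow> bool" where
  "vanishes_to_order A k f p \<longleftrightarrow>
     (\<exists>(V, \<phi>)\<in>A. \<exists>W h. p \<in> W \<and> W \<subseteq> V \<and> holo_fun A h W \<and>
        (\<forall>q\<in>W. f q = (\<phi> q $ 1 - \<phi> p $ 1) ^ k * h q))"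

definition log_vfields ::
  "('x::topological_space, 1) atlas \<Rightarrow> ('x \<Rightarrow> nat) \<Rightarrow> 'x set \<Rightarrow> 'x vfield set" where
  "log_vfields A D V = {v. holo_vfield A V v \<and>
     (\<forall>p\<in>V. \<forall>f. holo_near A f p \<longrightarrow> vanishes_to_order A (D p) (\<lambda>q. v q f) p)}"


section \<open>Holomorphic vector bundles\<close>

text \<open>A bundle is given by the projection from its total space and a set of local trivialisations
  \<open>(V, \<tau>)\<close>, where \<open>\<tau>\<close> is the fibre coordinate over \<open>V\<close>. The rank is the cardinality of the index
  type \<open>'r\<close>. The vector space structure of the fibres is the one transported by the
  trivialisations.\<close>

record ('x, 'e, 'r::finite) vbundle =
  bproj :: "'e \<Rightarrow> 'x"
  btriv :: "('x set \<times> ('e \<Rightarrow> complex ^ 'r)) set"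

definition fibre :: "('x, 'e, 'r::finite) vbundle \<Rightarrow> 'x \<Rightarrow> 'e set" where
  "fibre E x = {e. bproj E e = x}"

definition vector_bundle ::
  "('x::topological_space, 'n::finite) atlas \<Rightarrow> ('x, 'e, 'r::finite) vbundle \<Rightarrow> bool" where
  "vector_bundle A E \<longleftrightarrow>
     (\<Union>(V, \<tau>)\<in>btriv E. V) = UNIV \<and>
     (\<forall>(V, \<tau>)\<in>btriv E. open V \<and> (\<forall>x\<in>V. bij_betw \<tau> (fibre E x) UNIV)) \<and>
     (\<forall>(V, \<tau>)\<in>btriv E. \<forall>(W, \<sigma>)\<in>btriv E. \<exists>M :: 'x \<Rightarrow> complex ^ 'r ^ 'r.
        (\<forall>i j. holo_fun A (\<lambda>x. M x $ i $ j) (V \<inter> W)) \<and>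
        (\<forall>x\<in>V \<inter> W. \<forall>e\<in>fibre E x. \<sigma> e = M x *v \<tau> e))"

definition fib_zero :: "('x, 'e, 'r::finite) vbundle \<Rightarrow> 'x \<Rightarrow> 'e" where
  "fib_zero E x = (THE c. c \<in> fibre E x \<and> (\<forall>(V, \<tau>)\<in>btriv E. x \<in> V \<longrightarrow> \<tau> c = 0))"

definition fib_add :: "('x, 'e, 'r::finite) vbundle \<Rightarrow> 'e \<Rightarrow> 'e \<Rightarrow> 'e" where
  "fib_add E a b = (THE c. c \<in> fibre E (bproj E a) \<and>
     (\<forall>(V, \<tau>)\<in>btriv E. bproj E a \<in> V \<longrightarrow> \<tau> c = \<tau> a + \<tau> b))"

definition fib_scale :: "('x, 'e, 'r::finite) vbundle \<Rightarrow> complex \<Rightarrow> 'e \<Rightarrow> 'e" where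
  "fib_scale E k a = (THE c. c \<in> fibre E (bproj E a) \<and>
     (\<forall>(V, \<tau>)\<in>btriv E. bproj E a \<in> V \<longrightarrow> \<tau> c = k *s \<tau> a))"

definition holo_section ::
  "('x::topological_space, 'n::finite) atlas \<Rightarrow> ('x, 'e, 'r::finite) vbundle
    \<Rightarrow> 'x set \<Rightarrow> ('x \<Rightarrow> 'e) \<Rightarrow> bool" where
  "holo_section A E V e \<longleftrightarrow> open V \<and> (\<forall>x\<in>V. e x \<in> fibre E x) \<and>
     (\<forall>(W, \<tau>)\<in>btriv E. \<forall>i. holo_fun A (\<lambda>x. \<tau> (e x) $ i) (V \<inter> W))"


section \<open>Meromorphic connections\<close>

text \<open>\<open>nab e x w\<close> is the value at the tangent vector \<open>w\<close> at \<open>x\<close> of the \<open>E\<close>-valued meromorphic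
  one-form \<open>\<nabla>e\<close>, for a local holomorphic section \<open>e\<close> and \<open>x\<close> outside the support of \<open>D\<close>.
  The form \<open>\<nabla>e\<close> lies in \<open>E \<otimes> \<Omega>\<^sup>1(D)\<close> iff \<open>(z - z(p))\<^bsup>D(p)\<^esup> \<nabla>e(\<partial>/\<partial>z)\<close> extends
  holomorphically over each \<open>p\<close>.\<close>

type_synonym ('x, 'e) conn = "('x \<Rightarrow> 'e) \<Rightarrow> 'x \<Rightarrow> 'x tvec \<Rightarrow> 'e"

definition meromorphic_connection ::
  "('x::topological_space, 1) atlas \<Rightarrow> ('x \<Rightarrow> nat) \<Rightarrow> ('x, 'e, 'r::finite) vbundle
    \<Rightarrow> ('x, 'e) conn \<Rightarrow> bool" where
  "meromorphic_connection A D E nab \<longleftrightarrow>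
     \<comment> \<open>\<open>\<nabla>e\<close> is a one-form with values in \<open>E\<close>\<close>
     (\<forall>V e x. holo_section A E V e \<and> x \<in> V - support D \<longrightarrow>
        (\<forall>w\<in>tangent_space A x. nab e x w \<in> fibre E x) \<and>
        (\<forall>w\<in>tangent_space A x. \<forall>w'\<in>tangent_space A x. \<forall>c d.
           nab e x (\<lambda>f. c * w f + d * w' f) =
             fib_add E (fib_scale E c (nab e x w)) (fib_scale E d (nab e x w')))) \<and>
     \<comment> \<open>\<open>\<nabla>\<close> is a morphism of sheaves\<close>
     (\<forall>V e e' x. holo_section A E V e \<and> holo_section A E V e' \<and> (\<forall>y\<in>V. e y = e' y) \<and>
        x \<in> V - support D \<longrightarrow> (\<forall>w\<in>tangent_space A x. nab e x w = nab e' x w)) \<and>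
     (\<forall>V e e' x. holo_section A E V e \<and> holo_section A E V e' \<and> x \<in> V - support D \<longrightarrow>
        (\<forall>w\<in>tangent_space A x.
           nab (\<lambda>y. fib_add E (e y) (e' y)) x w = fib_add E (nab e x w) (nab e' x w))) \<and>
     \<comment> \<open>Leibniz rule\<close>
     (\<forall>V e f x. holo_section A E V e \<and> holo_fun A f V \<and> x \<in> V - support D \<longrightarrow>
        (\<forall>w\<in>tangent_space A x.
           nab (\<lambda>y. fib_scale E (f y) (e y)) x w =
             fib_add E (fib_scale E (w f) (e x)) (fib_scale E (f x) (nab e x w)))) \<and>
     \<comment> \<open>the poles are bounded by \<open>D\<close>\<close>
     (\<forall>V e p. holo_section A E V e \<and> p \<in> V \<longrightarrow>
        (\<forall>(C, \<phi>)\<in>A. p \<in> C \<longrightarrow>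
           (\<exists>W n. p \<in> W \<and> W \<subseteq> V \<inter> C \<and> holo_section A E W n \<and>
              (\<forall>x\<in>W - support D.
                 n x = fib_scale E ((\<phi> x $ 1 - \<phi> p $ 1) ^ D p)
                         (nab e x (chart_tvec A (C, \<phi>) x (axis 1 1)))))))"

text \<open>\<open>alg_conn A D E nab V v e n\<close>: on \<open>V\<close>, the representation of \<open>T\<^sub>X(-D)\<close> defined by the
  connection sends the section \<open>e\<close> to \<open>\<nabla>\<^sub>v e = n\<close>.\<close>

definition alg_conn ::
  "('x::topological_space, 1) atlas \<Rightarrow> ('x \<Rightarrow> nat) \<Rightarrow> ('x, 'e, 'r::finite) vbundle
    \<Rightarrow> ('x, 'e) conn \<Rightarrow> 'x set \<Rightarrow> 'x vfield \<Rightarrow> ('x \<Rightarrow> 'e) \<Rightarrow> ('x \<Rightarrow> 'e) \<Rightarrow> bool" where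
  "alg_conn A D E nab V v e n \<longleftrightarrow>
     v \<in> log_vfields A D V \<and> holo_section A E V e \<and> holo_section A E V n \<and>
     (\<forall>x\<in>V - support D. n x = nab e x (v x))"


section \<open>Lie groupoids and their Lie algebroids\<close>

text \<open>\<open>gmul G g h\<close> is \<open>gh\<close>, meaningful for \<open>s g = t h\<close>.\<close>

record ('x, 'g) groupoid =
  gsrc :: "'g \<Rightarrow> 'x"
  gtgt :: "'g \<Rightarrow> 'x"
  gmul :: "'g \<Rightarrow> 'g \<Rightarrow> 'g"
  gone :: "'x \<Rightarrow> 'g"
  ginv :: "'g \<Rightarrow> 'g"

definition source_fibre :: "('x, 'g) groupoid \<Rightarrow> 'x \<Rightarrow> 'g set" where
  "source_fibre G x = {g. gsrc G g = x}"

definition groupoid :: "('x, 'g) groupoid \<Rightarrow> bool" where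
  "groupoid G \<longleftrightarrow>
     (\<forall>x. gsrc G (gone G x) = x \<and> gtgt G (gone G x) = x) \<and>
     (\<forall>g h. gsrc G g = gtgt G h \<longrightarrow>
        gsrc G (gmul G g h) = gsrc G h \<and> gtgt G (gmul G g h) = gtgt G g) \<and>
     (\<forall>g h k. gsrc G g = gtgt G h \<and> gsrc G h = gtgt G k \<longrightarrow>
        gmul G (gmul G g h) k = gmul G g (gmul G h k)) \<and>
     (\<forall>g. gmul G (gone G (gtgt G g)) g = g \<and> gmul G g (gone G (gsrc G g)) = g) \<and>
     (\<forall>g. gsrc G (ginv G g) = gtgt G g \<and> gtgt G (ginv G g) = gsrc G g \<and>
        gmul G g (ginv G g) = gone G (gtgt G g) \<and> gmul G (ginv G g) g = gone G (gsrc G g))"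

text \<open>The product is holomorphic on the submanifold of composable pairs: it extends locally to a
  holomorphic map on an open subset of the product manifold.\<close>

definition lie_groupoid ::
  "('x::topological_space, 'n::finite) atlas \<Rightarrow> ('g::topological_space, 'k::finite) atlas
    \<Rightarrow> ('x, 'g) groupoid \<Rightarrow> bool" where
  "lie_groupoid A B G \<longleftrightarrow> complex_atlas A \<and> complex_atlas B \<and> groupoid G \<and>
     submersion B A (gsrc G) \<and> submersion B A (gtgt G) \<and>
     holo_map A B (gone G) UNIV \<and> holo_map B B (ginv G) UNIV \<and>
     (\<forall>g h. gsrc G g = gtgt G h \<longrightarrow>
        (\<exists>N F. (g, h) \<in> N \<and> holo_map (prod_atlas B B) B F N \<and>
           (\<forall>(k, l)\<in>N. gsrc G k = gtgt G l \<longrightarrow> F (k, l) = gmul G k l))) \<and>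
     (\<forall>x. Hausdorff_space (top_of_set (source_fibre G x)))"

definition source_tangent ::
  "('x::topological_space, 'n::finite) atlas \<Rightarrow> ('x, 'g) groupoid \<Rightarrow> 'g vfield \<Rightarrow> bool" where
  "source_tangent A G \<xi> \<longleftrightarrow>
     (\<forall>g f. holo_near A f (gsrc G g) \<longrightarrow> \<xi> g (\<lambda>k. f (gsrc G k)) = 0)"

text \<open>Right translation by \<open>h\<close> is defined only on the source fibre over \<open>t h\<close>. A vector tangent to
  that fibre is applied to a function on it by applying it to any local holomorphic extension.\<close>

definition right_invariant ::
  "('g::topological_space, 'k::finite) atlas \<Rightarrow> ('x, 'g) groupoid \<Rightarrow> 'x set \<Rightarrow> 'g vfield \<Rightarrow> bool"
  where
  "right_invariant B G V \<xi> \<longleftrightarrow>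
     (\<forall>g h F F' N. gtgt G g \<in> V \<and> gsrc G g = gtgt G h \<and>
        holo_near B F (gmul G g h) \<and> g \<in> N \<and> holo_fun B F' N \<and>
        (\<forall>k\<in>N. gsrc G k = gtgt G h \<longrightarrow> F' k = F (gmul G k h))
        \<longrightarrow> \<xi> (gmul G g h) F = \<xi> g F')"

definition lie_alg_sections ::
  "('x::topological_space, 'n::finite) atlas \<Rightarrow> ('g::topological_space, 'k::finite) atlas
    \<Rightarrow> ('x, 'g) groupoid \<Rightarrow> 'x set \<Rightarrow> 'g vfield set" where
  "lie_alg_sections A B G V = {\<xi>. holo_vfield B (gtgt G -` V) \<xi> \<and>
     source_tangent A G \<xi> \<and> right_invariant B G V \<xi>}"

text \<open>\<open>\<Phi> V\<close> is the isomorphism on sections over \<open>V\<close>. The clauses: bijectivity, compatibility with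
  restriction, linearity over holomorphic functions, brackets, and anchors (the derivative of \<open>t\<close>
  along the identity bisection, respectively the inclusion).\<close>

definition log_algebroid_iso ::
  "('x::topological_space, 1) atlas \<Rightarrow> ('x \<Rightarrow> nat) \<Rightarrow> ('g::topological_space, 'k::finite) atlas
    \<Rightarrow> ('x, 'g) groupoid \<Rightarrow> ('x set \<Rightarrow> 'x vfield \<Rightarrow> 'g vfield) \<Rightarrow> bool" where
  "log_algebroid_iso A D B G \<Phi> \<longleftrightarrow> (\<forall>V. open V \<longrightarrow>
     bij_betw (\<Phi> V) (log_vfields A D V) (lie_alg_sections A B G V) \<and>
     (\<forall>W. \<forall>v\<in>log_vfields A D V. open W \<and> W \<subseteq> V \<longrightarrow>
        \<Phi> W (vf_restrict v W) = vf_restrict (\<Phi> V v) (gtgt G -` W)) \<and>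
     (\<forall>v\<in>log_vfields A D V. \<forall>w\<in>log_vfields A D V.
        (\<forall>a b. holo_fun A a V \<and> holo_fun A b V \<longrightarrow>
           \<Phi> V (vf_comb a v b w) =
             vf_comb (\<lambda>g. a (gtgt G g)) (\<Phi> V v) (\<lambda>g. b (gtgt G g)) (\<Phi> V w)) \<and>
        \<Phi> V (vf_bracket A v w) = vf_bracket B (\<Phi> V v) (\<Phi> V w)) \<and>
     (\<forall>v\<in>log_vfields A D V. \<forall>x\<in>V. \<forall>f. holo_near A f x \<longrightarrow>
        \<Phi> V v (gone G x) (\<lambda>g. f (gtgt G g)) = v x f))"

text \<open>\<open>G\<close>, with the identification \<open>\<Phi>\<close> of its Lie algebroid, is the groupoid \<open>\<Pi>\<^sub>1(X, D)\<close>.\<close>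

definition twisted_fundamental_groupoid ::
  "('x::topological_space, 1) atlas \<Rightarrow> ('x \<Rightarrow> nat) \<Rightarrow> ('g::topological_space, 2) atlas
    \<Rightarrow> ('x, 'g) groupoid \<Rightarrow> ('x set \<Rightarrow> 'x vfield \<Rightarrow> 'g vfield) \<Rightarrow> bool" where
  "twisted_fundamental_groupoid A D B G \<Phi> \<longleftrightarrow> lie_groupoid A B G \<and>
     (\<forall>x. connected (source_fibre G x) \<and> simply_connected (source_fibre G x)) \<and>
     log_algebroid_iso A D B G \<Phi>"


section \<open>Representations of groupoids\<close>

text \<open>Holomorphic homomorphisms \<open>s\<^sup>*E \<rightarrow> t\<^sup>*E\<close> over an open subset of \<open>G\<close>.\<close>

definition holo_hom ::
  "('g::topological_space, 'k::finite) atlas \<Rightarrow> ('x, 'g) groupoid \<Rightarrow> ('x, 'e, 'r::finite) vbundle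
    \<Rightarrow> 'g set \<Rightarrow> ('g \<Rightarrow> 'e \<Rightarrow> 'e) \<Rightarrow> bool" where
  "holo_hom B G E N \<Theta> \<longleftrightarrow> open N \<and>
     (\<forall>g\<in>N. \<forall>e\<in>fibre E (gsrc G g). \<Theta> g e \<in> fibre E (gtgt G g)) \<and>
     (\<forall>(V, \<tau>)\<in>btriv E. \<forall>(W, \<sigma>)\<in>btriv E. \<exists>M :: 'g \<Rightarrow> complex ^ 'r ^ 'r.
        (\<forall>i j. holo_fun B (\<lambda>g. M g $ i $ j) (N \<inter> gsrc G -` V \<inter> gtgt G -` W)) \<and>
        (\<forall>g\<in>N \<inter> gsrc G -` V \<inter> gtgt G -` W. \<forall>e\<in>fibre E (gsrc G g). \<sigma> (\<Theta> g e) = M g *v \<tau> e))"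

definition groupoid_rep ::
  "('g::topological_space, 'k::finite) atlas \<Rightarrow> ('x, 'g) groupoid \<Rightarrow> ('x, 'e, 'r::finite) vbundle
    \<Rightarrow> ('g \<Rightarrow> 'e \<Rightarrow> 'e) \<Rightarrow> bool" where
  "groupoid_rep B G E \<Psi> \<longleftrightarrow> holo_hom B G E UNIV \<Psi> \<and>
     (\<forall>g. bij_betw (\<Psi> g) (fibre E (gsrc G g)) (fibre E (gtgt G g))) \<and>
     (\<forall>g h. gsrc G g = gtgt G h \<longrightarrow>
        (\<forall>e\<in>fibre E (gsrc G h). \<Psi> (gmul G g h) e = \<Psi> g (\<Psi> h e)))"

text \<open>The Lie algebroid representation of \<open>\<Psi>\<close> sends \<open>v\<close> and a section \<open>e\<close> to the section whose
  value at \<open>x\<close> is the derivative, along \<open>\<Phi>(v)\<close> at the identity \<open>1\<^sub>x\<close>, of the \<open>E\<^sub>x\<close>-valued function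
  \<open>g \<mapsto> \<Psi>(g)\<^sup>-\<^sup>1 e(t(g))\<close> on the source fibre over \<open>x\<close>. In a trivialisation this formula
  makes sense for all \<open>g\<close> near \<open>1\<^sub>x\<close>.\<close>

definition integrates ::
  "('x::topological_space, 1) atlas \<Rightarrow> ('x \<Rightarrow> nat) \<Rightarrow> ('x, 'g) groupoid
    \<Rightarrow> ('x set \<Rightarrow> 'x vfield \<Rightarrow> 'g vfield) \<Rightarrow> ('x, 'e, 'r::finite) vbundle \<Rightarrow> ('x, 'e) conn
    \<Rightarrow> ('g \<Rightarrow> 'e \<Rightarrow> 'e) \<Rightarrow> bool" where
  "integrates A D G \<Phi> E nab \<Psi> \<longleftrightarrow>
     (\<forall>V v e n. alg_conn A D E nab V v e n \<longrightarrow>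
        (\<forall>x\<in>V. \<forall>(W, \<tau>)\<in>btriv E. x \<in> W \<longrightarrow>
           (\<forall>i. \<tau> (n x) $ i =
              \<Phi> V v (gone G x)
                (\<lambda>g. \<tau> (inv_into (fibre E (gsrc G g)) (\<Psi> g) (e (gtgt G g))) $ i))))"


section \<open>Fundamental solutions\<close>

text \<open>Multivalued sections over an open set \<open>U\<close> are sections over its universal cover. As \<open>U\<close> need
  not be connected, this is a covering whose part over each component of \<open>U\<close> is simply connected.
  In HOL-Analysis simply connected sets are path connected, as constant loops are homotopic.\<close>

definition universal_cover ::
  "('u::topological_space \<Rightarrow> 'x::topological_space) \<Rightarrow> 'x set \<Rightarrow> bool" where
  "universal_cover p U \<longleftrightarrow> covering_space UNIV p U \<and>
     (\<forall>x\<in>U. simply_connected (p -` connected_component_set U x))"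

text \<open>The local branches of \<open>\<psi>\<close> are its composites with the continuous local sections of the
  covering; \<open>\<psi>\<close> is flat for the trivial connection and \<open>\<nabla>\<close> iff each branch sends constant sections
  to flat ones.\<close>

definition fundamental_solution ::
  "('x::topological_space, 1) atlas \<Rightarrow> ('x \<Rightarrow> nat) \<Rightarrow> ('x, 'e, 'r::finite) vbundle
    \<Rightarrow> ('x, 'e) conn \<Rightarrow> ('u::topological_space \<Rightarrow> 'x) \<Rightarrow> ('u \<Rightarrow> complex ^ 'r \<Rightarrow> 'e) \<Rightarrow> bool" where
  "fundamental_solution A D E nab p \<psi> \<longleftrightarrow>
     (\<forall>y. bij_betw (\<psi> y) UNIV (fibre E (p y)) \<and>
        (\<forall>a b. \<psi> y (a + b) = fib_add E (\<psi> y a) (\<psi> y b)) \<and>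
        (\<forall>k a. \<psi> y (k *s a) = fib_scale E k (\<psi> y a))) \<and>
     (\<forall>W \<rho>. open W \<and> W \<subseteq> - support D \<and> continuous_on W \<rho> \<and> (\<forall>x\<in>W. p (\<rho> x) = x) \<longrightarrow>
        (\<forall>c. holo_section A E W (\<lambda>x. \<psi> (\<rho> x) c) \<and>
           (\<forall>x\<in>W. \<forall>w\<in>tangent_space A x. nab (\<lambda>y. \<psi> (\<rho> y) c) x w = fib_zero E x)))"

text \<open>The open subgroupoid over the complement of \<open>D\<close>.\<close>

definition restricted_arrows :: "('x \<Rightarrow> nat) \<Rightarrow> ('x, 'g) groupoid \<Rightarrow> 'g set" where
  "restricted_arrows D G = {g. gsrc G g \<notin> support D \<and> gtgt G g \<notin> support D}"

text \<open>\<open>\<Theta>\<close> is a single-valued branch over \<open>N\<close> of the multivalued \<open>\<delta>\<psi> = t\<^sup>*\<psi> \<circ> (s\<^sup>*\<psi>)\<^sup>-\<^sup>1\<close>: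
  locally it is given by that formula after choosing continuous lifts \<open>a\<close> of \<open>s\<close> and \<open>b\<close> of \<open>t\<close> to
  the universal cover.\<close>

definition delta_branch ::
  "('x, 'g::topological_space) groupoid \<Rightarrow> ('x, 'e, 'r::finite) vbundle
    \<Rightarrow> ('u::topological_space \<Rightarrow> 'x) \<Rightarrow> ('u \<Rightarrow> complex ^ 'r \<Rightarrow> 'e)
    \<Rightarrow> 'g set \<Rightarrow> ('g \<Rightarrow> 'e \<Rightarrow> 'e) \<Rightarrow> bool" where
  "delta_branch G E p \<psi> N \<Theta> \<longleftrightarrow>
     (\<forall>g\<in>N. \<exists>N' a b. open N' \<and> g \<in> N' \<and> N' \<subseteq> N \<and> continuous_on N' a \<and> continuous_on N' b \<and>
        (\<forall>k\<in>N'. p (a k) = gsrc G k \<and> p (b k) = gtgt G k \<and>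
           (\<forall>e\<in>fibre E (gsrc G k). \<Theta> k e = \<psi> (b k) (inv_into UNIV (\<psi> (a k)) e))))"

definition normalised ::
  "('x \<Rightarrow> nat) \<Rightarrow> ('x, 'g) groupoid \<Rightarrow> ('x, 'e, 'r::finite) vbundle \<Rightarrow> ('g \<Rightarrow> 'e \<Rightarrow> 'e) \<Rightarrow> bool"
  where
  "normalised D G E \<Theta> \<longleftrightarrow> (\<forall>x. x \<notin> support D \<longrightarrow> (\<forall>e\<in>fibre E x. \<Theta> (gone G x) e = e))"

definition hom_eq_on ::
  "('x, 'g) groupoid \<Rightarrow> ('x, 'e, 'r::finite) vbundle \<Rightarrow> 'g set
    \<Rightarrow> ('g \<Rightarrow> 'e \<Rightarrow> 'e) \<Rightarrow> ('g \<Rightarrow> 'e \<Rightarrow> 'e) \<Rightarrow> bool" where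
  "hom_eq_on G E N \<Theta> \<Theta>' \<longleftrightarrow> (\<forall>g\<in>N. \<forall>e\<in>fibre E (gsrc G g). \<Theta> g e = \<Theta>' g e)"

end

theory Submission
  imports Defs "HOL-Complex_Analysis.Cauchy_Integral_Formula"
begin

text \<open>The extension is \<open>\<Psi>\<close> itself. Let \<open>x\<close> lie outside \<open>D\<close>. An arrow from \<open>x\<close> never ends in \<open>D\<close>: if
  the target map were not locally constant on a source fibre at an arrow ending in a point \<open>q\<close> of \<open>D\<close>,
  then the right-invariant vector field of \<open>z\<^bsup>D(q)\<^esup> \<partial>/\<partial>z\<close> would vanish over \<open>q\<close>, and its quotient by
  \<open>z \<circ> t\<close> would be a section of the Lie algebroid that does not come from \<open>T\<^sub>X(-D)\<close>. So \<open>D\<close> is reached on a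
  clopen part of the connected source fibre, which misses the identity.

  Over the complement of \<open>D\<close>, the pair \<open>(s, t)\<close> is a local coordinate system of the groupoid. There
  \<open>\<Psi>(g)\<^sup>-\<^sup>1 \<psi>(t(g))\<close> has zero derivative along source fibres, hence, using inverses, the expression
  \<open>\<psi>(t(g))\<^sup>-\<^sup>1 \<Psi>(g) \<psi>(s(g))\<close> is locally constant for every local choice of branches. Therefore being given
  by a branch of \<open>\<delta>\<psi>\<close> is an open and closed condition on source fibres, and it holds at identities.
  The arrows over the complement of \<open>D\<close> are dense, so the extension is unique.\<close>

section \<open>Holomorphic functions of two variables\<close>

text \<open>The groupoid is known only through its axioms and the isomorphism \<open>\<Phi>\<close>;
  no explicit model near the divisor is at hand. So invariance of \<open>D\<close> has to be
  extracted from the surjectivity of \<open>\<Phi> V\<close>, and the work lies in showing that a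
  field divided by \<open>z \<circ> t\<close> is still holomorphic, tangent to source fibres and
  right-invariant where \<open>z \<circ> t\<close> vanishes. The arrows form a complex surface, and
  holomorphy is given as one complex-linear derivative at every point; holomorphy of partial
  derivatives and of quotients by a coordinate must therefore come from Cauchy's formula. Two
  features shape the comparisons. The arrow space need not be Hausdorff, so they use open sets on
  which two complex-valued functions differ, or locally constant predicates on a connected set. And
  connectedness is given for whole source fibres, so a property of arrows over the complement of
  \<open>D\<close> can be propagated only once these fibres are known to stay there. The behaviour
  of \<open>\<psi>\<close> near \<open>D\<close> is never analysed: holomorphy across
  \<open>D\<close> is that of \<open>\<Psi>\<close>.\<close>

definition holo2 :: "(complex \<times> complex \<Rightarrow> complex) \<Rightarrow> (complex \<times> complex) set \<Rightarrow> bool" where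
  "holo2 f S \<longleftrightarrow> open S \<and>
     (\<forall>z\<in>S. \<exists>a b. (f has_derivative (\<lambda>h. a * fst h + b * snd h)) (at z))"

definition pd1 :: "(complex \<times> complex \<Rightarrow> complex) \<Rightarrow> complex \<times> complex \<Rightarrow> complex" where
  "pd1 f z = deriv (\<lambda>u. f (u, snd z)) (fst z)"

definition pd2 :: "(complex \<times> complex \<Rightarrow> complex) \<Rightarrow> complex \<times> complex \<Rightarrow> complex" where
  "pd2 f z = deriv (\<lambda>v. f (fst z, v)) (snd z)"

text \<open>Continuity is included so that Cauchy's formula suffices to reach \<open>holo2\<close>,
  without Hartogs's theorem. This is the form in which holomorphy is verified for partial
  derivatives and for quotients.\<close>

definition sep_holo :: "(complex \<times> complex \<Rightarrow> complex) \<Rightarrow> (complex \<times> complex) set \<Rightarrow> bool" where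
  "sep_holo f S \<longleftrightarrow> open S \<and> continuous_on S f \<and>
     (\<forall>z w. (z, w) \<in> S \<longrightarrow> (\<lambda>u. f (u, w)) field_differentiable at z \<and>
        (\<lambda>v. f (z, v)) field_differentiable at w)"

lemma partials_of_derivative:
  fixes f :: "complex \<times> complex \<Rightarrow> complex"
  assumes "(f has_derivative (\<lambda>h. a * fst h + b * snd h)) (at (z, w))"
  shows "((\<lambda>u. f (u, w)) has_field_derivative a) (at z)"
    and "((\<lambda>v. f (z, v)) has_field_derivative b) (at w)"
proof -
  have "((\<lambda>u. f (u, w)) has_derivative (\<lambda>x. a * fst (x, 0::complex) + b * snd (x, 0::complex))) (at z)"
    by (rule has_derivative_compose[where f = "\<lambda>u. (u, w)" and g' = "\<lambda>h. a * fst h + b * snd h"])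
      (auto intro!: derivative_eq_intros assms)
  then show "((\<lambda>u. f (u, w)) has_field_derivative a) (at z)"
    by (simp add: has_field_derivative_def)
  have "((\<lambda>v. f (z, v)) has_derivative (\<lambda>x. a * fst (0::complex, x) + b * snd (0::complex, x))) (at w)"
    by (rule has_derivative_compose[where f = "\<lambda>v. (z, v)" and g' = "\<lambda>h. a * fst h + b * snd h"])
      (auto intro!: derivative_eq_intros assms)
  then show "((\<lambda>v. f (z, v)) has_field_derivative b) (at w)"
    by (simp add: has_field_derivative_def)
qed

lemma holo2_open: "holo2 f S \<Longrightarrow> open S"
  by (simp add: holo2_def)

lemma holo2_has_derivative:
  assumes "holo2 f S" "z \<in> S"
  shows "(f has_derivative (\<lambda>h. pd1 f z * fst h + pd2 f z * snd h)) (at z)"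
proof -
  obtain a b where *: "(f has_derivative (\<lambda>h. a * fst h + b * snd h)) (at (fst z, snd z))"
    using assms by (auto simp: holo2_def)
  have "pd1 f z = a" "pd2 f z = b"
    using partials_of_derivative[OF *] by (auto simp: pd1_def pd2_def intro: DERIV_imp_deriv)
  then show ?thesis using * by simp
qed

lemma holo2_pd1: "holo2 f S \<Longrightarrow> (z, w) \<in> S \<Longrightarrow> ((\<lambda>u. f (u, w)) has_field_derivative pd1 f (z, w)) (at z)"
  by (rule partials_of_derivative(1)[OF holo2_has_derivative])

lemma holo2_pd2: "holo2 f S \<Longrightarrow> (z, w) \<in> S \<Longrightarrow> ((\<lambda>v. f (z, v)) has_field_derivative pd2 f (z, w)) (at w)"
  by (rule partials_of_derivative(2)[OF holo2_has_derivative])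

lemma holo2_continuous_on: "holo2 f S \<Longrightarrow> continuous_on S f"
  by (meson holo2_def has_derivative_continuous continuous_at_imp_continuous_on)

lemma holo2_sep_holo: "holo2 f S \<Longrightarrow> sep_holo f S"
  by (auto simp: sep_holo_def field_differentiable_def holo2_open holo2_continuous_on
      intro: holo2_pd1 holo2_pd2)

lemma open_prod_cballs:
  fixes S :: "('a::metric_space \<times> 'b::metric_space) set"
  assumes "open S" "(z, w) \<in> S"
  obtains r where "0 < r" "cball z r \<times> cball w r \<subseteq> S"
proof -
  obtain A B where AB: "open A" "open B" "z \<in> A" "w \<in> B" "A \<times> B \<subseteq> S"
    using open_prod_elim[OF assms] by (metis mem_Sigma_iff)
  obtain r1 r2 where "0 < r1" "cball z r1 \<subseteq> A" "0 < r2" "cball w r2 \<subseteq> B"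
    using AB open_contains_cball by meson
  then have "cball z (min r1 r2) \<times> cball w (min r1 r2) \<subseteq> S"
    using AB(5) by fastforce
  then show ?thesis using that[of "min r1 r2"] \<open>0 < r1\<close> \<open>0 < r2\<close> by auto
qed

lemma sep_holo_pd1:
  "sep_holo f S \<Longrightarrow> (z, w) \<in> S \<Longrightarrow> ((\<lambda>u. f (u, w)) has_field_derivative pd1 f (z, w)) (at z)"
  by (simp add: sep_holo_def pd1_def field_differentiable_derivI)

lemma sep_holo_pd2:
  "sep_holo f S \<Longrightarrow> (z, w) \<in> S \<Longrightarrow> ((\<lambda>v. f (z, v)) has_field_derivative pd2 f (z, w)) (at w)"
  by (simp add: sep_holo_def pd2_def field_differentiable_derivI)

text \<open>In the first variable the derivative of a holomorphic function is continuous. In the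
  second, the Cauchy estimate on a disc bounds the change of the derivative by the change of
  \<open>f\<close>, which is small uniformly because \<open>f\<close> is uniformly continuous on a
  compact bidisc.\<close>

lemma sep_holo_pd1_continuous:
  assumes f: "sep_holo f S"
  shows "continuous_on S (pd1 f)"
proof (rule continuous_at_imp_continuous_on, clarify)
  fix z0 w0 assume "(z0, w0) \<in> S"
  then obtain R where R: "0 < R" "cball z0 R \<times> cball w0 R \<subseteq> S"
    using open_prod_cballs f by (metis sep_holo_def)
  define r where "r = R / 2"
  have r: "0 < r" "r \<le> R" using R by (auto simp: r_def)
  let ?K = "cball z0 R \<times> cball w0 R"
  have "continuous_on ?K f"
    using f R continuous_on_subset by (auto simp: sep_holo_def)
  then have uc: "uniformly_continuous_on ?K f"
    by (intro compact_uniformly_continuous compact_Times compact_cball)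
  have sl: "(\<lambda>u. f (u, w)) holomorphic_on ball z0 R" if "w \<in> cball w0 R" for w
    using f R(2) that unfolding holomorphic_on_def sep_holo_def
    by (metis SigmaI ball_subset_cball field_differentiable_at_within subset_eq)
  show "isCont (pd1 f) (z0, w0)"
    unfolding continuous_at_eps_delta
  proof (intro allI impI)
    fix e :: real assume e: "0 < e"
    have "continuous_on (ball z0 R) (deriv (\<lambda>u. f (u, w0)))"
      by (intro holomorphic_on_imp_continuous_on holomorphic_deriv sl) (use R in auto)
    then have "isCont (deriv (\<lambda>u. f (u, w0))) z0"
      using R(1) by (simp add: continuous_on_eq_continuous_at)
    then obtain d1 where d1: "0 < d1"
      "\<And>z. dist z z0 < d1 \<Longrightarrow> dist (deriv (\<lambda>u. f (u, w0)) z) (deriv (\<lambda>u. f (u, w0)) z0) < e/2"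
      unfolding continuous_at_eps_delta using e by (metis half_gt_zero)
    obtain d2 where d2: "0 < d2"
      "\<And>a b. a \<in> ?K \<Longrightarrow> b \<in> ?K \<Longrightarrow> dist a b < d2 \<Longrightarrow> dist (f a) (f b) < e * r / 4"
      using uniformly_continuous_onE[OF uc, of "e * r / 4"] e r by (metis divide_pos_pos mult_pos_pos zero_less_numeral)
    have "dist (pd1 f (z, w)) (pd1 f (z0, w0)) < e"
      if zw: "dist (z, w) (z0, w0) < min d1 (min d2 r)" for z w
    proof -
      have dz: "dist z z0 < min d1 (min d2 r)" and dw: "dist w w0 < min d1 (min d2 r)"
        using zw dist_fst_le[of "(z, w)" "(z0, w0)"] dist_snd_le[of "(z, w)" "(z0, w0)"] by auto
      have sub: "cball z r \<subseteq> cball z0 R"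
        using dz by (auto simp: r_def dist_commute) (smt (verit) dist_commute dist_triangle field_sum_of_halves)
      have sub': "ball z r \<subseteq> ball z0 R"
        using dz by (auto simp: r_def dist_commute) (smt (verit) dist_commute dist_triangle field_sum_of_halves)
      have w: "w \<in> cball w0 R" "w0 \<in> cball w0 R"
        using dw r by (auto simp: dist_commute)
      let ?h = "\<lambda>u. f (u, w) - f (u, w0)"
      have hol: "?h holomorphic_on ball z r"
        by (intro holomorphic_on_diff holomorphic_on_subset[OF sl sub'] w)
      have cont: "continuous_on (cball z r) ?h"
        by (intro continuous_intros continuous_on_compose2[OF \<open>continuous_on ?K f\<close>]) (use sub w in auto)
      have bound: "norm (?h u) \<le> e * r / 4" if "norm (z - u) = r" for u
      proof -
        have "u \<in> cball z0 R" using sub that by (auto simp: dist_norm)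
        then have "dist (f (u, w)) (f (u, w0)) < e * r / 4"
          using d2(2)[of "(u, w)" "(u, w0)"] w dw by (auto simp: dist_Pair_Pair)
        then show ?thesis by (simp add: dist_norm)
      qed
      have "norm ((deriv ^^ 1) ?h z) \<le> fact 1 * (e * r / 4) / r^1"
        using Cauchy_inequality[OF hol cont r(1) bound] by blast
      then have "norm (deriv ?h z) \<le> e / 4" using r by simp
      moreover have "deriv ?h z = deriv (\<lambda>u. f (u, w)) z - deriv (\<lambda>u. f (u, w0)) z"
        using sl[OF w(1)] sl[OF w(2)] dz r
        by (intro deriv_diff holomorphic_on_imp_differentiable_at[OF _ open_ball]) (auto simp: dist_commute)
      ultimately have "dist (pd1 f (z, w)) (deriv (\<lambda>u. f (u, w0)) z) \<le> e / 4"
        by (simp add: pd1_def dist_norm)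
      moreover have "dist (deriv (\<lambda>u. f (u, w0)) z) (pd1 f (z0, w0)) < e / 2"
        using d1(2) dz by (auto simp: pd1_def)
      ultimately show ?thesis
        using dist_triangle[of "pd1 f (z, w)" "pd1 f (z0, w0)" "deriv (\<lambda>u. f (u, w0)) z"] e by linarith
    qed
    then show "\<exists>d>0. \<forall>x'. dist x' (z0, w0) < d \<longrightarrow> dist (pd1 f x') (pd1 f (z0, w0)) < e"
      using d1(1) d2(1) r(1) by (intro exI[of _ "min d1 (min d2 r)"]) auto
  qed
qed

lemma sep_holo_swap:
  assumes "sep_holo f S" shows "sep_holo (f \<circ> prod.swap) (prod.swap ` S)"
proof -
  have sw: "prod.swap ` S = prod.swap -` S" by force
  have op: "open (prod.swap ` S)"
    unfolding sw using assms
    by (intro open_vimage) (auto simp: sep_holo_def intro!: continuous_intros)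
  have "continuous_on (prod.swap ` S) (f \<circ> prod.swap)"
    using assms by (intro continuous_intros) (auto simp: sep_holo_def image_image)
  then show ?thesis using assms op unfolding sep_holo_def sw by auto
qed

lemma pd_swap: "pd1 (f \<circ> prod.swap) = pd2 f \<circ> prod.swap" "pd2 (f \<circ> prod.swap) = pd1 f \<circ> prod.swap"
  by (auto simp: pd1_def pd2_def)

lemma sep_holo_pd2_continuous:
  assumes "sep_holo f S"
  shows "continuous_on S (pd2 f)"
proof -
  have "continuous_on (prod.swap ` S) (pd2 f \<circ> prod.swap)"
    using sep_holo_pd1_continuous[OF sep_holo_swap[OF assms]] by (simp add: pd_swap)
  then have "continuous_on S ((pd2 f \<circ> prod.swap) \<circ> prod.swap)"
    by (rule continuous_on_compose[OF continuous_on_swap])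
  then show ?thesis by (simp add: o_def)
qed

text \<open>Osgood's lemma.\<close>

lemma sep_holo_imp_holo2:
  assumes f: "sep_holo f S"
  shows "holo2 f S"
  unfolding holo2_def
proof (intro conjI ballI)
  show "open S" using f by (simp add: sep_holo_def)
  fix zw assume "zw \<in> S"
  then obtain z w where zw: "zw = (z, w)" "(z, w) \<in> S" by (cases zw) auto
  obtain r where r: "0 < r" "cball z r \<times> cball w r \<subseteq> S"
    using open_prod_cballs[OF \<open>open S\<close> zw(2)] .
  have sub: "ball z r \<times> ball w r \<subseteq> S" using r(2) by (auto 4 4 simp: subset_eq)
  have fy: "((\<lambda>v. f (x, v)) has_derivative blinfun_apply (blinfun_mult_right (pd2 f (x, y)))) (at y within ball w r)"
    if "x \<in> ball z r" "y \<in> ball w r" for x y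
  proof -
    have "(x, y) \<in> S" using sub that by blast
    from has_derivative_at_withinI[OF sep_holo_pd2[OF f this, unfolded has_field_derivative_def]]
    show ?thesis by simp
  qed
  have fx: "((\<lambda>u. f (u, w)) has_derivative (\<lambda>h. pd1 f (z, w) * h)) (at z within ball z r)"
    using sep_holo_pd1[OF f zw(2)] by (simp add: has_field_derivative_def has_derivative_at_withinI)
  have c2: "continuous_on (ball z r \<times> ball w r) (\<lambda>(x, y). blinfun_mult_right (pd2 f (x, y)))"
  proof -
    have "continuous_on (ball z r \<times> ball w r) (\<lambda>x. blinfun_mult_right (pd2 f x))"
      using continuous_on_subset[OF sep_holo_pd2_continuous[OF f] sub]
      by (rule bounded_linear.continuous_on[OF bounded_linear_blinfun_mult_right])
    then show ?thesis by (simp add: case_prod_beta')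
  qed
  have "((\<lambda>(x, y). f (x, y)) has_derivative
      (\<lambda>(tx, ty). pd1 f (z, w) * tx + blinfun_apply (blinfun_mult_right (pd2 f (z, w))) ty))
      (at (z, w) within ball z r \<times> ball w r)"
  \<comment> \<open>Total differentiability needs one partial derivative at the point alone and
    joint continuity of the other one.\<close>
  proof (rule has_derivative_partialsI[OF fx fy])
    show "continuous (at (z, w) within ball z r \<times> ball w r) (\<lambda>(x, y). blinfun_mult_right (pd2 f (x, y)))"
      using c2 r(1) unfolding continuous_on_eq_continuous_within by simp
  qed (use r in auto)
  then have "(f has_derivative (\<lambda>h. pd1 f (z, w) * fst h + pd2 f (z, w) * snd h)) (at (z, w))"
    using r(1) by (simp add: at_within_open[of _ "ball z r \<times> ball w r"] open_Times case_prod_beta')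
  then show "\<exists>a b. (f has_derivative (\<lambda>h. a * fst h + b * snd h)) (at zw)"
    using zw(1) by blast
qed

text \<open>Cauchy's formula for the first derivative, with the circle parametrised by [0,1]: an
  ordinary integral can be differentiated in a parameter under the integral sign.\<close>

lemma deriv_circle_integral:
  assumes "continuous_on (cball z r) f" "f holomorphic_on ball z r" "0 < r"
  shows "deriv f z = integral {0..1} (\<lambda>t::real. f (z + r * exp (2 * of_real pi * \<i> * t)) * exp (- (2 * of_real pi * \<i> * t)) / r)"
proof -
  have "((\<lambda>u. f u / (u - z)^(Suc 1)) has_contour_integral (2*pi*\<i>) / (fact 1) * (deriv ^^ 1) f z) (circlepath z r)"
    using Cauchy_has_contour_integral_higher_derivative_circlepath[OF assms(1,2), of z 1] assms(3) by simp
  then have "((\<lambda>t. f (circlepath z r t) / (circlepath z r t - z)^2 *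
      vector_derivative (circlepath z r) (at t within {0..1})) has_integral 2*pi*\<i> * deriv f z) {0..1}"
    by (simp add: has_contour_integral_def power2_eq_square)
  then have "((\<lambda>t. (f (circlepath z r t) / (circlepath z r t - z)^2 *
      vector_derivative (circlepath z r) (at t within {0..1})) / (2 * pi * \<i>)) has_integral
      (2*pi*\<i> * deriv f z) / (2 * pi * \<i>)) {0..1}"
    by (rule has_integral_divide)
  moreover have "f (circlepath z r t) / (circlepath z r t - z)^2 *
        vector_derivative (circlepath z r) (at t within {0..1}) / (complex_of_real (2 * pi) * \<i>) =
        f (z + r * exp (2 * of_real pi * \<i> * t)) * exp (- (2 * of_real pi * \<i> * t)) / r"
      if t: "t \<in> {0..1}" for t
  proof -
    have "vector_derivative (circlepath z r) (at t within {0..1}) = 2 * pi * \<i> * r * exp (2 * pi * \<i> * t)"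
      using t vector_derivative_circlepath01[of t z r] by simp
    then show ?thesis
      using assms(3) by (simp add: circlepath exp_minus field_simps power2_eq_square)
  qed
  ultimately have "((\<lambda>t::real. f (z + r * exp (2 * of_real pi * \<i> * t)) * exp (- (2 * of_real pi * \<i> * t)) / r) has_integral
      (2*pi*\<i> * deriv f z) / (2 * pi * \<i>)) {0..1}"
    by (rule has_integral_eq[rotated]) auto
  then have "((\<lambda>t::real. f (z + r * exp (2 * of_real pi * \<i> * t)) * exp (- (2 * of_real pi * \<i> * t)) / r) has_integral
      deriv f z) {0..1}"
    by simp
  then show ?thesis by (rule integral_unique[symmetric])
qed

text \<open>Holomorphy in the first variable is the one-variable theorem. In the second,
  \<open>pd1 f\<close> is a Cauchy integral over a fixed circle whose integrand depends
  holomorphically on the parameter, with jointly continuous derivative \<open>pd2 f\<close>.\<close>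

lemma pd1_sep_holo:
  assumes f: "sep_holo f S"
  shows "sep_holo (pd1 f) S"
  unfolding sep_holo_def
proof (intro conjI allI impI)
  show op: "open S" using f by (simp add: sep_holo_def)
  show "continuous_on S (pd1 f)" using sep_holo_pd1_continuous[OF f] .
  fix z w assume zw: "(z, w) \<in> S"
  obtain r where r: "0 < r" "cball z r \<times> cball w r \<subseteq> S"
    using open_prod_cballs[OF op zw] .
  have sl: "(\<lambda>u. f (u, v)) holomorphic_on ball z r" if "v \<in> cball w r" for v
    using f r(2) that unfolding holomorphic_on_def sep_holo_def
    by (metis SigmaI ball_subset_cball field_differentiable_at_within subset_eq)
  have "deriv (\<lambda>u. f (u, w)) holomorphic_on ball z r"
    by (intro holomorphic_deriv sl) (use r in auto)
  then show "(\<lambda>u. pd1 f (u, w)) field_differentiable at z"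
    using r(1) by (simp add: pd1_def holomorphic_on_imp_differentiable_at[OF _ open_ball])
  let ?c = "\<lambda>t::real. z + r * exp (2 * of_real pi * \<i> * t)"
  let ?e = "\<lambda>t::real. exp (- (2 * of_real pi * \<i> * t)) / r"
  have inK: "?c t \<in> cball z r" for t
    using r(1) by (simp add: dist_norm norm_mult)
  have eq: "pd1 f (z, v) = integral (cbox 0 1) (\<lambda>t. f (?c t, v) * ?e t)" if "v \<in> ball w r" for v
  proof -
    have "continuous_on (cball z r) (\<lambda>u. f (u, v))"
    proof (rule continuous_on_compose2[where g = f and t = S and f = "\<lambda>u. (u, v)"])
      show "continuous_on S f" using f by (simp add: sep_holo_def)
      show "continuous_on (cball z r) (\<lambda>u. (u, v))" by (intro continuous_intros)
      have "v \<in> cball w r" using that by simp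
      then show "(\<lambda>u. (u, v)) ` cball z r \<subseteq> S" using r(2) by blast
    qed
    from deriv_circle_integral[OF this sl r(1)] that show ?thesis
      by (simp add: pd1_def)
  qed
  have "(\<lambda>v. integral (cbox 0 1) (\<lambda>t. f (?c t, v) * ?e t)) holomorphic_on ball w r"
  proof (rule leibniz_rule_holomorphic[where fx = "\<lambda>v t. pd2 f (?c t, v) * ?e t"])
    fix v and t :: real assume v: "v \<in> ball w r" and t: "t \<in> cbox 0 1"
    have "v \<in> cball w r" using v by simp
    then have "(?c t, v) \<in> S" using inK[of t] r(2) by blast
    then have "((\<lambda>v. f (?c t, v)) has_field_derivative pd2 f (?c t, v)) (at v within ball w r)"
      using sep_holo_pd2[OF f] has_field_derivative_at_within by blast
    then show "((\<lambda>v. f (?c t, v) * ?e t) has_field_derivative pd2 f (?c t, v) * ?e t) (at v within ball w r)"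
      by (rule DERIV_cmult_right)
  next
    fix v assume v: "v \<in> ball w r"
    have "continuous_on (cbox 0 1) (\<lambda>t. f (?c t, v) * ?e t)"
    proof (intro continuous_intros continuous_on_compose2[where g = f and t = S and f = "\<lambda>t. (?c t, v)"])
      show "continuous_on S f" using f by (simp add: sep_holo_def)
      have "v \<in> cball w r" using v by simp
      then show "(\<lambda>t. (?c t, v)) ` cbox 0 1 \<subseteq> S" using r(2) inK by blast
    qed (use r(1) in auto)
    then show "(\<lambda>t. f (?c t, v) * ?e t) integrable_on cbox 0 1"
      by (rule integrable_continuous)
  next
    have "continuous_on (ball w r \<times> cbox 0 1) (\<lambda>p. pd2 f (?c (snd p), fst p) * ?e (snd p))"
    proof -
      have "continuous_on (ball w r \<times> cbox 0 1) (\<lambda>p. pd2 f (?c (snd p), fst p))"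
      proof (rule continuous_on_compose2[OF sep_holo_pd2_continuous[OF f], where f = "\<lambda>p. (?c (snd p), fst p)"])
        show "(\<lambda>p. (?c (snd p), fst p)) ` (ball w r \<times> cbox 0 1) \<subseteq> S"
        proof clarify
          fix v and t :: real assume "v \<in> ball w r"
          then have "v \<in> cball w r" by simp
          then show "(?c (snd (v, t)), fst (v, t)) \<in> S" using inK[of t] r(2) by auto
        qed
      qed (intro continuous_intros)
      then show ?thesis using r by (intro continuous_intros) auto
    qed
    then show "continuous_on (ball w r \<times> cbox 0 1) (\<lambda>(v, t). pd2 f (?c t, v) * ?e t)"
      by (simp add: case_prod_beta')
  qed auto
  then have "(\<lambda>v. pd1 f (z, v)) holomorphic_on ball w r"
    by (rule holomorphic_transform) (simp add: eq)
  then show "(\<lambda>v. pd1 f (z, v)) field_differentiable at w"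
    using r(1) by (simp add: holomorphic_on_imp_differentiable_at[OF _ open_ball])
qed

lemma holo2_pd1_holo2: "holo2 f S \<Longrightarrow> holo2 (pd1 f) S"
  by (rule sep_holo_imp_holo2[OF pd1_sep_holo[OF holo2_sep_holo]])

lemma holo2_pd2_holo2:
  assumes "holo2 f S" shows "holo2 (pd2 f) S"
proof -
  have "sep_holo (pd1 (f \<circ> prod.swap) \<circ> prod.swap) (prod.swap ` (prod.swap ` S))"
    by (intro sep_holo_swap pd1_sep_holo holo2_sep_holo assms)
  then have "sep_holo (pd2 f) S"
    unfolding pd_swap by (simp add: o_def image_image)
  then show ?thesis by (rule sep_holo_imp_holo2)
qed

text \<open>Joint differentiability of the quotient along the line \<open>z = a\<close> is awkward
  to check directly. By Osgood's lemma continuity and separate holomorphy are enough, and these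
  follow from the mean value inequality and from removable singularities.\<close>

lemma holo2_divide:
  assumes f: "holo2 f S" and zero: "\<And>w. (a, w) \<in> S \<Longrightarrow> f (a, w) = 0"
  obtains k where "holo2 k S" "\<And>z w. (z, w) \<in> S \<Longrightarrow> f (z, w) = (z - a) * k (z, w)"
proof -
  \<comment> \<open>On the line \<open>z = a\<close> the value is the limit of the difference
    quotient, as \<open>f\<close> vanishes there.\<close>
  define k where "k = (\<lambda>(z, w). if z = a then pd1 f (a, w) else f (z, w) / (z - a))"
  have op: "open S" using f by (rule holo2_open)
  have p1: "holo2 (pd1 f) S" using f by (rule holo2_pd1_holo2)
  have "sep_holo k S"
    unfolding sep_holo_def
  proof (intro conjI allI impI)
    show "open S" by fact
    show "continuous_on S k"
    proof (rule continuous_at_imp_continuous_on, clarify)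
      fix z w assume zw: "(z, w) \<in> S"
      show "isCont k (z, w)"
      proof (cases "z = a")
        case False
        have "isCont f (z, w)"
          using holo2_continuous_on[OF f] op zw continuous_on_eq_continuous_at by blast
        then have *: "isCont (\<lambda>p. f p / (fst p - a)) (z, w)"
          using False by (intro continuous_intros) auto
        have "\<forall>\<^sub>F p in nhds (z, w). fst p \<noteq> a"
          by (rule eventually_nhds_in_open[of "(- {a}) \<times> UNIV", THEN eventually_mono])
            (use False in \<open>auto intro!: open_Times\<close>)
        then have "\<forall>\<^sub>F p in nhds (z, w). k p = f p / (fst p - a)"
          by eventually_elim (auto simp: k_def split: prod.splits)
        then show ?thesis using * isCont_cong[of k "\<lambda>p. f p / (fst p - a)" "(z, w)"] by blast
      next
        case True
        obtain r where r: "0 < r" "cball a r \<times> cball w r \<subseteq> S"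
          using open_prod_cballs[OF op zw] True by metis
        have cp: "isCont (pd1 f) (a, w)"
          using holo2_continuous_on[OF p1] op zw True continuous_on_eq_continuous_at by blast
        show ?thesis
          unfolding continuous_at_eps_delta
        proof (intro allI impI)
          fix e :: real assume "0 < e"
          obtain d where d: "0 < d" "\<And>p. dist p (a, w) < d \<Longrightarrow> dist (pd1 f p) (pd1 f (a, w)) < e / 2"
            using cp \<open>0 < e\<close> unfolding continuous_at_eps_delta by (metis half_gt_zero)
          have "dist (k (u, v)) (k (z, w)) < e" if uv: "dist (u, v) (z, w) < min d r" for u v
          proof (cases "u = a")
            case ua: True
            then show ?thesis using d(2)[of "(u, v)"] uv True \<open>0 < e\<close>
              by (simp add: k_def)
          next
            case ua: False
            have du: "dist u a < min d r" and dv: "dist v w < min d r"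
              using uv True dist_fst_le[of "(u, v)" "(z, w)"] dist_snd_le[of "(u, v)" "(z, w)"] by auto
            let ?c = "pd1 f (a, w)"
            let ?s = "ball a (dist u a) \<union> closed_segment a u"
            have seg: "dist x a \<le> dist u a" if "x \<in> closed_segment a u" for x
              using that by (metis dist_commute dist_in_closed_segment)
            have inS: "(x, v) \<in> S" if "x \<in> closed_segment a u" for x
              using seg[OF that] du dv r(2) by (auto simp: subset_eq dist_commute)
            have dd: "((\<lambda>x. f (x, v) - ?c * x) has_field_derivative pd1 f (x, v) - ?c) (at x within closed_segment a u)"
              if "x \<in> closed_segment a u" for x
              using holo2_pd1[OF f inS[OF that]]
              by (auto intro!: derivative_eq_intros intro: has_field_derivative_at_within)
            have bd: "norm (pd1 f (x, v) - ?c) \<le> e / 2" if "x \<in> closed_segment a u" for x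
            proof -
              have "dist (x, v) (a, w) \<le> dist (u, v) (a, w)"
                using seg[OF that] by (simp add: dist_Pair_Pair power_mono)
              then have "dist (pd1 f (x, v)) ?c < e / 2"
                using d(2) uv True by auto
              then show ?thesis by (simp add: dist_norm)
            qed
            \<comment> \<open>The mean value inequality for \<open>f (x, v) - ?c * x\<close> on the
              segment from \<open>a\<close> to \<open>u\<close>; its derivative
              \<open>pd1 f (x, v) - ?c\<close> is small by continuity of
              \<open>pd1 f\<close>.\<close>
            have "norm ((f (u, v) - ?c * u) - (f (a, v) - ?c * a)) \<le> e / 2 * norm (u - a)"
              by (rule field_differentiable_bound[OF convex_closed_segment dd bd]) auto
            moreover have "f (a, v) = 0"
              using zero dv r by (auto simp: subset_eq dist_commute)
            ultimately have "norm (f (u, v) - ?c * (u - a)) \<le> e / 2 * norm (u - a)"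
              by (simp add: algebra_simps)
            then have "norm ((f (u, v) - ?c * (u - a)) / (u - a)) \<le> e / 2"
              using ua by (simp add: norm_divide divide_le_eq)
            then have "norm (f (u, v) / (u - a) - ?c) \<le> e / 2"
              using ua by (simp add: diff_divide_distrib)
            then show ?thesis using ua True \<open>0 < e\<close> by (simp add: k_def dist_norm)
          qed
          then show "\<exists>\<delta>>0. \<forall>x'. dist x' (z, w) < \<delta> \<longrightarrow> dist (k x') (k (z, w)) < e"
            using d r by (intro exI[of _ "min d r"]) auto
        qed
      qed
    qed
  next
    fix z w assume zw: "(z, w) \<in> S"
    let ?T = "(\<lambda>u. (u, w)) -` S"
    have oT: "open ?T" using op by (intro open_vimage) (auto intro!: continuous_intros)
    have holT: "(\<lambda>u. f (u, w)) holomorphic_on ?T"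
      using holo2_pd1[OF f] by (auto simp: holomorphic_on_def field_differentiable_def
          intro: has_field_derivative_at_within)
    have "(\<lambda>u. k (u, w)) holomorphic_on ?T"
    proof (cases "(a, w) \<in> S")
      case True
      have "(\<lambda>u. if u = a then deriv (\<lambda>u. f (u, w)) a else (f (u, w) - f (a, w)) / (u - a)) holomorphic_on ?T"
        using pole_lemma_open[OF holT oT] .
      then show ?thesis
        by (rule holomorphic_transform) (use zero[OF True] in \<open>simp add: k_def pd1_def\<close>)
    next
      case False
      then have "(\<lambda>u. f (u, w) / (u - a)) holomorphic_on ?T"
        by (intro holomorphic_intros holT) auto
      then show ?thesis
        by (rule holomorphic_transform) (use False in \<open>auto simp: k_def\<close>)
    qed
    then show "(\<lambda>u. k (u, w)) field_differentiable at z"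
      using zw oT by (simp add: holomorphic_on_imp_differentiable_at)
    show "(\<lambda>v. k (z, v)) field_differentiable at w"
    proof (cases "z = a")
      case True
      then show ?thesis
        using holo2_pd2[OF p1 zw] by (auto simp: k_def field_differentiable_def)
    next
      case False
      have "(\<lambda>v. f (z, v)) field_differentiable at w"
        using holo2_pd2[OF f zw] by (auto simp: field_differentiable_def)
      then have "(\<lambda>v. f (z, v) / (z - a)) field_differentiable at w"
        using False by (intro field_differentiable_divide field_differentiable_const) auto
      then show ?thesis using False by (simp add: k_def)
    qed
  qed
  then have "holo2 k S" by (rule sep_holo_imp_holo2)
  moreover have "f (z, w) = (z - a) * k (z, w)" if "(z, w) \<in> S" for z w
    using zero that by (auto simp: k_def)
  ultimately show ?thesis using that by blast
qed


section \<open>Holomorphic functions on manifolds\<close>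

definition cdiff :: "(complex ^ 'n \<Rightarrow> complex) \<Rightarrow> complex ^ 'n \<Rightarrow> bool" where
  "cdiff f z \<longleftrightarrow> (\<exists>L. (f has_derivative L) (at z) \<and> (\<forall>c v. L (c *s v) = c * L v))"

lemma holo_cn_iff: "holo_cn f S \<longleftrightarrow> open S \<and> (\<forall>z\<in>S. cdiff f z)"
  by (auto simp: holo_cn_def cdiff_def)

lemma cdiffD:
  assumes "cdiff f z"
  shows "(f has_derivative frechet_derivative f (at z)) (at z)"
    and "frechet_derivative f (at z) (c *s v) = c * frechet_derivative f (at z) v"
proof -
  obtain L where L: "(f has_derivative L) (at z)" "\<forall>c v. L (c *s v) = c * L v"
    using assms by (auto simp: cdiff_def)
  have "L = frechet_derivative f (at z)" using frechet_derivative_at[OF L(1)] .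
  then show "(f has_derivative frechet_derivative f (at z)) (at z)"
    "frechet_derivative f (at z) (c *s v) = c * frechet_derivative f (at z) v"
    using L by auto
qed

lemma has_derivative_vec_componentwise:
  fixes f :: "'a::real_normed_vector \<Rightarrow> complex ^ 'n"
  assumes "\<And>i. ((\<lambda>x. f x $ i) has_derivative (\<lambda>h. L h $ i)) (at z)"
  shows "(f has_derivative L) (at z)"
proof (rule iffD2[OF has_derivative_componentwise_within], rule ballI)
  fix b :: "complex ^ 'n" assume "b \<in> Basis"
  then obtain i c where b: "b = axis i c" by (auto simp: Basis_vec_def)
  show "((\<lambda>x. f x \<bullet> b) has_derivative (\<lambda>x. L x \<bullet> b)) (at z)"
    unfolding b inner_axis using has_derivative_inner_left[OF assms] .
qed

lemma cdiff_compose: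
  fixes g :: "complex ^ 'm \<Rightarrow> complex ^ 'n"
  assumes f: "cdiff f (g z)" and g: "\<And>i. cdiff (\<lambda>x. g x $ i) z"
  shows "cdiff (\<lambda>x. f (g x)) z"
    and "frechet_derivative (\<lambda>x. f (g x)) (at z) v =
      frechet_derivative f (at (g z)) (\<chi> i. frechet_derivative (\<lambda>x. g x $ i) (at z) v)"
proof -
  let ?L = "\<lambda>h. \<chi> i. frechet_derivative (\<lambda>x. g x $ i) (at z) h"
  have "(g has_derivative ?L) (at z)"
    by (rule has_derivative_vec_componentwise) (simp add: cdiffD[OF g])
  from has_derivative_compose[OF this cdiffD(1)[OF f]]
  have *: "((\<lambda>x. f (g x)) has_derivative (\<lambda>h. frechet_derivative f (at (g z)) (?L h))) (at z)" .
  have "?L (c *s v) = c *s ?L v" for c v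
    by (simp add: vec_eq_iff cdiffD(2)[OF g])
  then show "cdiff (\<lambda>x. f (g x)) z"
    unfolding cdiff_def using * cdiffD(2)[OF f] by (intro exI conjI) auto
  show "frechet_derivative (\<lambda>x. f (g x)) (at z) v = frechet_derivative f (at (g z)) (?L v)"
    using frechet_derivative_at[OF *] by metis
qed

lemma cdiff_compose2:
  assumes h: "(h has_derivative (\<lambda>k. a * fst k + b * snd k)) (at (f1 z, f2 z))"
    and f: "cdiff f1 z" "cdiff f2 z"
  shows "cdiff (\<lambda>x. h (f1 x, f2 x)) z"
    and "frechet_derivative (\<lambda>x. h (f1 x, f2 x)) (at z) v =
      a * frechet_derivative f1 (at z) v + b * frechet_derivative f2 (at z) v"
proof -
  let ?L = "\<lambda>v. a * frechet_derivative f1 (at z) v + b * frechet_derivative f2 (at z) v"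
  have "((\<lambda>x. (f1 x, f2 x)) has_derivative
      (\<lambda>v. (frechet_derivative f1 (at z) v, frechet_derivative f2 (at z) v))) (at z)"
    by (intro has_derivative_Pair cdiffD f)
  from has_derivative_compose[OF this h]
  have *: "((\<lambda>x. h (f1 x, f2 x)) has_derivative ?L) (at z)" by simp
  have "?L (c *s v) = c * ?L v" for c v
    by (simp add: cdiffD(2)[OF f(1)] cdiffD(2)[OF f(2)] algebra_simps)
  then show "cdiff (\<lambda>x. h (f1 x, f2 x)) z"
    unfolding cdiff_def using * by blast
  show "frechet_derivative (\<lambda>x. h (f1 x, f2 x)) (at z) v = ?L v"
    using frechet_derivative_at[OF *] by metis
qed

lemma cdiff_cong:
  assumes "open S" "z \<in> S" "\<And>x. x \<in> S \<Longrightarrow> f x = g x" "cdiff f z"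
  shows "cdiff g z" and "frechet_derivative g (at z) = frechet_derivative f (at z)"
proof -
  have *: "(g has_derivative frechet_derivative f (at z)) (at z)"
    by (rule has_derivative_transform_within_open[OF cdiffD(1)[OF assms(4)] assms(1,2,3)])
  then show "cdiff g z" using cdiffD(2)[OF assms(4)] by (auto simp: cdiff_def)
  show "frechet_derivative g (at z) = frechet_derivative f (at z)"
    using frechet_derivative_at[OF *] by simp
qed

lemma atlas_chart:
  assumes "complex_atlas A" "(V, \<phi>) \<in> A"
  shows "open V" "open (\<phi> ` V)" "continuous_on V \<phi>" "continuous_on (\<phi> ` V) (inv_into V \<phi>)"
    "inj_on \<phi> V"
proof -
  have *: "open V \<and> open (\<phi> ` V) \<and> homeomorphism V (\<phi> ` V) \<phi> (inv_into V \<phi>)"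
    using assms unfolding complex_atlas_def by auto
  then show "open V" "open (\<phi> ` V)" by auto
  from * have h: "homeomorphism V (\<phi> ` V) \<phi> (inv_into V \<phi>)" by simp
  show "continuous_on V \<phi>" "continuous_on (\<phi> ` V) (inv_into V \<phi>)"
    using homeomorphism_cont1[OF h] homeomorphism_cont2[OF h] by auto
  show "inj_on \<phi> V" using homeomorphism_apply1[OF h] by (rule inj_on_inverseI)
qed

lemma atlas_cover:
  assumes "complex_atlas A"
  obtains V \<phi> where "(V, \<phi>) \<in> A" "p \<in> V"
proof -
  have "(\<Union>(V, \<phi>)\<in>A. V) = UNIV" using assms unfolding complex_atlas_def by (rule conjunct1)
  then have "p \<in> (\<Union>(V, \<phi>)\<in>A. V)" by simp
  then show ?thesis using that by auto
qed

lemma atlas_image_open: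
  assumes "complex_atlas A" "(V, \<phi>) \<in> A" "open W"
  shows "open (\<phi> ` (V \<inter> W))"
proof -
  note c = atlas_chart[OF assms(1,2)]
  have "\<phi> ` (V \<inter> W) = \<phi> ` V \<inter> inv_into V \<phi> -` (V \<inter> W)"
    using c(5) by auto
  moreover have "open (\<phi> ` V \<inter> inv_into V \<phi> -` (V \<inter> W))"
    using c assms(3) by (metis continuous_open_preimage open_Int)
  ultimately show ?thesis by simp
qed

lemma atlas_transition:
  assumes "complex_atlas A" "(V, \<phi>) \<in> A" "(W, \<theta>) \<in> A" "p \<in> V" "p \<in> W"
  shows "cdiff (\<lambda>z. \<theta> (inv_into V \<phi> z) $ i) (\<phi> p)"
proof -
  have "holo_cn (\<lambda>z. \<theta> (inv_into V \<phi> z) $ i) (\<phi> ` (V \<inter> W))"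
    using assms unfolding complex_atlas_def by fastforce
  then show ?thesis using assms(4,5) by (auto simp: holo_cn_iff)
qed

text \<open>One chart suffices here, and \<open>hdiff_chart\<close> passes to any other. With
  \<open>holo_fun_iff\<close>, closure properties of holomorphic functions become statements about a
  single point.\<close>

definition hdiff :: "('m::topological_space, 'n::finite) atlas \<Rightarrow> ('m \<Rightarrow> complex) \<Rightarrow> 'm \<Rightarrow> bool" where
  "hdiff A f p \<longleftrightarrow> (\<exists>(V, \<phi>)\<in>A. p \<in> V \<and> cdiff (\<lambda>z. f (inv_into V \<phi> z)) (\<phi> p))"

text \<open>The chain rule for the transition map, whose components are holomorphic by the atlas
  axioms. The derivative formula is the transformation law of tangent vectors: it lets
  \<open>tangent_in_chart\<close> express a vector in any prescribed chart.\<close>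

lemma chart_change:
  assumes "complex_atlas A" "(V, \<phi>) \<in> A" "(W, \<theta>) \<in> A" "p \<in> V" "p \<in> W"
    and f: "cdiff (\<lambda>z. f (inv_into V \<phi> z)) (\<phi> p)"
  shows "cdiff (\<lambda>z. f (inv_into W \<theta> z)) (\<theta> p)"
    and "frechet_derivative (\<lambda>z. f (inv_into W \<theta> z)) (at (\<theta> p)) v =
      frechet_derivative (\<lambda>z. f (inv_into V \<phi> z)) (at (\<phi> p))
        (\<chi> i. frechet_derivative (\<lambda>z. \<phi> (inv_into W \<theta> z) $ i) (at (\<theta> p)) v)"
proof -
  note c1 = atlas_chart[OF assms(1,2)] and c2 = atlas_chart[OF assms(1,3)]
  let ?S = "\<theta> ` (W \<inter> V)"
  have S: "open ?S" "\<theta> p \<in> ?S"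
    using atlas_image_open[OF assms(1,3) c1(1)] assms by auto
  let ?g = "\<lambda>z. \<phi> (inv_into W \<theta> z)"
  have gp: "?g (\<theta> p) = \<phi> p" using assms(5) c2(5) by simp
  have f': "cdiff (\<lambda>z. f (inv_into V \<phi> z)) (?g (\<theta> p))" using f gp by simp
  note comp = cdiff_compose[of _ ?g, OF f' atlas_transition[OF assms(1,3,2,5,4)]]
  have eq: "(\<lambda>x. f (inv_into V \<phi> (?g x))) z = f (inv_into W \<theta> z)" if "z \<in> ?S" for z
    using that c1(5) c2(5) by auto
  show "cdiff (\<lambda>z. f (inv_into W \<theta> z)) (\<theta> p)"
    by (rule cdiff_cong(1)[OF S eq comp(1)])
  show "frechet_derivative (\<lambda>z. f (inv_into W \<theta> z)) (at (\<theta> p)) v =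
      frechet_derivative (\<lambda>z. f (inv_into V \<phi> z)) (at (\<phi> p))
        (\<chi> i. frechet_derivative (\<lambda>z. \<phi> (inv_into W \<theta> z) $ i) (at (\<theta> p)) v)"
    using cdiff_cong(2)[OF S eq comp(1)] comp(2)[of v] gp by simp
qed

lemma hdiff_chart:
  assumes "complex_atlas A" "hdiff A f p" "(W, \<theta>) \<in> A" "p \<in> W"
  shows "cdiff (\<lambda>z. f (inv_into W \<theta> z)) (\<theta> p)"
  using assms chart_change(1) unfolding hdiff_def by blast

lemma holo_fun_iff:
  assumes "complex_atlas A"
  shows "holo_fun A f W \<longleftrightarrow> open W \<and> (\<forall>p\<in>W. hdiff A f p)"
proof safe
  assume h: "holo_fun A f W"
  then show "open W" by (simp add: holo_fun_def)
  fix p assume "p \<in> W"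
  obtain V \<phi> where V: "(V, \<phi>) \<in> A" "p \<in> V" using atlas_cover[OF assms] .
  have "cdiff (\<lambda>z. f (inv_into V \<phi> z)) (\<phi> p)"
    using h V \<open>p \<in> W\<close> unfolding holo_fun_def holo_cn_iff by fast
  then show "hdiff A f p" using V unfolding hdiff_def by blast
next
  assume W: "open W" "\<forall>p\<in>W. hdiff A f p"
  show "holo_fun A f W"
    unfolding holo_fun_def holo_cn_iff
    using W atlas_image_open[OF assms] hdiff_chart[OF assms] by auto
qed

lemma holo_near_hdiff:
  "complex_atlas A \<Longrightarrow> holo_near A f p \<Longrightarrow> hdiff A f p"
  by (auto simp: holo_near_def holo_fun_iff)

lemma holo_fun_imp_near: "holo_fun A f W \<Longrightarrow> p \<in> W \<Longrightarrow> holo_near A f p"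
  by (auto simp: holo_near_def)

lemma holo_fun_open: "holo_fun A f W \<Longrightarrow> open W"
  by (simp add: holo_fun_def)

lemma holo_fun_subset:
  "complex_atlas A \<Longrightarrow> holo_fun A f W \<Longrightarrow> open W' \<Longrightarrow> W' \<subseteq> W \<Longrightarrow> holo_fun A f W'"
  by (auto simp: holo_fun_iff)

lemma hdiff_cong:
  assumes A: "complex_atlas A" and W: "open W" "p \<in> W" "\<And>q. q \<in> W \<Longrightarrow> f q = g q"
    and "hdiff A f p"
  shows "hdiff A g p"
proof -
  obtain V \<phi> where V: "(V, \<phi>) \<in> A" "p \<in> V" using atlas_cover[OF A] .
  have "cdiff (\<lambda>z. g (inv_into V \<phi> z)) (\<phi> p)"
  proof (rule cdiff_cong(1))
    show "open (\<phi> ` (V \<inter> W))" using atlas_image_open[OF A V(1) W(1)] .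
    show "cdiff (\<lambda>z. f (inv_into V \<phi> z)) (\<phi> p)" using hdiff_chart assms V by blast
  qed (use V W atlas_chart[OF A V(1)] in auto)
  then show ?thesis using V unfolding hdiff_def by blast
qed

lemma holo_fun_cong:
  assumes "complex_atlas A" "holo_fun A f W" "\<And>q. q \<in> W \<Longrightarrow> f q = g q"
  shows "holo_fun A g W"
  using assms hdiff_cong[OF assms(1), of W _ f g] by (auto simp: holo_fun_iff)

lemma holo_fun_locally:
  assumes "complex_atlas A" "open W"
    and "\<And>p. p \<in> W \<Longrightarrow> \<exists>W'. p \<in> W' \<and> holo_fun A f W'"
  shows "holo_fun A f W"
  using assms by (auto simp: holo_fun_iff)

lemma hdiff_compose2:
  assumes A: "complex_atlas A"
    and h: "(h has_derivative (\<lambda>k. a * fst k + b * snd k)) (at (f1 p, f2 p))"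
    and f: "hdiff A f1 p" "hdiff A f2 p"
  shows "hdiff A (\<lambda>q. h (f1 q, f2 q)) p"
proof -
  obtain V \<phi> where V: "(V, \<phi>) \<in> A" "p \<in> V" using atlas_cover[OF A] .
  have p: "inv_into V \<phi> (\<phi> p) = p" using V atlas_chart[OF A V(1)] by simp
  have "cdiff (\<lambda>z. h (f1 (inv_into V \<phi> z), f2 (inv_into V \<phi> z))) (\<phi> p)"
    by (rule cdiff_compose2[where a = a and b = b])
      (use h p hdiff_chart[OF A f(1) V] hdiff_chart[OF A f(2) V] in auto)
  then show ?thesis using V unfolding hdiff_def by blast
qed

lemma hdiff_const: "complex_atlas A \<Longrightarrow> hdiff A (\<lambda>q. c) p"
proof -
  assume A: "complex_atlas A"
  obtain V \<phi> where V: "(V, \<phi>) \<in> A" "p \<in> V" using atlas_cover[OF A] .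
  have "cdiff (\<lambda>z. c) (\<phi> p)"
    unfolding cdiff_def by (intro exI[of _ "\<lambda>h. 0"]) simp
  then show ?thesis using V unfolding hdiff_def by auto
qed

lemma hdiff_add:
  assumes A: "complex_atlas A" and f: "hdiff A f p" "hdiff A g p"
  shows "hdiff A (\<lambda>q. f q + g q) p"
proof -
  have "hdiff A (\<lambda>q. (\<lambda>k. fst k + snd k) (f q, g q)) p"
    by (rule hdiff_compose2[OF A _ f, where a = 1 and b = 1]) (auto intro!: derivative_eq_intros)
  then show ?thesis by simp
qed

lemma hdiff_mult:
  assumes A: "complex_atlas A" and f: "hdiff A f p" "hdiff A g p"
  shows "hdiff A (\<lambda>q. f q * g q) p"
proof -
  have "hdiff A (\<lambda>q. (\<lambda>k. fst k * snd k) (f q, g q)) p"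
    by (rule hdiff_compose2[OF A _ f, where a = "g p" and b = "f p"])
      (auto intro!: derivative_eq_intros simp: algebra_simps)
  then show ?thesis by simp
qed

lemma hdiff_sum:
  assumes A: "complex_atlas A" and "finite I" "\<And>i. i \<in> I \<Longrightarrow> hdiff A (f i) p"
  shows "hdiff A (\<lambda>q. \<Sum>i\<in>I. f i q) p"
  using assms(2,3) by (induction I) (auto intro: hdiff_const[OF A] hdiff_add[OF A])

lemma hdiff_power:
  assumes A: "complex_atlas A" and "hdiff A f p"
  shows "hdiff A (\<lambda>q. f q ^ n) p"
  by (induction n) (auto intro: hdiff_const[OF A] hdiff_mult[OF A] assms)

lemma hdiff_chart_coord:
  assumes A: "complex_atlas A" and V: "(V, \<phi>) \<in> A" "p \<in> V"
  shows "hdiff A (\<lambda>q. \<phi> q $ i) p"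
  using atlas_transition[OF A V(1) V(1) V(2) V(2)] V unfolding hdiff_def by blast

lemma hdiff_tendsto:
  assumes A: "complex_atlas A" and "hdiff A f p"
  shows "(f \<longlongrightarrow> f p) (nhds p)"
proof -
  obtain V \<phi> where V: "(V, \<phi>) \<in> A" "p \<in> V" using atlas_cover[OF A] .
  note c = atlas_chart[OF A V(1)]
  have "isCont (\<lambda>z. f (inv_into V \<phi> z)) (\<phi> p)"
    using cdiffD(1)[OF hdiff_chart[OF A assms(2) V]] has_derivative_continuous by blast
  then have 1: "((\<lambda>z. f (inv_into V \<phi> z)) \<longlongrightarrow> f (inv_into V \<phi> (\<phi> p))) (nhds (\<phi> p))"
    unfolding isCont_def
    using tendsto_at_iff_tendsto_nhds[where g = "\<lambda>z. f (inv_into V \<phi> z)"] by blast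
  have "(\<phi> \<longlongrightarrow> \<phi> p) (at p)"
    using c(1,3) V(2) unfolding continuous_on_def by (metis at_within_open)
  then have 2: "(\<phi> \<longlongrightarrow> \<phi> p) (nhds p)"
    using tendsto_at_iff_tendsto_nhds[of \<phi> p] by blast
  have "((\<lambda>q. f (inv_into V \<phi> (\<phi> q))) \<longlongrightarrow> f (inv_into V \<phi> (\<phi> p))) (nhds p)"
    by (rule filterlim_compose[OF 1 2])
  moreover have "\<forall>\<^sub>F q in nhds p. q \<in> V" using V c eventually_nhds_in_open by blast
  then have "\<forall>\<^sub>F q in nhds p. f (inv_into V \<phi> (\<phi> q)) = f q"
    by eventually_elim (use c in simp)
  moreover have "inv_into V \<phi> (\<phi> p) = p" using c(5) V(2) by simp
  ultimately show ?thesis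
    using tendsto_cong[of "\<lambda>q. f (inv_into V \<phi> (\<phi> q))" f "nhds p"] by simp
qed

lemma holo_fun_continuous_on:
  assumes "complex_atlas A" "holo_fun A f W"
  shows "continuous_on W f"
  unfolding continuous_on_def
proof
  fix p assume "p \<in> W"
  then have "(f \<longlongrightarrow> f p) (nhds p)"
    using assms(2) hdiff_tendsto[OF assms(1)] unfolding holo_fun_iff[OF assms(1)] by blast
  then show "(f \<longlongrightarrow> f p) (at p within W)"
    unfolding at_within_def by (rule filterlim_mono) auto
qed

lemma holo_mapD:
  assumes "holo_map A B F W"
  shows "open W" "continuous_on W F"
    "(V, \<phi>) \<in> B \<Longrightarrow> holo_fun A (\<lambda>p. \<phi> (F p) $ i) (W \<inter> F -` V)"
  using assms unfolding holo_map_def by fast+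

lemma hdiff_compose_map:
  assumes A: "complex_atlas A" and B: "complex_atlas B"
    and F: "holo_map A B F W" and p: "p \<in> W" and f: "hdiff B f (F p)"
  shows "hdiff A (\<lambda>q. f (F q)) p"
proof -
  obtain V \<phi> where V: "(V, \<phi>) \<in> A" "p \<in> V" using atlas_cover[OF A] .
  obtain V' \<theta> where V': "(V', \<theta>) \<in> B" "F p \<in> V'" using atlas_cover[OF B] .
  note c = atlas_chart[OF A V(1)] and c' = atlas_chart[OF B V'(1)]
  have W: "open W" "continuous_on W F" using F by (auto simp: holo_map_def)
  let ?W = "W \<inter> F -` V'"
  have oW: "open ?W" using W c' continuous_open_preimage by blast
  have inv: "inv_into V \<phi> (\<phi> p) = p" using c V by simp
  have co: "hdiff A (\<lambda>q. \<theta> (F q) $ i) p" for i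
  proof -
    have "holo_fun A (\<lambda>q. \<theta> (F q) $ i) ?W" by (rule holo_mapD(3)[OF F V'(1)])
    then show ?thesis using p V' unfolding holo_fun_iff[OF A] by simp
  qed
  have "cdiff (\<lambda>z. f (inv_into V' \<theta> (\<theta> (F (inv_into V \<phi> z))))) (\<phi> p)"
    by (rule cdiff_compose(1)[where f = "\<lambda>z. f (inv_into V' \<theta> z)"])
      (use hdiff_chart[OF B f V'] hdiff_chart[OF A co V] inv in auto)
  then have "cdiff (\<lambda>z. f (F (inv_into V \<phi> z))) (\<phi> p)"
    by (rule cdiff_cong(1)[rotated 3, where S = "\<phi> ` (V \<inter> ?W)"])
      (use atlas_image_open[OF A V(1) oW] V p V' c c' in auto)
  then show ?thesis using V unfolding hdiff_def by blast
qed

lemma holo_fun_compose_map: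
  assumes "complex_atlas A" "complex_atlas B" "holo_map A B F W" "holo_fun B f W'"
  shows "holo_fun A (\<lambda>q. f (F q)) (W \<inter> F -` W')"
  using assms hdiff_compose_map[OF assms(1-3), of _ f] continuous_open_preimage[of W F W']
  by (auto simp: holo_fun_iff holo_map_def)

section \<open>Tangent vectors\<close>

lemma chart_tvec_near:
  "holo_near A f p \<Longrightarrow> chart_tvec A (V, \<phi>) p w f = frechet_derivative (\<lambda>z. f (inv_into V \<phi> z)) (at (\<phi> p)) w"
  by (simp add: chart_tvec_def)

lemma tangent_not_near: "v \<in> tangent_space A p \<Longrightarrow> \<not> holo_near A f p \<Longrightarrow> v f = 0"
  by (auto simp: tangent_space_def chart_tvec_def)

lemma chart_tvec_in_tangent:
  "(V, \<phi>) \<in> A \<Longrightarrow> p \<in> V \<Longrightarrow> chart_tvec A (V, \<phi>) p w \<in> tangent_space A p"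
  unfolding tangent_space_def by (intro CollectI exI[of _ "(V, \<phi>)"] exI[of _ w]) simp

lemma tangent_in_chart:
  assumes A: "complex_atlas A" and v: "v \<in> tangent_space A p" and W: "(W, \<theta>) \<in> A" "p \<in> W"
  obtains w where "v = chart_tvec A (W, \<theta>) p w"
proof -
  obtain V \<phi> u where V: "(V, \<phi>) \<in> A" "p \<in> V" "v = chart_tvec A (V, \<phi>) p u"
    using v by (auto simp: tangent_space_def)
  let ?w = "\<chi> i. frechet_derivative (\<lambda>z. \<theta> (inv_into V \<phi> z) $ i) (at (\<phi> p)) u"
  have "v f = chart_tvec A (W, \<theta>) p ?w f" for f
  proof (cases "holo_near A f p")
    case True
    then have "cdiff (\<lambda>z. f (inv_into W \<theta> z)) (\<theta> p)"
      using hdiff_chart[OF A holo_near_hdiff[OF A] W] by blast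
    from chart_change(2)[OF A W(1) V(1) W(2) V(2) this] show ?thesis
      using True V(3) by (simp add: chart_tvec_near)
  qed (simp add: V(3) chart_tvec_def)
  then show ?thesis using that by blast
qed

text \<open>Being holomorphic near \<open>p\<close> depends only on the germ, so the two functions
  either have equal derivatives or both receive the default value \<open>0\<close>.\<close>

lemma tangent_cong:
  assumes A: "complex_atlas A" and v: "v \<in> tangent_space A p"
    and W: "open W" "p \<in> W" "\<And>q. q \<in> W \<Longrightarrow> f q = g q"
  shows "v f = v g"
proof -
  obtain V \<phi> w where V: "(V, \<phi>) \<in> A" "p \<in> V" "v = chart_tvec A (V, \<phi>) p w"
    using v by (auto simp: tangent_space_def)
  have imp: "holo_near A g p" if "holo_near A f p" "\<And>q. q \<in> W \<Longrightarrow> f q = g q" for f g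
  proof -
    obtain U where U: "p \<in> U" "holo_fun A f U" using \<open>holo_near A f p\<close> by (auto simp: holo_near_def)
    have "holo_fun A f (U \<inter> W)"
      using holo_fun_subset[OF A U(2)] W(1) holo_fun_open[OF U(2)] by auto
    then have "holo_fun A g (U \<inter> W)" by (rule holo_fun_cong[OF A]) (use that in auto)
    then show ?thesis using U W by (auto simp: holo_near_def)
  qed
  show ?thesis
  proof (cases "holo_near A f p")
    case True
    then have g: "holo_near A g p" using imp W by blast
    have c: "cdiff (\<lambda>z. f (inv_into V \<phi> z)) (\<phi> p)"
      using True V hdiff_chart[OF A holo_near_hdiff[OF A]] by blast
    have "frechet_derivative (\<lambda>z. g (inv_into V \<phi> z)) (at (\<phi> p)) =
      frechet_derivative (\<lambda>z. f (inv_into V \<phi> z)) (at (\<phi> p))"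
      by (rule cdiff_cong(2)[OF atlas_image_open[OF A V(1) W(1)] _ _ c])
        (use V W atlas_chart[OF A V(1)] in auto)
    then show ?thesis using True g V by (simp add: chart_tvec_near)
  next
    case False
    then have "\<not> holo_near A g p" using imp[of g f] W by auto
    then show ?thesis using False V by (simp add: chart_tvec_def)
  qed
qed

text \<open>The chain rule for an outer function of two variables. Additivity and homogeneity of
  tangent vectors are the cases of a sum and of a scalar multiple.\<close>

lemma tangent_compose2:
  assumes A: "complex_atlas A" and v: "v \<in> tangent_space A p"
    and f: "holo_near A f1 p" "holo_near A f2 p" "holo_near A (\<lambda>q. h (f1 q, f2 q)) p"
    and h: "(h has_derivative (\<lambda>k. a * fst k + b * snd k)) (at (f1 p, f2 p))"
  shows "v (\<lambda>q. h (f1 q, f2 q)) = a * v f1 + b * v f2"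
proof -
  obtain V \<phi> w where V: "(V, \<phi>) \<in> A" "p \<in> V" "v = chart_tvec A (V, \<phi>) p w"
    using v by (auto simp: tangent_space_def)
  have p: "inv_into V \<phi> (\<phi> p) = p" using V atlas_chart[OF A V(1)] by simp
  show ?thesis
    unfolding V(3) chart_tvec_near[OF f(1)] chart_tvec_near[OF f(2)] chart_tvec_near[OF f(3)]
    by (rule cdiff_compose2(2))
      (use h p hdiff_chart[OF A holo_near_hdiff[OF A] V(1,2)] f in auto)
qed

lemma tangent_const:
  assumes A: "complex_atlas A" and v: "v \<in> tangent_space A p"
  shows "v (\<lambda>q. c) = 0"
proof -
  obtain V \<phi> w where V: "(V, \<phi>) \<in> A" "p \<in> V" "v = chart_tvec A (V, \<phi>) p w"
    using v by (auto simp: tangent_space_def)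
  have "frechet_derivative (\<lambda>z. c) (at (\<phi> p)) = (\<lambda>h. 0)"
    using frechet_derivative_at[OF has_derivative_const] by metis
  then show ?thesis by (auto simp: V(3) chart_tvec_def)
qed

lemma holo_near_iff:
  assumes A: "complex_atlas A"
  shows "holo_near A f p \<longleftrightarrow> (\<exists>W. open W \<and> p \<in> W \<and> (\<forall>q\<in>W. hdiff A f q))"
  unfolding holo_near_def holo_fun_iff[OF A] by blast

lemma holo_near_add:
  assumes "complex_atlas A" "holo_near A f p" "holo_near A g p"
  shows "holo_near A (\<lambda>q. f q + g q) p"
proof -
  obtain U U' where "open U" "p \<in> U" "\<forall>q\<in>U. hdiff A f q" "open U'" "p \<in> U'" "\<forall>q\<in>U'. hdiff A g q"
    using assms(2,3) unfolding holo_near_iff[OF assms(1)] by auto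
  then show ?thesis unfolding holo_near_iff[OF assms(1)]
    by (intro exI[of _ "U \<inter> U'"]) (auto intro: hdiff_add[OF assms(1)])
qed

lemma holo_near_mult:
  assumes "complex_atlas A" "holo_near A f p" "holo_near A g p"
  shows "holo_near A (\<lambda>q. f q * g q) p"
proof -
  obtain U U' where "open U" "p \<in> U" "\<forall>q\<in>U. hdiff A f q" "open U'" "p \<in> U'" "\<forall>q\<in>U'. hdiff A g q"
    using assms(2,3) unfolding holo_near_iff[OF assms(1)] by auto
  then show ?thesis unfolding holo_near_iff[OF assms(1)]
    by (intro exI[of _ "U \<inter> U'"]) (auto intro: hdiff_mult[OF assms(1)])
qed

lemma holo_near_const: "complex_atlas A \<Longrightarrow> holo_near A (\<lambda>q. c) p"
  unfolding holo_near_iff using hdiff_const by blast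

lemma tangent_add:
  assumes A: "complex_atlas A" and v: "v \<in> tangent_space A p"
    and f: "holo_near A f p" "holo_near A g p"
  shows "v (\<lambda>q. f q + g q) = v f + v g"
proof -
  have "((\<lambda>k. fst k + snd k) has_derivative (\<lambda>k. 1 * fst k + 1 * snd k)) (at (f p, g p))"
    by (auto intro!: derivative_eq_intros)
  from tangent_compose2[OF A v f _ this] holo_near_add[OF A f] show ?thesis by simp
qed

lemma tangent_cmult:
  assumes A: "complex_atlas A" and v: "v \<in> tangent_space A p" and f: "holo_near A f p"
  shows "v (\<lambda>q. c * f q) = c * v f"
proof -
  have "((\<lambda>k. c * fst k) has_derivative (\<lambda>k. c * fst k + 0 * snd k)) (at (f p, f p))"
    by (auto intro!: derivative_eq_intros)
  from tangent_compose2[OF A v f f _ this] holo_near_mult[OF A holo_near_const[OF A] f]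
  show ?thesis by simp
qed

lemma tangent_linear_comb:
  assumes A: "complex_atlas A" and v: "v \<in> tangent_space A p" and "finite I"
    and f: "\<And>i. i \<in> I \<Longrightarrow> holo_near A (f i) p"
  shows "holo_near A (\<lambda>q. \<Sum>i\<in>I. c i * f i q) p"
    and "v (\<lambda>q. \<Sum>i\<in>I. c i * f i q) = (\<Sum>i\<in>I. c i * v (f i))"
proof -
  have "holo_near A (\<lambda>q. \<Sum>i\<in>I. c i * f i q) p \<and> v (\<lambda>q. \<Sum>i\<in>I. c i * f i q) = (\<Sum>i\<in>I. c i * v (f i))"
    using \<open>finite I\<close> f
  proof (induction I)
    case empty
    then show ?case using holo_near_const[OF A] tangent_const[OF A v] by simp
  next
    case (insert i I)
    then have "holo_near A (\<lambda>q. c i * f i q) p"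
      using holo_near_mult[OF A holo_near_const[OF A], of "f i" p "c i"] by simp
    then show ?case
      using insert tangent_add[OF A v] tangent_cmult[OF A v] holo_near_add[OF A] by simp
  qed
  then show "holo_near A (\<lambda>q. \<Sum>i\<in>I. c i * f i q) p"
    "v (\<lambda>q. \<Sum>i\<in>I. c i * f i q) = (\<Sum>i\<in>I. c i * v (f i))" by auto
qed


lemma chart_tvec_coord:
  assumes A: "complex_atlas A" and V: "(V, \<phi>) \<in> A" "p \<in> V"
  shows "chart_tvec A (V, \<phi>) p w (\<lambda>q. \<phi> q $ i) = w $ i"
proof -
  note c = atlas_chart[OF A V(1)]
  have near: "holo_near A (\<lambda>q. \<phi> q $ i) p"
    unfolding holo_near_iff[OF A] by (rule exI[of _ V]) (use hdiff_chart_coord[OF A V(1)] c(1) V(2) in simp)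
  have "((\<lambda>z. z $ i) has_derivative (\<lambda>h. h $ i)) (at (\<phi> p))"
    by (intro bounded_linear_imp_has_derivative bounded_linear_vec_nth)
  then have "((\<lambda>z. \<phi> (inv_into V \<phi> z) $ i) has_derivative (\<lambda>h. h $ i)) (at (\<phi> p))"
    by (rule has_derivative_transform_within_open[OF _ c(2)]) (use V(2) in \<open>auto simp: f_inv_into_f\<close>)
  from fun_cong[OF frechet_derivative_at[OF this], of w] show ?thesis
    unfolding chart_tvec_near[OF near] by (rule sym)
qed

lemma chart_tvec_comb:
  assumes A: "complex_atlas A" and V: "(V, \<phi>) \<in> A" "p \<in> V"
  shows "chart_tvec A (V, \<phi>) p (a *s w + b *s w') =
    (\<lambda>f. a * chart_tvec A (V, \<phi>) p w f + b * chart_tvec A (V, \<phi>) p w' f)"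
proof
  fix f
  show "chart_tvec A (V, \<phi>) p (a *s w + b *s w') f =
    a * chart_tvec A (V, \<phi>) p w f + b * chart_tvec A (V, \<phi>) p w' f"
  proof (cases "holo_near A f p")
    case True
    have c: "cdiff (\<lambda>z. f (inv_into V \<phi> z)) (\<phi> p)"
      by (rule hdiff_chart[OF A holo_near_hdiff[OF A True] V])
    have "linear (frechet_derivative (\<lambda>z. f (inv_into V \<phi> z)) (at (\<phi> p)))"
      using cdiffD(1)[OF c] has_derivative_linear by blast
    then show ?thesis
      by (simp add: chart_tvec_near[OF True] linear_add cdiffD(2)[OF c])
  qed (simp add: chart_tvec_def)
qed

lemma tangent_space_comb:
  assumes A: "complex_atlas A" and v: "v \<in> tangent_space A p" "v' \<in> tangent_space A p"
  shows "(\<lambda>f. a * v f + b * v' f) \<in> tangent_space A p"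
proof -
  obtain V \<phi> where V: "(V, \<phi>) \<in> A" "p \<in> V" using atlas_cover[OF A] .
  obtain w where w: "v = chart_tvec A (V, \<phi>) p w" using tangent_in_chart[OF A v(1) V] .
  obtain w' where w': "v' = chart_tvec A (V, \<phi>) p w'" using tangent_in_chart[OF A v(2) V] .
  show ?thesis
    unfolding w w' chart_tvec_comb[OF A V, symmetric] by (rule chart_tvec_in_tangent[OF V])
qed

text \<open>Cramer's rule for the values on \<open>f1\<close> and \<open>f2\<close>, using that the
  tangent space is closed under linear combinations.\<close>

lemma tangent_space_solve:
  assumes A: "complex_atlas A" and v: "v \<in> tangent_space A p" "v' \<in> tangent_space A p"
    and det: "v f1 * v' f2 - v f2 * v' f1 \<noteq> 0"
  obtains u where "u \<in> tangent_space A p" "u f1 = a" "u f2 = b"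
proof -
  define d where "d = v f1 * v' f2 - v f2 * v' f1"
  define u where "u = (\<lambda>f. (a * v' f2 - b * v' f1) / d * v f + (v f1 * b - v f2 * a) / d * v' f)"
  have "u \<in> tangent_space A p" unfolding u_def by (rule tangent_space_comb[OF A v])
  moreover have "u f1 = a * (d / d)" "u f2 = b * (d / d)"
    unfolding u_def by (simp_all add: d_def field_simps flip: add_divide_distrib diff_divide_distrib)
  ultimately show ?thesis using that det by (simp add: d_def)
qed

section \<open>Coordinates on complex surfaces\<close>

text \<open>Charts take values in \<open>complex ^ 2\<close>, whereas partial derivatives and the
  bidisc arguments live on pairs; \<open>vec2\<close> and \<open>unvec2\<close> translate.\<close>

definition vec2 :: "complex \<times> complex \<Rightarrow> complex ^ 2" where
  "vec2 k = fst k *s axis 1 1 + snd k *s axis 2 1"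

definition unvec2 :: "complex ^ 2 \<Rightarrow> complex \<times> complex" where
  "unvec2 w = (w $ 1, w $ 2)"

lemma vec2_nth [simp]: "vec2 k $ 1 = fst k" "vec2 k $ 2 = snd k"
  by (simp_all add: vec2_def axis_def)

lemma vec2_unvec2 [simp]: "vec2 (unvec2 w) = w" "unvec2 (vec2 k) = k"
  by (simp_all add: vec_eq_iff forall_2 unvec2_def)

lemma vec2_has_derivative: "(vec2 has_derivative vec2) (at z)"
proof (rule has_derivative_vec_componentwise)
  fix i :: 2
  have "i = 1 \<or> i = 2" using exhaust_2 by auto
  then show "((\<lambda>x. vec2 x $ i) has_derivative (\<lambda>h. vec2 h $ i)) (at z)"
    by (elim disjE) (auto intro!: derivative_eq_intros)
qed

lemma chart_has_derivative2:
  assumes B: "complex_atlas B" and V: "(V, \<phi>) \<in> B" "p \<in> V" and h: "hdiff B h p"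
  defines "L \<equiv> frechet_derivative (\<lambda>z. h (inv_into V \<phi> z)) (at (\<phi> p))"
  shows "((\<lambda>z. h (inv_into V \<phi> (vec2 z))) has_derivative
      (\<lambda>k. L (axis 1 1) * fst k + L (axis 2 1) * snd k)) (at (unvec2 (\<phi> p)))"
    and "L w = L (axis 1 1) * w $ 1 + L (axis 2 1) * w $ 2"
proof -
  note c = hdiff_chart[OF B h V]
  have lin: "linear L" unfolding L_def using cdiffD(1)[OF c] has_derivative_linear by blast
  have L: "L (vec2 k) = L (axis 1 1) * fst k + L (axis 2 1) * snd k" for k
    unfolding vec2_def linear_add[OF lin] unfolding L_def cdiffD(2)[OF c] by simp
  from L[of "unvec2 w"] show "L w = L (axis 1 1) * w $ 1 + L (axis 2 1) * w $ 2"
    unfolding vec2_unvec2 by (simp add: unvec2_def)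
  have "((\<lambda>z. h (inv_into V \<phi> z)) has_derivative L) (at (vec2 (unvec2 (\<phi> p))))"
    unfolding L_def using cdiffD(1)[OF c] by simp
  from has_derivative_compose[OF vec2_has_derivative this]
  show "((\<lambda>z. h (inv_into V \<phi> (vec2 z))) has_derivative
      (\<lambda>k. L (axis 1 1) * fst k + L (axis 2 1) * snd k)) (at (unvec2 (\<phi> p)))"
    by (simp add: L)
qed

lemma continuous_on_vec2: "continuous_on S vec2"
  by (intro continuous_at_imp_continuous_on ballI has_derivative_continuous[OF vec2_has_derivative])

lemma chart_holo2:
  assumes B: "complex_atlas B" and V: "(V, \<phi>) \<in> B" and h: "holo_fun B h W"
  shows "holo2 (\<lambda>z. h (inv_into V \<phi> (vec2 z))) (vec2 -` (\<phi> ` (V \<inter> W)))"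
  unfolding holo2_def
proof (intro conjI ballI)
  show "open (vec2 -` (\<phi> ` (V \<inter> W)))"
    by (rule open_vimage[OF atlas_image_open[OF B V holo_fun_open[OF h]] continuous_on_vec2])
  fix z assume "z \<in> vec2 -` (\<phi> ` (V \<inter> W))"
  then obtain p where p: "p \<in> V" "p \<in> W" "vec2 z = \<phi> p" by auto
  then have z: "z = unvec2 (\<phi> p)" using vec2_unvec2(2)[of z] by metis
  have "hdiff B h p" using h p unfolding holo_fun_iff[OF B] by simp
  from chart_has_derivative2(1)[OF B V p(1) this]
  show "\<exists>a b. ((\<lambda>z. h (inv_into V \<phi> (vec2 z))) has_derivative (\<lambda>h. a * fst h + b * snd h)) (at z)"
    unfolding z by blast
qed

text \<open>\<open>f1\<close> and \<open>f2\<close> are coordinates on \<open>N\<close>, and \<open>\<kappa>\<close> is the inverse of the coordinate map.\<close>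

definition coord_box :: "('g::topological_space, 2) atlas \<Rightarrow> 'g set \<Rightarrow> ('g \<Rightarrow> complex) \<Rightarrow>
    ('g \<Rightarrow> complex) \<Rightarrow> complex set \<Rightarrow> complex set \<Rightarrow> (complex \<times> complex \<Rightarrow> 'g) \<Rightarrow> bool" where
  "coord_box B N f1 f2 P Q \<kappa> \<longleftrightarrow>
     open N \<and> open P \<and> open Q \<and> convex P \<and> convex Q \<and> holo_fun B f1 N \<and> holo_fun B f2 N \<and>
     continuous_on (P \<times> Q) \<kappa> \<and>
     (\<forall>k\<in>N. f1 k \<in> P \<and> f2 k \<in> Q \<and> \<kappa> (f1 k, f2 k) = k) \<and>
     (\<forall>z\<in>P. \<forall>w\<in>Q. \<kappa> (z, w) \<in> N \<and> f1 (\<kappa> (z, w)) = z \<and> f2 (\<kappa> (z, w)) = w) \<and>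
     (\<forall>h W. holo_fun B h W \<longrightarrow> holo2 (h \<circ> \<kappa>) (P \<times> Q \<inter> \<kappa> -` W))"

lemma coord_boxD:
  assumes "coord_box B N f1 f2 P Q \<kappa>"
  shows "open N" "open P" "open Q" "convex P" "convex Q" "holo_fun B f1 N" "holo_fun B f2 N"
    "continuous_on (P \<times> Q) \<kappa>"
    "k \<in> N \<Longrightarrow> f1 k \<in> P" "k \<in> N \<Longrightarrow> f2 k \<in> Q" "k \<in> N \<Longrightarrow> \<kappa> (f1 k, f2 k) = k"
    "z \<in> P \<Longrightarrow> w \<in> Q \<Longrightarrow> \<kappa> (z, w) \<in> N" "z \<in> P \<Longrightarrow> w \<in> Q \<Longrightarrow> f1 (\<kappa> (z, w)) = z"
    "z \<in> P \<Longrightarrow> w \<in> Q \<Longrightarrow> f2 (\<kappa> (z, w)) = w"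
    "holo_fun B h W \<Longrightarrow> holo2 (h \<circ> \<kappa>) (P \<times> Q \<inter> \<kappa> -` W)"
  using assms unfolding coord_box_def by auto

text \<open>A slice is the continuous image under \<open>\<kappa>\<close> of a product of convex
  sets. This is why the box is required to have convex sides.\<close>

lemma coord_box_slices:
  assumes box: "coord_box B N f1 f2 P Q \<kappa>"
  shows "connected {k \<in> N. f1 k = a}" and "connected {k \<in> N. f2 k = a}"
proof -
  note b = coord_boxD[OF box]
  have conn: "connected (\<kappa> ` (P' \<times> Q'))" if "convex P'" "convex Q'" "P' \<subseteq> P" "Q' \<subseteq> Q" for P' Q'
    using that by (intro connected_continuous_image continuous_on_subset[OF b(8)] connected_Times
        convex_connected) auto
  have 1: "{k \<in> N. f1 k = a} = \<kappa> ` ((P \<inter> {a}) \<times> Q)" and 2: "{k \<in> N. f2 k = a} = \<kappa> ` (P \<times> (Q \<inter> {a}))"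
    using b(9-14) by (auto intro!: rev_image_eqI[of "(f1 _, f2 _)"])
  show "connected {k \<in> N. f1 k = a}" unfolding 1 by (rule conn) (use b(4,5) in \<open>auto intro: convex_Int\<close>)
  show "connected {k \<in> N. f2 k = a}" unfolding 2 by (rule conn) (use b(4,5) in \<open>auto intro: convex_Int\<close>)
qed

lemma complex_linear_pair:
  fixes L :: "complex \<times> complex \<Rightarrow> complex"
  assumes "linear L" "\<And>c k. L (c * fst k, c * snd k) = c * L k"
  shows "L k = L (1, 0) * fst k + L (0, 1) * snd k"
proof -
  let ?a = "(1, 0) :: complex \<times> complex" and ?b = "(0, 1) :: complex \<times> complex"
  have "L k = L ((fst k * fst ?a, fst k * snd ?a) + (snd k * fst ?b, snd k * snd ?b))"
    by simp
  also have "\<dots> = fst k * L (1, 0) + snd k * L (0, 1)"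
    unfolding linear_add[OF assms(1)] assms(2) by simp
  finally show ?thesis by (simp add: mult.commute)
qed

text \<open>The holomorphic inverse function theorem. The two vectors witness that the Jacobian of
  \<open>(f1, f2)\<close> is invertible at \<open>g\<close>; the real theorem gives a differentiable
  inverse, and its derivative is complex linear because it inverts a complex linear map.\<close>

lemma coord_box_exists:
  fixes B :: "('g::topological_space, 2) atlas"
  assumes B: "complex_atlas B" and f: "holo_fun B f1 U" "holo_fun B f2 U" and g: "g \<in> U"
    and v: "v \<in> tangent_space B g" "v' \<in> tangent_space B g"
    and det: "v f1 * v' f2 - v f2 * v' f1 \<noteq> 0"
  obtains N P Q \<kappa> where "g \<in> N" "N \<subseteq> U" "coord_box B N f1 f2 P Q \<kappa>"
proof -
  obtain V \<phi> where V: "(V, \<phi>) \<in> B" "g \<in> V" using atlas_cover[OF B] .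
  note c = atlas_chart[OF B V(1)]
  define F1 where "F1 = (\<lambda>z. f1 (inv_into V \<phi> (vec2 z)))"
  define F2 where "F2 = (\<lambda>z. f2 (inv_into V \<phi> (vec2 z)))"
  define T where "T = vec2 -` (\<phi> ` (V \<inter> U))"
  define F where "F = (\<lambda>z. (F1 z, F2 z))"
  define x0 where "x0 = unvec2 (\<phi> g)"
  have h1: "holo2 F1 T" and h2: "holo2 F2 T"
    unfolding F1_def F2_def T_def using chart_holo2[OF B V(1)] f by auto
  have T: "open T" using h1 by (rule holo2_open)
  have x0: "x0 \<in> T" using V g by (auto simp: x0_def T_def)
  define D where "D = (\<lambda>z k. (pd1 F1 z * fst k + pd2 F1 z * snd k, pd1 F2 z * fst k + pd2 F2 z * snd k))"
  have FD: "(F has_derivative D z) (at z)" if "z \<in> T" for z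
    unfolding F_def D_def by (intro has_derivative_Pair holo2_has_derivative[OF h1 that] holo2_has_derivative[OF h2 that])
  define F' where "F' = (\<lambda>z. Blinfun (D z))"
  have F': "blinfun_apply (F' z) = D z" if "z \<in> T" for z
    unfolding F'_def using has_derivative_bounded_linear[OF FD[OF that]]
    by (rule bounded_linear_Blinfun_apply)
  have contF': "continuous_on T F'"
  proof (rule continuous_on_blinfun_componentwise)
    fix i :: "complex \<times> complex"
    have "continuous_on T (\<lambda>z. D z i)"
      unfolding D_def
      by (intro continuous_intros sep_holo_pd1_continuous sep_holo_pd2_continuous holo2_sep_holo h1 h2)
    then show "continuous_on T (\<lambda>z. blinfun_apply (F' z) i)"
      by (rule continuous_on_eq) (simp add: F')
  qed
  have val: "u f = pd1 (\<lambda>z. f (inv_into V \<phi> (vec2 z))) x0 * w $ 1 + pd2 (\<lambda>z. f (inv_into V \<phi> (vec2 z))) x0 * w $ 2"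
    if "u = chart_tvec B (V, \<phi>) g w" "holo_fun B f U" for u f w
  proof -
    have near: "holo_near B f g" using that(2) g holo_fun_imp_near by blast
    note d = chart_has_derivative2[OF B V holo_near_hdiff[OF B near]]
    have *: "pd1 (\<lambda>z. f (inv_into V \<phi> (vec2 z))) x0 =
       frechet_derivative (\<lambda>z. f (inv_into V \<phi> z)) (at (\<phi> g)) (axis 1 1)"
     "pd2 (\<lambda>z. f (inv_into V \<phi> (vec2 z))) x0 =
       frechet_derivative (\<lambda>z. f (inv_into V \<phi> z)) (at (\<phi> g)) (axis 2 1)"
      using partials_of_derivative[of _ _ _ "fst x0" "snd x0"] d(1)
      by (auto simp: pd1_def pd2_def x0_def intro!: DERIV_imp_deriv)
    show ?thesis unfolding that(1) chart_tvec_near[OF near] * by (rule d(2))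
  qed
  obtain w where w: "v = chart_tvec B (V, \<phi>) g w" using tangent_in_chart[OF B v(1) V] .
  obtain w' where w': "v' = chart_tvec B (V, \<phi>) g w'" using tangent_in_chart[OF B v(2) V] .
  define d where "d = pd1 F1 x0 * pd2 F2 x0 - pd2 F1 x0 * pd1 F2 x0"
  \<comment> \<open>The matrix of values is the Jacobian matrix times the matrix of components of
    \<open>v\<close> and \<open>v'\<close>, and determinants multiply.\<close>
  have "v f1 * v' f2 - v f2 * v' f1 = d * (w $ 1 * w' $ 2 - w $ 2 * w' $ 1)"
    unfolding val[OF w f(1)] val[OF w f(2)] val[OF w' f(1)] val[OF w' f(2)] d_def F1_def F2_def
    by (simp add: algebra_simps)
  then have d: "d \<noteq> 0" using det by auto
  \<comment> \<open>The inverse of the Jacobian matrix at \<open>x0\<close> by cofactors.\<close>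
  define I where "I = (\<lambda>k::complex \<times> complex. ((pd2 F2 x0 * fst k - pd2 F1 x0 * snd k) / d,
      (pd1 F1 x0 * snd k - pd1 F2 x0 * fst k) / d))"
  have "(I has_derivative I) (at 0)"
    unfolding I_def using d by (auto intro!: derivative_eq_intros)
  then have I: "blinfun_apply (Blinfun I) = I"
    using bounded_linear_Blinfun_apply has_derivative_bounded_linear by blast
  have ID: "I (D x0 k) = k" for k
  proof -
    have "pd2 F2 x0 * fst (D x0 k) - pd2 F1 x0 * snd (D x0 k) = d * fst k"
      "pd1 F1 x0 * snd (D x0 k) - pd1 F2 x0 * fst (D x0 k) = d * snd k"
      by (simp_all add: D_def d_def algebra_simps)
    then show ?thesis using d by (simp add: I_def)
  qed
  have inv: "Blinfun I o\<^sub>L F' x0 = id_blinfun"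
    by (rule blinfun_eqI) (simp add: I F'[OF x0] ID)
  have FD': "(F has_derivative blinfun_apply (F' z)) (at z)" if "z \<in> T" for z
    unfolding F'[OF that] using FD[OF that] .
  obtain U' V' G G' where ift: "open U'" "U' \<subseteq> T" "x0 \<in> U'" "open V'" "F x0 \<in> V'"
    "homeomorphism U' V' F G" "\<And>y. y \<in> V' \<Longrightarrow> (G has_derivative (G' y)) (at y)"
    "\<And>y. y \<in> V' \<Longrightarrow> G' y = inv (blinfun_apply (F' (G y)))"
    "\<And>y. y \<in> V' \<Longrightarrow> bij (blinfun_apply (F' (G y)))"
    using inverse_function_theorem[OF T FD' contF' x0 inv] by blast
  have Fx0: "F x0 = (f1 g, f2 g)"
    using V c(5) by (simp add: F_def F1_def F2_def x0_def)
  obtain r where r: "0 < r" "cball (f1 g) r \<times> cball (f2 g) r \<subseteq> V'"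
    using open_prod_cballs[OF ift(4)] ift(5) Fx0 by metis
  \<comment> \<open>Balls whose product lies in the image \<open>V'\<close>, so that the coordinate
    domain is a product of convex sets; \<open>N\<close> below is cut down to match it.\<close>
  define P where "P = ball (f1 g) r"
  define Q where "Q = ball (f2 g) r"
  have PQ: "P \<times> Q \<subseteq> V'"
    using r(2) ball_subset_cball unfolding P_def Q_def by (meson Sigma_mono order_trans)
  define \<kappa> where "\<kappa> = (\<lambda>z. inv_into V \<phi> (vec2 (G z)))"
  define N where "N = {k \<in> V \<inter> U. unvec2 (\<phi> k) \<in> U' \<and> f1 k \<in> P \<and> f2 k \<in> Q}"
  have Fk: "F (unvec2 (\<phi> k)) = (f1 k, f2 k)" if "k \<in> V" for k
    using that c(5) by (simp add: F_def F1_def F2_def)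
  have GU: "G y \<in> U'" if "y \<in> V'" for y
    using ift(6) that unfolding homeomorphism_def by blast
  have k1: "\<kappa> y \<in> V \<inter> U" "unvec2 (\<phi> (\<kappa> y)) = G y" if y: "y \<in> V'" for y
  proof -
    have "G y \<in> T" using GU[OF y] ift(2) by blast
    then obtain q where q: "q \<in> V" "q \<in> U" "vec2 (G y) = \<phi> q" by (auto simp: T_def)
    then have "\<kappa> y = q" using c(5) by (simp add: \<kappa>_def)
    then show "\<kappa> y \<in> V \<inter> U" using q by simp
    show "unvec2 (\<phi> (\<kappa> y)) = G y" using \<open>\<kappa> y = q\<close> q(3) by (metis vec2_unvec2(2))
  qed
  have k2: "(f1 (\<kappa> y), f2 (\<kappa> y)) = y" if y: "y \<in> V'" for y
    using Fk[of "\<kappa> y"] k1[OF y] homeomorphism_apply2[OF ift(6) y] by simp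
  have k3: "\<kappa> (f1 k, f2 k) = k" if "k \<in> N" for k
  proof -
    have k: "k \<in> V" "unvec2 (\<phi> k) \<in> U'" using that by (auto simp: N_def)
    have "G (f1 k, f2 k) = unvec2 (\<phi> k)"
      using homeomorphism_apply1[OF ift(6) k(2)] Fk[OF k(1)] by simp
    then show ?thesis using k c(5) by (simp add: \<kappa>_def)
  qed
  have contu: "continuous_on S unvec2" for S
    unfolding unvec2_def by (intro continuous_intros)
  have oVU: "open (V \<inter> U)" using c(1) holo_fun_open[OF f(1)] by blast
  have "open ((V \<inter> U) \<inter> (\<lambda>k. (unvec2 (\<phi> k), f1 k, f2 k)) -` (U' \<times> P \<times> Q))"
  proof (rule continuous_open_preimage[OF _ oVU])
    show "continuous_on (V \<inter> U) (\<lambda>k. (unvec2 (\<phi> k), f1 k, f2 k))"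
      using holo_fun_continuous_on[OF B f(1)] holo_fun_continuous_on[OF B f(2)] c(3)
      by (intro continuous_intros continuous_on_compose2[OF contu[of UNIV]])
        (auto intro: continuous_on_subset)
    show "open (U' \<times> P \<times> Q)" using ift(1) by (auto simp: P_def Q_def intro!: open_Times)
  qed
  moreover have "(V \<inter> U) \<inter> (\<lambda>k. (unvec2 (\<phi> k), f1 k, f2 k)) -` (U' \<times> P \<times> Q) = N"
    by (auto simp: N_def)
  ultimately have oN: "open N" by simp
  have contG: "continuous_on V' G" using homeomorphism_cont2[OF ift(6)] .
  have "continuous_on V' \<kappa>"
  proof -
    have "continuous_on V' (\<lambda>z. vec2 (G z))"
      by (rule continuous_on_compose2[OF continuous_on_vec2[of UNIV] contG]) auto
    moreover have "vec2 (G z) \<in> \<phi> ` V" if "z \<in> V'" for z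
      using GU[OF that] ift(2) by (auto simp: T_def)
    ultimately show ?thesis
      unfolding \<kappa>_def by (intro continuous_on_compose2[OF c(4)]) auto
  qed
  then have ck: "continuous_on (P \<times> Q) \<kappa>" using PQ continuous_on_subset by blast
  have hol: "holo2 (h \<circ> \<kappa>) (P \<times> Q \<inter> \<kappa> -` W)" if h: "holo_fun B h W" for h W
    unfolding holo2_def
  proof (intro conjI ballI)
    show "open (P \<times> Q \<inter> \<kappa> -` W)"
      using holo_fun_open[OF h] ck by (intro continuous_open_preimage) (auto simp: P_def Q_def open_Times)
    fix y assume y: "y \<in> P \<times> Q \<inter> \<kappa> -` W"
    then have yV: "y \<in> V'" using PQ by blast
    let ?H = "\<lambda>z. h (inv_into V \<phi> (vec2 z))"
    have "vec2 (G y) \<in> \<phi> ` (V \<inter> W)"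
      using k1[OF yV] y by (metis IntD1 IntD2 IntI imageI vec2_unvec2(1) vimageE)
    then have Gy: "(?H has_derivative (\<lambda>k. pd1 ?H (G y) * fst k + pd2 ?H (G y) * snd k)) (at (G y))"
      using holo2_has_derivative[OF chart_holo2[OF B V(1) h]] by simp
    define L where "L = (\<lambda>k. pd1 ?H (G y) * fst (G' y k) + pd2 ?H (G y) * snd (G' y k))"
    have L: "((h \<circ> \<kappa>) has_derivative L) (at y)"
      using has_derivative_compose[OF ift(7)[OF yV] Gy] by (simp add: \<kappa>_def o_def L_def)
    have GT: "G y \<in> T" using GU[OF yV] ift(2) by blast
    have bij: "bij (D (G y))" and G': "G' y = inv (D (G y))"
      using ift(8,9)[OF yV] F'[OF GT] by auto
    \<comment> \<open>The inverse of a bijection that commutes with complex scalars commutes with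
      them too.\<close>
    have G'c: "G' y (c * fst k, c * snd k) = (c * fst (G' y k), c * snd (G' y k))" for c k
    proof -
      have "D (G y) (c * fst (G' y k), c * snd (G' y k)) = (c * fst (D (G y) (G' y k)), c * snd (D (G y) (G' y k)))"
        by (simp add: D_def algebra_simps)
      also have "\<dots> = (c * fst k, c * snd k)"
        using bij G' by (simp add: bij_is_surj surj_f_inv_f)
      finally show ?thesis
        using bij G' by (metis bij_inv_eq_iff)
    qed
    have "L k = L (1, 0) * fst k + L (0, 1) * snd k" for k
      by (rule complex_linear_pair[OF has_derivative_linear[OF L]]) (simp add: L_def G'c algebra_simps)
    then have "L = (\<lambda>k. L (1, 0) * fst k + L (0, 1) * snd k)" by blast
    then show "\<exists>a b. ((h \<circ> \<kappa>) has_derivative (\<lambda>k. a * fst k + b * snd k)) (at y)"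
      using L by metis
  qed
  have "coord_box B N f1 f2 P Q \<kappa>"
    unfolding coord_box_def
  proof (intro conjI ballI allI impI)
    show "holo_fun B f1 N" "holo_fun B f2 N"
      using holo_fun_subset[OF B f(1) oN] holo_fun_subset[OF B f(2) oN] by (auto simp: N_def)
    fix z w assume "z \<in> P" "w \<in> Q"
    then have zw: "(z, w) \<in> V'" using PQ by blast
    from k1[OF zw] k2[OF zw] GU[OF zw] \<open>z \<in> P\<close> \<open>w \<in> Q\<close>
    show "\<kappa> (z, w) \<in> N" "f1 (\<kappa> (z, w)) = z" "f2 (\<kappa> (z, w)) = w"
      by (auto simp: N_def)
  qed (use oN ck hol k3 in \<open>auto simp: P_def Q_def N_def\<close>)
  moreover have "g \<in> N" using V g ift(3) r(1) by (auto simp: N_def x0_def P_def Q_def)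
  moreover have "N \<subseteq> U" by (auto simp: N_def)
  ultimately show ?thesis using that by blast
qed

text \<open>The chain rule through \<open>\<kappa>\<close>. It reduces a tangent vector in the box
  to its values on the two coordinates, which are known for the fields that occur later.\<close>

lemma coord_box_value:
  assumes B: "complex_atlas B" and box: "coord_box B N f1 f2 P Q \<kappa>"
    and k: "k \<in> N" "k \<in> W" and v: "v \<in> tangent_space B k" and h: "holo_fun B h W"
  shows "v h = pd1 (h \<circ> \<kappa>) (f1 k, f2 k) * v f1 + pd2 (h \<circ> \<kappa>) (f1 k, f2 k) * v f2"
proof -
  note b = coord_boxD[OF box]
  have eq: "h q = (h \<circ> \<kappa>) (f1 q, f2 q)" if "q \<in> N" for q using b(11)[OF that] by simp
  have "v h = v (\<lambda>q. (h \<circ> \<kappa>) (f1 q, f2 q))"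
    by (rule tangent_cong[OF B v b(1) k(1) eq])
  also have "\<dots> = pd1 (h \<circ> \<kappa>) (f1 k, f2 k) * v f1 + pd2 (h \<circ> \<kappa>) (f1 k, f2 k) * v f2"
  proof (rule tangent_compose2[OF B v])
    show "holo_near B f1 k" "holo_near B f2 k" using b(6,7) k holo_fun_imp_near by blast+
    have "holo_fun B h (N \<inter> W)" using holo_fun_subset[OF B h] b(1) holo_fun_open[OF h] by auto
    then have "holo_fun B (\<lambda>q. (h \<circ> \<kappa>) (f1 q, f2 q)) (N \<inter> W)"
      by (rule holo_fun_cong[OF B]) (use eq in auto)
    then show "holo_near B (\<lambda>q. (h \<circ> \<kappa>) (f1 q, f2 q)) k" using k holo_fun_imp_near by blast
    show "((h \<circ> \<kappa>) has_derivative (\<lambda>ka. pd1 (h \<circ> \<kappa>) (f1 k, f2 k) * fst ka + pd2 (h \<circ> \<kappa>) (f1 k, f2 k) * snd ka))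
        (at (f1 k, f2 k))"
      by (rule holo2_has_derivative[OF b(15)[OF h]]) (use b(9,10,11)[OF k(1)] k in auto)
  qed
  finally show ?thesis .
qed

lemma coord_box_holo_fun:
  assumes B: "complex_atlas B" and box: "coord_box B N f1 f2 P Q \<kappa>"
    and k: "holo2 k S" and W: "open W" "W \<subseteq> N" "\<And>q. q \<in> W \<Longrightarrow> (f1 q, f2 q) \<in> S"
  shows "holo_fun B (\<lambda>q. k (f1 q, f2 q)) W"
  unfolding holo_fun_iff[OF B]
proof (intro conjI ballI)
  fix q assume q: "q \<in> W"
  show "hdiff B (\<lambda>q. k (f1 q, f2 q)) q"
    using coord_boxD(6,7)[OF box] W q unfolding holo_fun_iff[OF B]
    by (intro hdiff_compose2[OF B holo2_has_derivative[OF k]]) auto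
qed (use W in simp)

lemma complete_coordinate:
  fixes B :: "('g::topological_space, 2) atlas"
  assumes B: "complex_atlas B" and f: "holo_near B f1 g"
    and v: "v \<in> tangent_space B g" "v f1 \<noteq> 0"
  obtains f2 U u u' where "g \<in> U" "holo_fun B f2 U" "u \<in> tangent_space B g" "u' \<in> tangent_space B g"
    "u f1 * u' f2 - u f2 * u' f1 \<noteq> 0"
proof -
  obtain V \<phi> where V: "(V, \<phi>) \<in> B" "g \<in> V" using atlas_cover[OF B] .
  obtain w where w: "v = chart_tvec B (V, \<phi>) g w" using tangent_in_chart[OF B v(1) V] .
  let ?e = "\<lambda>i::2. chart_tvec B (V, \<phi>) g (axis i 1)"
  have e: "?e i \<in> tangent_space B g" for i by (rule chart_tvec_in_tangent[OF V])
  have ec: "?e i (\<lambda>q. \<phi> q $ j) = (if j = i then 1 else 0)" for i j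
    by (simp add: chart_tvec_coord[OF B V] axis_def)
  have hol: "holo_fun B (\<lambda>q. \<phi> q $ i) V" for i
    unfolding holo_fun_iff[OF B] using atlas_chart(1)[OF B V(1)] hdiff_chart_coord[OF B V(1)] by simp
  have "v f1 = ?e 1 f1 * w $ 1 + ?e 2 f1 * w $ 2"
    unfolding w chart_tvec_near[OF f] by (rule chart_has_derivative2(2)[OF B V holo_near_hdiff[OF B f]])
  \<comment> \<open>one of the two chart coordinates serves as \<open>f2\<close>\<close>
  then consider "?e 1 f1 \<noteq> 0" | "?e 2 f1 \<noteq> 0" using v(2) by fastforce
  then show ?thesis
  proof cases
    case 1
    then show ?thesis
      using that[OF V(2) hol[of 2] e[of 1] e[of 2]] ec by simp
  next
    case 2
    then show ?thesis
      using that[OF V(2) hol[of 1] e[of 2] e[of 1]] ec by simp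
  qed
qed


text \<open>Neighbourhoods are open in the ambient space, but only their trace on \<open>S\<close>
  matters: the properties of arrows considered later are locally constant along a source fibre, not
  across fibres.\<close>

lemma connected_constant_predicate:
  assumes S: "connected S" and P: "\<And>g. g \<in> S \<Longrightarrow> \<exists>N. open N \<and> g \<in> N \<and> (\<forall>k\<in>N \<inter> S. P k \<longleftrightarrow> P g)"
    and "a \<in> S" "b \<in> S" "P a"
  shows "P b"
proof (rule ccontr)
  assume "\<not> P b"
  define X where "X = \<Union>{N. open N \<and> (\<forall>k\<in>N \<inter> S. P k)}"
  define Y where "Y = \<Union>{N. open N \<and> (\<forall>k\<in>N \<inter> S. \<not> P k)}"
  have "open X" "open Y" unfolding X_def Y_def by (auto intro!: open_Union)
  moreover have "S \<subseteq> X \<union> Y"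
  proof
    fix g assume g: "g \<in> S"
    obtain N where N: "open N" "g \<in> N" "\<forall>k\<in>N \<inter> S. P k \<longleftrightarrow> P g" using P[OF g] by auto
    then show "g \<in> X \<union> Y" by (cases "P g") (auto simp: X_def Y_def)
  qed
  moreover have "X \<inter> Y \<inter> S = {}" by (auto simp: X_def Y_def)
  moreover have "a \<in> X"
    using P[OF \<open>a \<in> S\<close>] \<open>P a\<close> by (auto simp: X_def)
  moreover have "b \<in> Y"
    using P[OF \<open>b \<in> S\<close>] \<open>\<not> P b\<close> by (auto simp: Y_def)
  ultimately show False
    using connectedD[OF S, of X Y] assms(3,4) by blast
qed

text \<open>Integrating factor: with \<open>H\<close> a primitive of \<open>h\<close>, the product
  of \<open>T\<close> and \<open>exp (- H)\<close> has derivative zero, hence is constant on the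
  convex set, and it vanishes at \<open>b\<close>.\<close>

lemma linear_ode_zero:
  fixes T h :: "complex \<Rightarrow> complex"
  assumes S: "open S" "convex S" "b \<in> S" and h: "h holomorphic_on S"
    and T: "\<And>x. x \<in> S \<Longrightarrow> (T has_field_derivative T x * h x) (at x)" and "T b = 0" "x \<in> S"
  shows "T x = 0"
proof -
  obtain H where H: "\<And>x. x \<in> S \<Longrightarrow> (H has_field_derivative h x) (at x within S)"
    using holomorphic_convex_primitive'[OF S(2,1) h] by blast
  have "((\<lambda>x. T x * exp (- H x)) has_field_derivative 0) (at x within S)" if "x \<in> S" for x
  proof -
    have "((\<lambda>x. T x * exp (- H x)) has_field_derivative
        T x * h x * exp (- H x) + exp (- H x) * (- h x) * T x) (at x within S)"
      by (rule DERIV_mult[OF has_field_derivative_at_within[OF T[OF that]]])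
        (auto intro!: derivative_eq_intros H that)
    then show ?thesis by (simp add: algebra_simps)
  qed
  from has_field_derivative_zero_constant[OF S(2) this]
  obtain c where c: "\<forall>x\<in>S. T x * exp (- H x) = c" by blast
  then have "c = 0" using S(3) \<open>T b = 0\<close> by force
  then show ?thesis using c \<open>x \<in> S\<close> by simp
qed

lemma holo_fun_add:
  "complex_atlas A \<Longrightarrow> holo_fun A f W \<Longrightarrow> holo_fun A g W \<Longrightarrow> holo_fun A (\<lambda>q. f q + g q) W"
  by (simp add: holo_fun_iff hdiff_add)

lemma holo_fun_mult:
  "complex_atlas A \<Longrightarrow> holo_fun A f W \<Longrightarrow> holo_fun A g W \<Longrightarrow> holo_fun A (\<lambda>q. f q * g q) W"
  by (simp add: holo_fun_iff hdiff_mult)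

lemma holo_fun_const: "complex_atlas A \<Longrightarrow> open W \<Longrightarrow> holo_fun A (\<lambda>q. c) W"
  by (simp add: holo_fun_iff hdiff_const)

lemma holo_fun_diff_const:
  assumes A: "complex_atlas A" and f: "holo_fun A f W"
  shows "holo_fun A (\<lambda>q. f q - c) W"
  using holo_fun_add[OF A f holo_fun_const[OF A holo_fun_open[OF f], of "- c"]] by simp

text \<open>For density arguments: if this set is non-empty it contains points of any dense set,
  where the functions are known to agree. No separation of points of the manifold is
  involved.\<close>

lemma holo_fun_neq_open:
  assumes A: "complex_atlas A" and f: "holo_fun A f W" and g: "holo_fun A g W'"
  shows "open {q \<in> W \<inter> W'. f q \<noteq> g q}"
proof -
  have o: "open (W \<inter> W')" using holo_fun_open[OF f] holo_fun_open[OF g] by blast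
  have "continuous_on (W \<inter> W') (\<lambda>q. f q - g q)"
    using holo_fun_continuous_on[OF A f] holo_fun_continuous_on[OF A g]
    by (intro continuous_on_diff) (auto intro: continuous_on_subset)
  from continuous_open_preimage[OF this o, of "- {0}"]
  have "open ((W \<inter> W') \<inter> (\<lambda>q. f q - g q) -` (- {0}))" by auto
  moreover have "(W \<inter> W') \<inter> (\<lambda>q. f q - g q) -` (- {0}) = {q \<in> W \<inter> W'. f q \<noteq> g q}" by auto
  ultimately show ?thesis by simp
qed

lemma holo_fun_power:
  "complex_atlas A \<Longrightarrow> holo_fun A f W \<Longrightarrow> holo_fun A (\<lambda>q. f q ^ n) W"
  by (simp add: holo_fun_iff hdiff_power)

lemma tangent_diff_const:
  assumes A: "complex_atlas A" and v: "v \<in> tangent_space A p" and f: "holo_near A f p"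
  shows "v (\<lambda>q. f q - c) = v f"
  using tangent_add[OF A v f holo_near_const[OF A, of "- c"]] tangent_const[OF A v, of "- c"] by simp

lemma chart_coord_holo:
  assumes A: "complex_atlas A" and V: "(V, \<phi>) \<in> A"
  shows "holo_fun A (\<lambda>q. \<phi> q $ i) V"
  unfolding holo_fun_iff[OF A] using atlas_chart(1)[OF A V] hdiff_chart_coord[OF A V] by simp

section \<open>Holomorphic functions and logarithmic vector fields on curves\<close>

lemma cvec1_eq_iff: "(v :: complex ^ 1) = w \<longleftrightarrow> v $ 1 = w $ 1"
  by (simp add: vec_eq_iff)

lemma chart1_eq:
  fixes A :: "('x::topological_space, 1) atlas"
  assumes "complex_atlas A" "(V, \<phi>) \<in> A" "x \<in> V" "y \<in> V" "\<phi> x $ 1 = \<phi> y $ 1"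
  shows "x = y"
  using atlas_chart(5)[OF assms(1,2)] assms(3-5) by (simp add: inj_on_def cvec1_eq_iff)

lemma vec_has_derivative: "((vec :: complex \<Rightarrow> complex ^ 'n) has_derivative vec) (at c)"
  by (rule has_derivative_vec_componentwise) simp

lemma chart1_has_derivative:
  fixes A :: "('x::topological_space, 1) atlas"
  assumes A: "complex_atlas A" and V: "(V, \<phi>) \<in> A" "p \<in> V" and f: "hdiff A f p"
  shows "((\<lambda>c. f (inv_into V \<phi> (vec c))) has_field_derivative
      frechet_derivative (\<lambda>z. f (inv_into V \<phi> z)) (at (\<phi> p)) (axis 1 1)) (at (\<phi> p $ 1))"
proof -
  let ?L = "frechet_derivative (\<lambda>z. f (inv_into V \<phi> z)) (at (\<phi> p))"
  note c = hdiff_chart[OF A f V]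
  have vec: "(vec (\<phi> p $ 1) :: complex ^ 1) = \<phi> p" by (simp add: cvec1_eq_iff)
  from has_derivative_compose[OF vec_has_derivative[of "\<phi> p $ 1"], of "\<lambda>z. f (inv_into V \<phi> z)" ?L] cdiffD(1)[OF c]
  have "((\<lambda>c. f (inv_into V \<phi> (vec c))) has_derivative (\<lambda>h. ?L (vec h))) (at (\<phi> p $ 1))"
    by (simp add: vec)
  moreover have "?L (vec h) = ?L (axis 1 1) * h" for h
  proof -
    have "(vec h :: complex ^ 1) = h *s axis 1 1" by (simp add: cvec1_eq_iff axis_def)
    then show ?thesis using cdiffD(2)[OF c] by (simp add: mult.commute)
  qed
  ultimately show ?thesis by (simp add: has_field_derivative_def)
qed

text \<open>In the chart this is the one-variable fact that the derivative of a holomorphic function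
  is holomorphic; \<open>vec\<close> identifies \<open>complex\<close> with
  \<open>complex ^ 1\<close>.\<close>

lemma chart1_derivative_holo:
  fixes A :: "('x::topological_space, 1) atlas"
  assumes A: "complex_atlas A" and V: "(V, \<phi>) \<in> A" and f: "holo_fun A f W" and W: "W \<subseteq> V"
  shows "holo_fun A (\<lambda>p. chart_tvec A (V, \<phi>) p (axis 1 1) f) W"
proof -
  define F where "F = (\<lambda>c. f (inv_into V \<phi> (vec c)))"
  define T where "T = vec -` (\<phi> ` (V \<inter> W))"
  have oW: "open W" using f by (rule holo_fun_open)
  have T: "open T"
    unfolding T_def using atlas_image_open[OF A V oW]
    by (rule open_vimage)
      (intro continuous_at_imp_continuous_on ballI has_derivative_continuous[OF vec_has_derivative])
  have inT: "\<phi> p $ 1 \<in> T" if "p \<in> W" for p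
  proof -
    have "vec (\<phi> p $ 1) = \<phi> p" by (simp add: cvec1_eq_iff)
    then show ?thesis using that W by (auto simp: T_def)
  qed
  have der: "(F has_field_derivative chart_tvec A (V, \<phi>) p (axis 1 1) f) (at (\<phi> p $ 1))" if "p \<in> W" for p
  proof -
    have near: "holo_near A f p" using f that holo_fun_imp_near by blast
    show ?thesis unfolding F_def chart_tvec_near[OF near]
      by (rule chart1_has_derivative[OF A V _ holo_near_hdiff[OF A near]]) (use that W in auto)
  qed
  have "F holomorphic_on T"
    unfolding holomorphic_on_def
  proof
    fix c assume "c \<in> T"
    then obtain p where "p \<in> V \<inter> W" "vec c = \<phi> p" by (auto simp: T_def)
    moreover from this have "c = \<phi> p $ 1" by (metis vec_component)
    ultimately show "F field_differentiable at c within T"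
      using der[of p] field_differentiable_def field_differentiable_at_within by blast
  qed
  then have dF: "deriv F holomorphic_on T" using T by (rule holomorphic_deriv)
  show ?thesis
    unfolding holo_fun_iff[OF A]
  proof (intro conjI ballI)
    fix p assume p: "p \<in> W"
    obtain D where D: "(deriv F has_field_derivative D) (at (\<phi> p $ 1))"
      using holomorphic_on_imp_differentiable_at[OF dF T inT[OF p]] by (auto simp: field_differentiable_def)
    have "((\<lambda>k. deriv F (fst k)) has_derivative (\<lambda>k. D * fst k)) (at (\<phi> p $ 1, \<phi> p $ 1))"
      by (rule has_derivative_compose[of fst fst _ _ "deriv F" "(*) D"])
        (use D in \<open>auto simp: has_field_derivative_def intro!: derivative_eq_intros\<close>)
    then have d: "((\<lambda>k. deriv F (fst k)) has_derivative (\<lambda>k. D * fst k + 0 * snd k)) (at (\<phi> p $ 1, \<phi> p $ 1))"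
      by simp
    have "hdiff A (\<lambda>q. \<phi> q $ 1) p" using hdiff_chart_coord[OF A V] p W by blast
    from hdiff_compose2[OF A d this this]
    have 1: "hdiff A (\<lambda>q. deriv F (\<phi> q $ 1)) p" by simp
    have 2: "deriv F (\<phi> q $ 1) = chart_tvec A (V, \<phi>) q (axis 1 1) f" if "q \<in> W" for q
      using der[OF that] by (rule DERIV_imp_deriv)
    show "hdiff A (\<lambda>p. chart_tvec A (V, \<phi>) p (axis 1 1) f) p"
      by (rule hdiff_cong[OF A oW p 2 1])
  qed fact
qed

definition log_field :: "('x::topological_space, 1) atlas \<Rightarrow> ('x \<Rightarrow> nat) \<Rightarrow> ('x, 1) chart \<Rightarrow> 'x \<Rightarrow> 'x set \<Rightarrow> 'x vfield"
  where "log_field A D C q V = (\<lambda>x f. if x \<in> V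
     then (snd C x $ 1 - snd C q $ 1) ^ D q * chart_tvec A C x (axis 1 1) f else 0)"

text \<open>As \<open>q\<close> is the only point of \<open>V\<close> that may lie on the divisor,
  vanishing of positive order is required at \<open>q\<close> alone, where it is built into the
  formula.\<close>

lemma log_field_in:
  assumes A: "complex_atlas A" and C: "(C, \<phi>) \<in> A" and V: "open V" "V \<subseteq> C" "q \<in> V" "V \<inter> support D \<subseteq> {q}"
  shows "log_field A D (C, \<phi>) q V \<in> log_vfields A D V"
proof -
  let ?v = "log_field A D (C, \<phi>) q V"
  have tan: "?v p \<in> tangent_space A p" if p: "p \<in> V" for p
  proof -
    have c: "chart_tvec A (C, \<phi>) p (axis 1 1) \<in> tangent_space A p"
      using chart_tvec_in_tangent[OF C] p V by blast
    have "?v p = (\<lambda>f. (\<phi> p $ 1 - \<phi> q $ 1) ^ D q * chart_tvec A (C, \<phi>) p (axis 1 1) f +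
        0 * chart_tvec A (C, \<phi>) p (axis 1 1) f)"
      using p by (simp add: log_field_def fun_eq_iff)
    then show ?thesis
      using tangent_space_comb[OF A c c, of "(\<phi> p $ 1 - \<phi> q $ 1) ^ D q" 0] by simp
  qed
  have hol: "holo_fun A (\<lambda>p. ?v p f) W" if W: "W \<subseteq> V" "holo_fun A f W" for W f
  proof -
    have "holo_fun A (\<lambda>p. \<phi> p $ 1) W"
      using holo_fun_subset[OF A chart_coord_holo[OF A C]] holo_fun_open[OF W(2)] W V by blast
    then have "holo_fun A (\<lambda>p. (\<phi> p $ 1 - \<phi> q $ 1) ^ D q * chart_tvec A (C, \<phi>) p (axis 1 1) f) W"
      using chart1_derivative_holo[OF A C W(2)] W V
      by (intro holo_fun_mult holo_fun_power holo_fun_diff_const A) auto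
    then show ?thesis by (rule holo_fun_cong[OF A]) (use W in \<open>auto simp: log_field_def\<close>)
  qed
  have van: "vanishes_to_order A (D p) (\<lambda>x. ?v x f) p" if p: "p \<in> V" "holo_near A f p" for p f
  proof -
    obtain W where W: "p \<in> W" "holo_fun A f W" using p by (auto simp: holo_near_def)
    define W' where "W' = W \<inter> V"
    have W': "holo_fun A f W'" "W' \<subseteq> V" "p \<in> W'"
      using holo_fun_subset[OF A W(2)] holo_fun_open[OF W(2)] V p W by (auto simp: W'_def)
    have "\<exists>h. holo_fun A h W' \<and> (\<forall>x\<in>W'. ?v x f = (\<phi> x $ 1 - \<phi> p $ 1) ^ D p * h x)"
    proof (cases "D p = 0")
      case True
      then show ?thesis using hol[OF W'(2,1)] by (intro exI[of _ "\<lambda>x. ?v x f"]) simp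
    next
      case False
      then have "p = q" using p V by (auto simp: support_def)
      have "W' \<subseteq> C" using W' V by blast
      from chart1_derivative_holo[OF A C W'(1) this] show ?thesis
        by (intro exI[of _ "\<lambda>x. chart_tvec A (C, \<phi>) x (axis 1 1) f"])
          (use W' \<open>p = q\<close> in \<open>auto simp: log_field_def\<close>)
    qed
    then obtain h where "holo_fun A h W'" "\<forall>x\<in>W'. ?v x f = (\<phi> x $ 1 - \<phi> p $ 1) ^ D p * h x" by blast
    then show ?thesis
      unfolding vanishes_to_order_def using C W' V by (intro bexI[of _ "(C, \<phi>)"]) (auto intro!: exI[of _ W'] exI[of _ h])
  qed
  have "holo_vfield A V ?v"
    unfolding holo_vfield_def using V(1) tan hol by (auto simp: log_field_def)
  then show ?thesis unfolding log_vfields_def using van by blast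
qed

lemma log_field_coord:
  assumes A: "complex_atlas A" and C: "(C, \<phi>) \<in> A" and "V \<subseteq> C" "x \<in> V"
  shows "log_field A D (C, \<phi>) q V x (\<lambda>y. \<phi> y $ 1) = (\<phi> x $ 1 - \<phi> q $ 1) ^ D q"
  using chart_tvec_coord[OF A C, of x "axis 1 1" 1] assms(3,4) by (auto simp: log_field_def)

text \<open>The curve is Hausdorff, so finite sets are closed; a locally finite support can
  therefore be removed from a neighbourhood of \<open>x\<close> except possibly at \<open>x\<close>
  itself.\<close>

lemma open_compl_support:
  fixes D :: "'x::t2_space \<Rightarrow> nat"
  assumes "effective_divisor D"
  shows "open (- support D)" and "\<exists>W. open W \<and> x \<in> W \<and> W \<inter> support D \<subseteq> {x}"
proof -
  have *: "\<exists>W. open W \<and> x \<in> W \<and> W \<inter> support D \<subseteq> {x}" for x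
  proof -
    obtain W where W: "open W" "x \<in> W" "finite (W \<inter> support D)"
      using assms unfolding effective_divisor_def by blast
    then have "open (W - (W \<inter> support D - {x}))"
      by (intro open_Diff finite_imp_closed) auto
    then show ?thesis using W by (intro exI[of _ "W - (W \<inter> support D - {x})"]) auto
  qed
  then show "\<exists>W. open W \<and> x \<in> W \<and> W \<inter> support D \<subseteq> {x}" .
  have "\<exists>T. open T \<and> x \<in> T \<and> T \<subseteq> - support D" if "x \<in> - support D" for x
  proof -
    obtain W where "open W" "x \<in> W" "W \<inter> support D \<subseteq> {x}" using * by blast
    then show ?thesis using that by (intro exI[of _ W]) auto
  qed
  then show "open (- support D)" using open_subopen[of "- support D"] by blast
qed

section \<open>The twisted fundamental groupoid\<close>

locale twisted_groupoid =
  fixes A :: "('x::t2_space, 1) atlas"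
    and D :: "'x \<Rightarrow> nat"
    and B :: "('g::topological_space, 2) atlas"
    and G :: "('x, 'g) groupoid"
    and \<Phi> :: "'x set \<Rightarrow> 'x vfield \<Rightarrow> 'g vfield"
  assumes eff: "effective_divisor D"
    and tw: "twisted_fundamental_groupoid A D B G \<Phi>"
begin

lemma lie: "lie_groupoid A B G"
  using tw by (simp add: twisted_fundamental_groupoid_def)

lemma atlasA: "complex_atlas A" and atlasB: "complex_atlas B" and grp: "groupoid G"
  and submersion_src: "submersion B A (gsrc G)" and submersion_tgt: "submersion B A (gtgt G)"
  and map_inv: "holo_map B B (ginv G) UNIV"
  using lie by (simp_all add: lie_groupoid_def)

lemma map_src: "holo_map B A (gsrc G) UNIV" and map_tgt: "holo_map B A (gtgt G) UNIV"
  using submersion_src submersion_tgt by (simp_all add: submersion_def)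

lemma open_src: "open V \<Longrightarrow> open (gsrc G -` V)" and open_tgt: "open V \<Longrightarrow> open (gtgt G -` V)"
  using holo_mapD(2)[OF map_src] holo_mapD(2)[OF map_tgt] by (auto intro: open_vimage)

lemma src_one [simp]: "gsrc G (gone G x) = x" and tgt_one [simp]: "gtgt G (gone G x) = x"
  and src_inv [simp]: "gsrc G (ginv G g) = gtgt G g" and tgt_inv [simp]: "gtgt G (ginv G g) = gsrc G g"
  and one_mul [simp]: "gmul G (gone G (gtgt G g)) g = g"
  and mul_inv: "gmul G g (ginv G g) = gone G (gtgt G g)"
  and inv_mul: "gmul G (ginv G g) g = gone G (gsrc G g)"
  using grp by (simp_all add: groupoid_def)

lemma src_mul: "gsrc G g = gtgt G h \<Longrightarrow> gsrc G (gmul G g h) = gsrc G h"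
  and tgt_mul: "gsrc G g = gtgt G h \<Longrightarrow> gtgt G (gmul G g h) = gtgt G g"
  and mul_assoc: "gsrc G g = gtgt G h \<Longrightarrow> gsrc G h = gtgt G k \<Longrightarrow>
    gmul G (gmul G g h) k = gmul G g (gmul G h k)"
  using grp by (simp_all add: groupoid_def)

text \<open>The continuous local extension of the product serves to pull open sets and continuous
  functions back along right translations.\<close>

lemma mul_local:
  assumes "gsrc G g = gtgt G h"
  obtains M F where "open M" "(g, h) \<in> M" "continuous_on M F"
    "\<And>k l. (k, l) \<in> M \<Longrightarrow> gsrc G k = gtgt G l \<Longrightarrow> F (k, l) = gmul G k l"
proof -
  have "\<forall>g h. gsrc G g = gtgt G h \<longrightarrow> (\<exists>N F. (g, h) \<in> N \<and> holo_map (prod_atlas B B) B F N \<and>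
           (\<forall>(k, l)\<in>N. gsrc G k = gtgt G l \<longrightarrow> F (k, l) = gmul G k l))"
    using lie unfolding lie_groupoid_def by (elim conjE)
  then obtain N F where "(g, h) \<in> N" "holo_map (prod_atlas B B) B F N"
    "\<forall>(k, l)\<in>N. gsrc G k = gtgt G l \<longrightarrow> F (k, l) = gmul G k l"
    using assms by blast
  then show ?thesis using that[of N F] holo_mapD(1,2)[of "prod_atlas B B" B F N] by auto
qed

lemma connected_source_fibre: "connected (source_fibre G x)"
  using tw by (simp add: twisted_fundamental_groupoid_def)

text \<open>A lift of the coordinate vector shows that the pulled-back coordinate has non-zero
  differential, which is the input for completing it to a coordinate system.\<close>

lemma submersion_coord:
  assumes F: "submersion B A F" and C: "(C, \<phi>) \<in> A" "F g \<in> C"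
  obtains v where "v \<in> tangent_space B g" "v (\<lambda>k. \<phi> (F k) $ 1) = 1"
proof -
  let ?w = "chart_tvec A (C, \<phi>) (F g) (axis 1 1)"
  have near: "holo_near A (\<lambda>x. \<phi> x $ 1) (F g)"
    using chart_coord_holo[OF atlasA C(1)] C(2) holo_fun_imp_near by blast
  have w: "?w \<in> tangent_space A (F g)" by (rule chart_tvec_in_tangent[OF C])
  have "\<forall>p. \<forall>w\<in>tangent_space A (F p). \<exists>v\<in>tangent_space B p.
        \<forall>f. holo_near A f (F p) \<longrightarrow> v (\<lambda>q. f (F q)) = w f"
    using F unfolding submersion_def by (elim conjE)
  then obtain v where v: "v \<in> tangent_space B g" "\<forall>f. holo_near A f (F g) \<longrightarrow> v (\<lambda>q. f (F q)) = ?w f"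
    using w by blast
  have "v (\<lambda>k. \<phi> (F k) $ 1) = 1"
    using v(2)[rule_format, OF near] chart_tvec_coord[OF atlasA C, of "axis 1 1" 1] by simp
  then show ?thesis using that v(1) by blast
qed

lemma src_coord_holo: "(C, \<phi>) \<in> A \<Longrightarrow> holo_fun B (\<lambda>k. \<phi> (gsrc G k) $ 1) (gsrc G -` C)"
  and tgt_coord_holo: "(C, \<phi>) \<in> A \<Longrightarrow> holo_fun B (\<lambda>k. \<phi> (gtgt G k) $ 1) (gtgt G -` C)"
  using holo_mapD(3)[OF map_src, of C \<phi> 1] holo_mapD(3)[OF map_tgt, of C \<phi> 1] by simp_all

lemma tgt_compose_holo: "holo_fun A f V \<Longrightarrow> holo_fun B (\<lambda>k. f (gtgt G k)) (gtgt G -` V)"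
  using holo_fun_compose_map[OF atlasB atlasA map_tgt] by simp

lemma adapted_chart:
  assumes "open W" "q \<in> W"
  obtains C \<phi> V where "(C, \<phi>) \<in> A" "open V" "q \<in> V" "V \<subseteq> C" "V \<subseteq> W" "V \<inter> support D \<subseteq> {q}"
proof -
  obtain C \<phi> where C: "(C, \<phi>) \<in> A" "q \<in> C" using atlas_cover[OF atlasA] .
  obtain W' where W': "open W'" "q \<in> W'" "W' \<inter> support D \<subseteq> {q}"
    using open_compl_support(2)[OF eff] by blast
  have "open (C \<inter> W \<inter> W')" using atlas_chart(1)[OF atlasA C(1)] assms W' by blast
  then show ?thesis
    by (rule that[OF C(1)]) (use C assms W' in auto)
qed

context
  fixes V v
  assumes V: "open V" and v: "v \<in> log_vfields A D V"
begin

lemma iso_sections: "\<Phi> V v \<in> lie_alg_sections A B G V"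
proof -
  have "bij_betw (\<Phi> V) (log_vfields A D V) (lie_alg_sections A B G V)"
    using tw V unfolding twisted_fundamental_groupoid_def log_algebroid_iso_def by simp
  then show ?thesis using v bij_betwE by blast
qed

lemma iso_anchor:
  assumes "x \<in> V" "holo_near A f x"
  shows "\<Phi> V v (gone G x) (\<lambda>g. f (gtgt G g)) = v x f"
proof -
  have "log_algebroid_iso A D B G \<Phi>" using tw by (simp add: twisted_fundamental_groupoid_def)
  then have "\<forall>v\<in>log_vfields A D V. \<forall>x\<in>V. \<forall>f. holo_near A f x \<longrightarrow>
        \<Phi> V v (gone G x) (\<lambda>g. f (gtgt G g)) = v x f"
    using V unfolding log_algebroid_iso_def by simp
  then show ?thesis using v assms by blast
qed

lemma section_vfield: "holo_vfield B (gtgt G -` V) (\<Phi> V v)"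
  and section_source_tangent: "source_tangent A G (\<Phi> V v)"
  and section_right_invariant: "right_invariant B G V (\<Phi> V v)"
  using iso_sections by (simp_all add: lie_alg_sections_def)

lemma section_tangent: "gtgt G g \<in> V \<Longrightarrow> \<Phi> V v g \<in> tangent_space B g"
  using section_vfield by (simp add: holo_vfield_def)

lemma section_holo: "W \<subseteq> gtgt G -` V \<Longrightarrow> holo_fun B f W \<Longrightarrow> holo_fun B (\<lambda>g. \<Phi> V v g f) W"
  using section_vfield by (simp add: holo_vfield_def)

lemma section_src: "holo_near A f (gsrc G g) \<Longrightarrow> \<Phi> V v g (\<lambda>k. f (gsrc G k)) = 0"
  using section_source_tangent by (simp add: source_tangent_def)

lemma section_translate:
  assumes "gtgt G g \<in> V" "gsrc G g = gtgt G h" "holo_near B F (gmul G g h)" "g \<in> N" "holo_fun B F' N"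
    "\<And>k. k \<in> N \<Longrightarrow> gsrc G k = gtgt G h \<Longrightarrow> F' k = F (gmul G k h)"
  shows "\<Phi> V v (gmul G g h) F = \<Phi> V v g F'"
  by (rule section_right_invariant[unfolded right_invariant_def, rule_format, of g h F N F'])
    (use assms in auto)

text \<open>The isomorphism prescribes the anchor at identities only. Right translation by
  \<open>g\<close> takes the identity at \<open>t(g)\<close> to \<open>g\<close> and does not affect
  functions of the target, so right invariance spreads the formula to all arrows.\<close>

lemma section_anchor:
  assumes f: "holo_fun A f V" and g: "gtgt G g \<in> V"
  shows "\<Phi> V v g (\<lambda>k. f (gtgt G k)) = v (gtgt G g) f"
proof -
  let ?F = "\<lambda>k. f (gtgt G k)"
  have F: "holo_fun B ?F (gtgt G -` V)" using tgt_compose_holo[OF f] .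
  have "\<Phi> V v (gmul G (gone G (gtgt G g)) g) ?F = \<Phi> V v (gone G (gtgt G g)) ?F"
    by (rule section_translate[OF _ _ _ _ F])
      (use g F in \<open>auto simp: tgt_mul intro: holo_fun_imp_near\<close>)
  also have "\<dots> = v (gtgt G g) f"
    by (rule iso_anchor[OF g holo_fun_imp_near[OF f g]])
  finally show ?thesis by simp
qed

end

text \<open>The half of the isomorphism that produces the contradiction: a right-invariant field
  with too small an order of vanishing would still have to come from
  \<open>T\<^sub>X(-D)\<close>.\<close>

lemma iso_surj:
  assumes "open V" "\<xi> \<in> lie_alg_sections A B G V"
  obtains v where "v \<in> log_vfields A D V" "\<Phi> V v = \<xi>"
proof -
  have "bij_betw (\<Phi> V) (log_vfields A D V) (lie_alg_sections A B G V)"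
    using tw assms(1) unfolding twisted_fundamental_groupoid_def log_algebroid_iso_def by simp
  then have "\<Phi> V ` log_vfields A D V = lie_alg_sections A B G V" by (rule bij_betw_imp_surj_on)
  then have "\<xi> \<in> \<Phi> V ` log_vfields A D V" using assms(2) by (simp only:)
  then show ?thesis using that by (elim imageE) simp
qed

section \<open>Arrows near which the target map is constant on the source fibre\<close>

definition tgt_loc_const :: "'g \<Rightarrow> bool" where
  "tgt_loc_const g \<longleftrightarrow> (\<exists>N. open N \<and> g \<in> N \<and> (\<forall>k\<in>N. gsrc G k = gsrc G g \<longrightarrow> gtgt G k = gtgt G g))"

lemma open_mul_preimage:
  assumes "open M" "continuous_on M F" "open W"
  shows "open {k. (k, h) \<in> M \<and> F (k, h) \<in> W}"
proof -
  have "open (M \<inter> F -` W)" using assms by (simp add: continuous_open_preimage)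
  then have "open ((\<lambda>k. (k, h)) -` (M \<inter> F -` W))" by (rule open_vimage) (intro continuous_intros)
  then show ?thesis by (simp add: vimage_def)
qed

text \<open>Right translation by \<open>h\<close>, the product of the inverse of \<open>g\<close>
  with \<open>g'\<close>, takes \<open>g\<close> to \<open>g'\<close>, maps source fibres to source
  fibres and preserves targets. So the property depends only on the target of the arrow.\<close>

lemma tgt_loc_const_translate:
  assumes "gtgt G g = gtgt G g'" "tgt_loc_const g'"
  shows "tgt_loc_const g"
proof -
  obtain N' where N': "open N'" "g' \<in> N'" "\<forall>k\<in>N'. gsrc G k = gsrc G g' \<longrightarrow> gtgt G k = gtgt G g'"
    using assms(2) by (auto simp: tgt_loc_const_def)
  define h where "h = gmul G (ginv G g) g'"
  have c: "gsrc G (ginv G g) = gtgt G g'" using assms(1) by simp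
  have th: "gtgt G h = gsrc G g" and sh: "gsrc G h = gsrc G g'"
    using c by (simp_all add: h_def tgt_mul src_mul)
  have gh: "gmul G g h = g'"
    using mul_assoc[of g "ginv G g" g'] c assms(1) by (simp add: h_def mul_inv)
  obtain M F where M: "open M" "(g, h) \<in> M" "continuous_on M F"
    "\<And>k l. (k, l) \<in> M \<Longrightarrow> gsrc G k = gtgt G l \<Longrightarrow> F (k, l) = gmul G k l"
    using mul_local[of g h] th by metis
  let ?N = "{k. (k, h) \<in> M \<and> F (k, h) \<in> N'}"
  have "g \<in> ?N" using M(2,4) th gh N'(2) by simp
  moreover have "gtgt G k = gtgt G g" if "k \<in> ?N" "gsrc G k = gsrc G g" for k
  proof -
    have "gmul G k h \<in> N'" using that M(4) th by force
    then have "gtgt G (gmul G k h) = gtgt G g'"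
      using N'(3) src_mul[of k h] sh th that by simp
    then show ?thesis using tgt_mul[of k h] th that assms(1) by simp
  qed
  ultimately show ?thesis
    unfolding tgt_loc_const_def using open_mul_preimage[OF M(1,3) N'(1)] by blast
qed

end


section \<open>Invariance of the divisor under the groupoid\<close>

context twisted_groupoid
begin

context
  fixes C \<phi> V q
  assumes C: "(C, \<phi>) \<in> A" and V: "open V" "V \<subseteq> C" "q \<in> V" "V \<inter> support D \<subseteq> {q}"
begin

abbreviation (input) tcoord :: "'g \<Rightarrow> complex" where
  "tcoord \<equiv> \<lambda>k. \<phi> (gtgt G k) $ 1 - \<phi> q $ 1"

abbreviation (input) gen :: "'g vfield" where
  "gen \<equiv> \<Phi> V (log_field A D (C, \<phi>) q V)"

lemma log_field_V: "log_field A D (C, \<phi>) q V \<in> log_vfields A D V"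
  by (rule log_field_in[OF atlasA C V])

lemma open_tgt_V: "open (gtgt G -` V)"
  by (rule open_tgt[OF V(1)])

lemma tcoord_holo: "holo_fun B tcoord (gtgt G -` V)"
  by (rule holo_fun_diff_const[OF atlasB])
    (rule holo_fun_subset[OF atlasB tgt_coord_holo[OF C] open_tgt_V], use V(2) in auto)

lemma tcoord_eq_0: "gtgt G k \<in> V \<Longrightarrow> tcoord k = 0 \<longleftrightarrow> gtgt G k = q"
  using chart1_eq[OF atlasA C, of "gtgt G k" q] V by auto

lemma gen_tgt:
  assumes "gtgt G g \<in> V" shows "gen g (\<lambda>k. \<phi> (gtgt G k) $ 1) = tcoord g ^ D q"
proof -
  have "holo_fun A (\<lambda>x. \<phi> x $ 1) V"
    by (rule holo_fun_subset[OF atlasA chart_coord_holo[OF atlasA C] V(1,2)])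
  from section_anchor[OF V(1) log_field_V this assms] show ?thesis
    using log_field_coord[OF atlasA C V(2) assms] by simp
qed

lemma gen_tcoord:
  assumes "gtgt G g \<in> V" shows "gen g tcoord = tcoord g ^ D q"
proof -
  have "holo_near B (\<lambda>k. \<phi> (gtgt G k) $ 1) g"
    using holo_fun_imp_near[OF tgt_coord_holo[OF C]] assms V(2) by auto
  from tangent_diff_const[OF atlasB section_tangent[OF V(1) log_field_V assms] this]
  show ?thesis using gen_tgt[OF assms] by simp
qed

lemma gen_src:
  assumes "(C', \<theta>) \<in> A" "gsrc G g \<in> C'"
  shows "gen g (\<lambda>k. \<theta> (gsrc G k) $ 1) = 0"
  using section_src[OF V(1) log_field_V holo_fun_imp_near[OF chart_coord_holo[OF atlasA assms(1)] assms(2)]] .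

text \<open>Along a source fibre the target coordinate solves a linear equation if \<open>gen\<close> does not vanish;
  so it is constant as soon as it vanishes at one point.\<close>

lemma gen_vanishes:
  assumes Dq: "D q \<noteq> 0" and g: "gtgt G g = q" "\<not> tgt_loc_const g" and F: "holo_near B F g"
  shows "gen g F = 0"
proof -
  obtain C' \<theta> where C': "(C', \<theta>) \<in> A" "gsrc G g \<in> C'" using atlas_cover[OF atlasA] .
  let ?\<sigma> = "\<lambda>k. \<theta> (gsrc G k) $ 1"
  have \<sigma>: "holo_fun B ?\<sigma> (gsrc G -` C')" by (rule src_coord_holo[OF C'(1)])
  have near\<sigma>: "holo_near B ?\<sigma> g" using holo_fun_imp_near[OF \<sigma>] C'(2) by simp
  obtain v where v: "v \<in> tangent_space B g" "v ?\<sigma> = 1"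
    using submersion_coord[OF submersion_src C'] .
  obtain w U u u' where w: "g \<in> U" "holo_fun B w U" "u \<in> tangent_space B g" "u' \<in> tangent_space B g"
    "u ?\<sigma> * u' w - u w * u' ?\<sigma> \<noteq> 0"
    using complete_coordinate[OF atlasB near\<sigma> v(1)] v(2) by (metis zero_neq_one)
  define U0 where "U0 = U \<inter> gsrc G -` C' \<inter> gtgt G -` V"
  have oU0: "open U0"
    unfolding U0_def using holo_fun_open[OF w(2)] holo_fun_open[OF \<sigma>] open_tgt_V by blast
  have g0: "g \<in> U0" using w(1) C'(2) g(1) V(3) by (simp add: U0_def)
  have hol0: "holo_fun B ?\<sigma> U0" "holo_fun B w U0" "holo_fun B tcoord U0"
    using holo_fun_subset[OF atlasB \<sigma> oU0] holo_fun_subset[OF atlasB w(2) oU0]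
      holo_fun_subset[OF atlasB tcoord_holo oU0] by (auto simp: U0_def)
  obtain N P Q \<kappa> where N: "g \<in> N" "N \<subseteq> U0" "coord_box B N ?\<sigma> w P Q \<kappa>"
    using coord_box_exists[OF atlasB hol0(1,2) g0 w(3-5)] .
  note b = coord_boxD[OF N(3)]
  have gs: "gen k ?\<sigma> = 0" if "k \<in> N" for k
    using gen_src[OF C'(1)] that N(2) by (auto simp: U0_def)
  have tan: "gen k \<in> tangent_space B k" if "k \<in> N" for k
    using section_tangent[OF V(1) log_field_V] that N(2) by (auto simp: U0_def)
  \<comment> \<open>Since \<open>gen\<close> kills the source coordinate, it is a multiple of the
    second coordinate field in the box; it vanishes where its value on \<open>w\<close>
    does.\<close>
  have val: "gen k h = pd2 (h \<circ> \<kappa>) (?\<sigma> k, w k) * gen k w" if "k \<in> N" "k \<in> W" "holo_fun B h W" for k h W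
    using coord_box_value[OF atlasB N(3) that(1,2) tan[OF that(1)] that(3)] gs[OF that(1)] by simp
  have "gen g w = 0"
  proof (rule ccontr)
    assume ne: "gen g w \<noteq> 0"
    define a where "a = ?\<sigma> g"
    define b0 where "b0 = w g"
    have a: "a \<in> P" "b0 \<in> Q" "\<kappa> (a, b0) = g" using b(9,10,11)[OF N(1)] by (auto simp: a_def b0_def)
    \<comment> \<open>Along the slice through \<open>g\<close>, which lies in its source fibre,
      \<open>c\<close> is the coefficient of \<open>gen\<close> and \<open>T\<close> the target
      coordinate relative to \<open>q\<close>. The chain rule and \<open>gen_tcoord\<close> will
      give \<open>T' * c = T ^ D q\<close>.\<close>
    define c where "c = (\<lambda>y. gen (\<kappa> (a, y)) w)"
    define T where "T = (\<lambda>y. tcoord (\<kappa> (a, y)))"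
    have NV: "N \<subseteq> gtgt G -` V" using N(2) by (auto simp: U0_def)
    have hc: "holo_fun B (\<lambda>k. gen k w) N"
      by (rule section_holo[OF V(1) log_field_V NV b(7)])
    have hz: "holo_fun B tcoord N" by (rule holo_fun_subset[OF atlasB hol0(3) b(1) N(2)])
    have dom: "P \<times> Q \<inter> \<kappa> -` N = P \<times> Q" using b(12) by auto
    have c2: "holo2 ((\<lambda>k. gen k w) \<circ> \<kappa>) (P \<times> Q)" using b(15)[OF hc] dom by simp
    have z2: "holo2 (tcoord \<circ> \<kappa>) (P \<times> Q)" using b(15)[OF hz] dom by simp
    have ch: "c holomorphic_on Q"
      unfolding holomorphic_on_def field_differentiable_def
    proof
      fix y assume "y \<in> Q"
      then have "(a, y) \<in> P \<times> Q" using a(1) by simp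
      from has_field_derivative_at_within[OF holo2_pd2[OF c2 this]]
      show "\<exists>f'. (c has_field_derivative f') (at y within Q)"
        unfolding c_def o_def by (rule exI)
    qed
    have Tode: "(T has_field_derivative pd2 (tcoord \<circ> \<kappa>) (a, y)) (at y)" if "y \<in> Q" for y
      using holo2_pd2[OF z2, of a y] a(1) that by (simp add: T_def o_def)
    have Teq: "T y ^ D q = pd2 (tcoord \<circ> \<kappa>) (a, y) * c y" if y: "y \<in> Q" for y
    proof -
      have k: "\<kappa> (a, y) \<in> N" using b(12) a(1) y by blast
      have "gtgt G (\<kappa> (a, y)) \<in> V" using k NV by auto
      from gen_tcoord[OF this] val[OF k k hz] b(13,14)[OF a(1) y]
      show ?thesis by (simp add: T_def c_def)
    qed
    define Q' where "Q' = Q \<inter> c -` (- {0})"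
    have "open Q'" unfolding Q'_def
      using holomorphic_on_imp_continuous_on[OF ch] b(3) by (intro continuous_open_preimage) auto
    moreover have "b0 \<in> Q'" using a ne by (simp add: Q'_def c_def)
    ultimately obtain r where r: "0 < r" "ball b0 r \<subseteq> Q'" using open_contains_ball by blast
    have rQ: "ball b0 r \<subseteq> Q" "\<And>y. y \<in> ball b0 r \<Longrightarrow> c y \<noteq> 0" using r(2) by (auto simp: Q'_def)
    have Thol: "T holomorphic_on ball b0 r"
      unfolding holomorphic_on_def field_differentiable_def
      using Tode rQ(1) has_field_derivative_at_within by blast
    \<comment> \<open>Since \<open>D q\<close> is positive, one factor \<open>T\<close> can be split
      off: where \<open>c\<close> does not vanish, \<open>T' = T * (T ^ m / c)\<close>, a linear
      equation with holomorphic coefficient.\<close>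
    obtain m where m: "D q = Suc m" using Dq by (cases "D q") auto
    have T0: "T y = 0" if "y \<in> ball b0 r" for y
    proof (rule linear_ode_zero[where T = T and x = y and S = "ball b0 r" and b = b0 and h = "\<lambda>y. T y ^ m / c y"])
      show "(\<lambda>y. T y ^ m / c y) holomorphic_on ball b0 r"
        using rQ by (intro holomorphic_intros Thol holomorphic_on_subset[OF ch]) auto
      fix x assume x: "x \<in> ball b0 r"
      then have "pd2 (tcoord \<circ> \<kappa>) (a, x) = T x * (T x ^ m / c x)"
        using Teq[of x] rQ m by (auto simp: field_simps)
      then show "(T has_field_derivative T x * (T x ^ m / c x)) (at x)"
        using Tode[of x] x rQ(1) by auto
    next
      show "T b0 = 0" using a(3) g(1) by (simp add: T_def)
    qed (use r(1) that in auto)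
    define N' where "N' = N \<inter> w -` ball b0 r"
    have "open N'" unfolding N'_def
      by (rule continuous_open_preimage[OF holo_fun_continuous_on[OF atlasB b(7)] b(1)]) simp
    moreover have "g \<in> N'" using N(1) r(1) by (simp add: N'_def b0_def)
    moreover have "gtgt G k = gtgt G g" if k: "k \<in> N'" "gsrc G k = gsrc G g" for k
    proof -
      have "\<kappa> (a, w k) = k" using b(11)[of k] k by (simp add: N'_def a_def)
      then have "tcoord k = 0" using T0[of "w k"] k(1) by (simp add: T_def N'_def)
      moreover have "gtgt G k \<in> V" using k(1) NV by (auto simp: N'_def)
      ultimately show ?thesis using tcoord_eq_0 g(1) by simp
    qed
    ultimately have "tgt_loc_const g" unfolding tgt_loc_const_def by blast
    then show False using g(2) by simp
  qed
  moreover obtain W where "g \<in> W" "holo_fun B F W" using F by (auto simp: holo_near_def)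
  ultimately show ?thesis using val[OF N(1)] by simp
qed

text \<open>As \<open>gen\<close> vanishes on the zero set of \<open>tcoord\<close>, it is divisible by \<open>tcoord\<close>. In \<open>gen_quotient\<close> the
  quotient inherits its properties by continuity, because the zero set has empty interior in the
  source fibres.\<close>

definition gen_quotient_at :: "'g \<Rightarrow> 'g tvec \<Rightarrow> bool" where
  "gen_quotient_at g u \<longleftrightarrow> u \<in> tangent_space B g \<and> (\<forall>F W. g \<in> W \<and> holo_fun B F W \<longrightarrow>
    (\<exists>W' f'. g \<in> W' \<and> W' \<subseteq> W \<inter> gtgt G -` V \<and> holo_fun B f' W' \<and> f' g = u F \<and>
      (\<forall>k\<in>W'. gen k F = tcoord k * f' k)))"

text \<open>In coordinates \<open>(tcoord, w)\<close> the field has values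
  \<open>tcoord ^ D q\<close> and \<open>gen k w\<close>. The first is divisible by
  \<open>tcoord\<close> as \<open>D q\<close> is positive, the second by \<open>holo2_divide\<close>
  because it vanishes on the zero set. The vector \<open>u\<close> is prescribed by the two
  quotients at \<open>g\<close>.\<close>

lemma gen_quotient_vector:
  assumes Dq: "D q \<noteq> 0" and vanish: "\<And>g F. gtgt G g = q \<Longrightarrow> holo_near B F g \<Longrightarrow> gen g F = 0"
    and g: "gtgt G g \<in> V"
  shows "\<exists>u. gen_quotient_at g u"
proof -
  have gV: "g \<in> gtgt G -` V" using g by simp
  have near: "holo_near B tcoord g" by (rule holo_fun_imp_near[OF tcoord_holo gV])
  have gC: "gtgt G g \<in> C" using g V(2) by blast
  obtain v where v: "v \<in> tangent_space B g" "v (\<lambda>k. \<phi> (gtgt G k) $ 1) = 1"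
    using submersion_coord[OF submersion_tgt C gC] .
  have "holo_near B (\<lambda>k. \<phi> (gtgt G k) $ 1) g"
    using holo_fun_imp_near[OF tgt_coord_holo[OF C]] gC by simp
  then have v2: "v tcoord \<noteq> 0" using tangent_diff_const[OF atlasB v(1)] v(2) by simp
  obtain w U u1 u2 where w: "g \<in> U" "holo_fun B w U" "u1 \<in> tangent_space B g" "u2 \<in> tangent_space B g"
    "u1 tcoord * u2 w - u1 w * u2 tcoord \<noteq> 0"
    using complete_coordinate[OF atlasB near, OF v(1), OF v2] by metis
  define U0 where "U0 = U \<inter> gtgt G -` V"
  have oU0: "open U0" unfolding U0_def using holo_fun_open[OF w(2)] open_tgt_V by blast
  have hol0: "holo_fun B tcoord U0" "holo_fun B w U0"
    using holo_fun_subset[OF atlasB w(2) oU0] holo_fun_subset[OF atlasB tcoord_holo oU0]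
    by (auto simp: U0_def)
  have g0: "g \<in> U0" using w(1) g by (simp add: U0_def)
  obtain N P Q \<kappa> where N: "g \<in> N" "N \<subseteq> U0" "coord_box B N tcoord w P Q \<kappa>"
    using coord_box_exists[OF atlasB hol0 g0 w(3,4), OF w(5)] .
  note b = coord_boxD[OF N(3)]
  have NV: "N \<subseteq> gtgt G -` V" using N(2) by (auto simp: U0_def)
  have hw: "holo_fun B (\<lambda>k. gen k w) N"
    by (rule section_holo[OF V(1) log_field_V NV b(7)])
  have dom: "P \<times> Q \<inter> \<kappa> -` N = P \<times> Q" using b(12) by auto
  have h2: "holo2 ((\<lambda>k. gen k w) \<circ> \<kappa>) (P \<times> Q)" using b(15)[OF hw] dom by simp
  have zero: "((\<lambda>k. gen k w) \<circ> \<kappa>) (0, y) = 0" if "(0, y) \<in> P \<times> Q" for y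
  proof -
    have k: "\<kappa> (0, y) \<in> N" using b(12) that by blast
    have "tcoord (\<kappa> (0, y)) = 0" using b(13) that by blast
    then have "gtgt G (\<kappa> (0, y)) = q" using tcoord_eq_0 k NV by auto
    then show ?thesis using vanish holo_fun_imp_near[OF b(7) k] by simp
  qed
  obtain kk where kk: "holo2 kk (P \<times> Q)"
    "\<And>x y. (x, y) \<in> P \<times> Q \<Longrightarrow> ((\<lambda>k. gen k w) \<circ> \<kappa>) (x, y) = (x - 0) * kk (x, y)"
    using holo2_divide[OF h2 zero] by metis
  obtain m where m: "D q = Suc m" using Dq by (cases "D q") auto
  have gw: "gen k w = tcoord k * kk (tcoord k, w k)" if "k \<in> N" for k
    using kk(2)[of "tcoord k" "w k"] b(9,10,11)[OF that] by simp
  obtain u where u: "u \<in> tangent_space B g" "u tcoord = tcoord g ^ m" "u w = kk (tcoord g, w g)"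
    using tangent_space_solve[OF atlasB w(3,4), OF w(5)] .
  show ?thesis
    unfolding gen_quotient_at_def
  proof (intro exI[of _ u] conjI[OF u(1)] allI impI, elim conjE)
    fix F W assume W: "g \<in> W" "holo_fun B F W"
    define W' where "W' = N \<inter> W"
    \<comment> \<open>The chain rule for the quotient field: \<open>u\<close> lives at
      \<open>g\<close> only, but its coordinate values are given by functions holomorphic on the
      whole box.\<close>
    define f' where "f' = (\<lambda>k. pd1 (F \<circ> \<kappa>) (tcoord k, w k) * tcoord k ^ m +
      pd2 (F \<circ> \<kappa>) (tcoord k, w k) * kk (tcoord k, w k))"
    have oW': "open W'" unfolding W'_def using b(1) holo_fun_open[OF W(2)] by blast
    have W'N: "W' \<subseteq> N" by (simp add: W'_def)
    have F2: "holo2 (F \<circ> \<kappa>) (P \<times> Q \<inter> \<kappa> -` W)" by (rule b(15)[OF W(2)])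
    have inS: "(tcoord k, w k) \<in> P \<times> Q \<inter> \<kappa> -` W" if "k \<in> W'" for k
      using b(9,10,11)[of k] that by (simp add: W'_def)
    have "holo_fun B tcoord W'" by (rule holo_fun_subset[OF atlasB b(6) oW' W'N])
    then have hf': "holo_fun B f' W'"
      unfolding f'_def
      by (intro holo_fun_add holo_fun_mult holo_fun_power atlasB
          coord_box_holo_fun[OF atlasB N(3) holo2_pd1_holo2[OF F2] oW' W'N inS]
          coord_box_holo_fun[OF atlasB N(3) holo2_pd2_holo2[OF F2] oW' W'N inS]
          coord_box_holo_fun[OF atlasB N(3) kk(1) oW' W'N]) (use inS in auto)
    have "f' g = u F"
      using coord_box_value[OF atlasB N(3) N(1) W(1) u(1) W(2)] u(2,3) by (simp add: f'_def)
    moreover have "gen k F = tcoord k * f' k" if k: "k \<in> W'" for k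
    proof -
      have kN: "k \<in> N" "k \<in> W" "gtgt G k \<in> V" using k NV by (auto simp: W'_def)
      from coord_box_value[OF atlasB N(3) kN(1,2) section_tangent[OF V(1) log_field_V kN(3)] W(2)]
      show ?thesis
        using gen_tcoord[OF kN(3)] gw[OF kN(1)] m by (simp add: f'_def algebra_simps)
    qed
    moreover have "g \<in> W'" "W' \<subseteq> W \<inter> gtgt G -` V" using N(1) W(1) NV by (auto simp: W'_def)
    ultimately show "\<exists>W' f'. g \<in> W' \<and> W' \<subseteq> W \<inter> gtgt G -` V \<and> holo_fun B f' W' \<and> f' g = u F \<and>
      (\<forall>k\<in>W'. gen k F = tcoord k * f' k)"
      using hf' by blast
  qed
qed

lemma gen_quotient:
  assumes Dq: "D q \<noteq> 0" and nonconst: "\<And>g. gtgt G g = q \<Longrightarrow> \<not> tgt_loc_const g"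
  obtains \<xi> where "\<xi> \<in> lie_alg_sections A B G V"
    "\<And>g F. gtgt G g \<in> V \<Longrightarrow> holo_near B F g \<Longrightarrow> gen g F = tcoord g * \<xi> g F"
proof -
  have "\<forall>g\<in>gtgt G -` V. \<exists>u. gen_quotient_at g u"
  proof (rule ballI, rule gen_quotient_vector[OF Dq])
    show "gen g F = 0" if "gtgt G g = q" "holo_near B F g" for g F
      by (rule gen_vanishes[OF Dq that(1) nonconst[OF that(1)] that(2)])
  qed simp
  from bchoice[OF this]
  obtain \<eta> where \<eta>: "\<forall>g\<in>gtgt G -` V. gen_quotient_at g (\<eta> g)"
    by (rule exE)
  \<comment> \<open>The vectors were chosen arrow by arrow, so nothing yet relates nearby values;
    coherence will come from density. The value outside \<open>V\<close> follows the convention for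
    vector fields.\<close>
  define \<xi> where "\<xi> = (\<lambda>g. if gtgt G g \<in> V then \<eta> g else (\<lambda>f. 0))"
  have tan: "\<xi> g \<in> tangent_space B g" if "gtgt G g \<in> V" for g
    using \<eta> that by (simp add: \<xi>_def gen_quotient_at_def)
  have loc: "\<exists>W' f'. g \<in> W' \<and> W' \<subseteq> W \<inter> gtgt G -` V \<and> holo_fun B f' W' \<and> f' g = \<xi> g F \<and>
      (\<forall>k\<in>W'. gen k F = tcoord k * f' k)"
    if "gtgt G g \<in> V" "g \<in> W" "holo_fun B F W" for g F W
  proof -
    have "\<xi> g = \<eta> g" using that(1) by (simp add: \<xi>_def)
    moreover have "g \<in> gtgt G -` V" using that(1) by simp
    ultimately show ?thesis using bspec[OF \<eta>, unfolded gen_quotient_at_def, THEN conjunct2, THEN spec, THEN spec, THEN mp, OF _ conjI[OF that(2,3)]]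
      by simp
  qed
  have div: "gen g F = tcoord g * \<xi> g F" if g: "gtgt G g \<in> V" and F: "holo_near B F g" for g F
  proof -
    obtain W where W: "g \<in> W" "holo_fun B F W" using F by (auto simp: holo_near_def)
    obtain W' f' where "g \<in> W'" "f' g = \<xi> g F" "\<forall>k\<in>W'. gen k F = tcoord k * f' k"
      using loc[OF g W] by blast
    then show ?thesis by auto
  qed
  \<comment> \<open>Near an arrow into \<open>q\<close> the same source fibre contains arrows with
    other targets. Density within one source fibre is essential, since right translation by
    \<open>h\<close> is defined on only one such fibre.\<close>
  have dense: "\<exists>k\<in>U. gsrc G k = gsrc G g \<and> gtgt G k \<in> V \<and> tcoord k \<noteq> 0"
    if g: "gtgt G g \<in> V" and U: "open U" "g \<in> U" for g U
  proof (cases "gtgt G g = q")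
    case True
    have "open (U \<inter> gtgt G -` V)" "g \<in> U \<inter> gtgt G -` V" using U open_tgt_V g by auto
    then obtain k where "k \<in> U \<inter> gtgt G -` V" "gsrc G k = gsrc G g" "gtgt G k \<noteq> gtgt G g"
      using nonconst[OF True] unfolding tgt_loc_const_def by blast
    then show ?thesis using tcoord_eq_0[of k] True by auto
  next
    case False
    then show ?thesis using tcoord_eq_0[OF g] g U by auto
  qed
  have "holo_vfield B (gtgt G -` V) \<xi>"
    unfolding holo_vfield_def
  proof (intro conjI ballI allI impI)
    show "open (gtgt G -` V)" by (rule open_tgt_V)
    show "\<xi> g \<in> tangent_space B g" if "g \<in> gtgt G -` V" for g using tan that by simp
    show "\<xi> g = (\<lambda>f. 0)" if "g \<notin> gtgt G -` V" for g using that by (simp add: \<xi>_def)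
    fix W F assume W: "W \<subseteq> gtgt G -` V \<and> holo_fun B F W"
    then have F: "holo_fun B F W" by simp
    show "holo_fun B (\<lambda>g. \<xi> g F) W"
    proof (rule holo_fun_locally[OF atlasB holo_fun_open[OF F]])
      fix g assume g: "g \<in> W"
      then have gV: "gtgt G g \<in> V" using W by auto
      obtain W' f' where W': "g \<in> W'" "W' \<subseteq> W \<inter> gtgt G -` V" "holo_fun B f' W'"
        "\<forall>k\<in>W'. gen k F = tcoord k * f' k"
        using loc[OF gV g F] by blast
      \<comment> \<open>The local quotients \<open>f'\<close> and \<open>f''\<close> agree wherever
        \<open>tcoord\<close> is non-zero; if they differed at \<open>k\<close>, they would differ
        on an open set, which contains such arrows.\<close>
      have "f' k = \<xi> k F" if k: "k \<in> W'" for k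
      proof (rule ccontr)
        assume ne: "f' k \<noteq> \<xi> k F"
        have kV: "gtgt G k \<in> V" "k \<in> W" using k W'(2) by auto
        obtain W'' f'' where W'': "k \<in> W''" "holo_fun B f'' W''" "f'' k = \<xi> k F"
          "\<forall>l\<in>W''. gen l F = tcoord l * f'' l"
          using loc[OF kV F] by blast
        have "k \<in> {l \<in> W' \<inter> W''. f' l \<noteq> f'' l}" using k W''(1,3) ne by simp
        from dense[OF kV(1) holo_fun_neq_open[OF atlasB W'(3) W''(2)] this]
        obtain l where "l \<in> W'" "l \<in> W''" "f' l \<noteq> f'' l" "tcoord l \<noteq> 0" by blast
        then show False using W'(4) W''(4) by force
      qed
      then have "holo_fun B (\<lambda>g. \<xi> g F) W'" by (rule holo_fun_cong[OF atlasB W'(3)])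
      then show "\<exists>W'. g \<in> W' \<and> holo_fun B (\<lambda>g. \<xi> g F) W'" using W'(1) by blast
    qed
  qed
  moreover have "source_tangent A G \<xi>"
    unfolding source_tangent_def
  proof (intro allI impI)
    fix g f assume f: "holo_near A f (gsrc G g)"
    let ?F = "\<lambda>k. f (gsrc G k)"
    show "\<xi> g ?F = 0"
    \<comment> \<open>In the first case the value is zero by convention, either outside the domain
      of the field or on a function that is not holomorphic near \<open>g\<close>.\<close>
    proof (cases "gtgt G g \<in> V \<and> holo_near B ?F g")
      case False
      then show ?thesis using tangent_not_near[OF tan] by (auto simp: \<xi>_def)
    next
      case True
      obtain X where X: "gsrc G g \<in> X" "holo_fun A f X" using f by (auto simp: holo_near_def)
      obtain W where W: "g \<in> W" "holo_fun B ?F W" using True by (auto simp: holo_near_def)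
      have gV: "gtgt G g \<in> V" using True by simp
      obtain W' f' where W': "g \<in> W'" "holo_fun B f' W'" "f' g = \<xi> g ?F"
        "\<forall>k\<in>W'. gen k ?F = tcoord k * f' k"
        using loc[OF gV W] by blast
      show ?thesis
      proof (rule ccontr)
        assume "\<xi> g ?F \<noteq> 0"
        then have gin: "g \<in> (W' \<inter> f' -` (- {0})) \<inter> gsrc G -` X" using W' X by simp
        have "open (W' \<inter> f' -` (- {0}))"
          by (rule continuous_open_preimage[OF holo_fun_continuous_on[OF atlasB W'(2)] holo_fun_open[OF W'(2)]]) auto
        then have "open ((W' \<inter> f' -` (- {0})) \<inter> gsrc G -` X)"
          using open_src[OF holo_fun_open[OF X(2)]] by blast
        from dense[OF gV this gin]
        obtain k where k: "k \<in> W'" "f' k \<noteq> 0" "gsrc G k \<in> X" "tcoord k \<noteq> 0" by auto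
        have "gen k ?F = 0"
          by (rule section_src[OF V(1) log_field_V holo_fun_imp_near[OF X(2) k(3)]])
        then show False using W'(4) k by simp
      qed
    qed
  qed
  moreover have "right_invariant B G V \<xi>"
    unfolding right_invariant_def
  proof (intro allI impI, elim conjE)
    fix g h F F' N
    assume gV: "gtgt G g \<in> V" and gh: "gsrc G g = gtgt G h" and F: "holo_near B F (gmul G g h)"
      and N: "g \<in> N" "holo_fun B F' N" and eq: "\<forall>k\<in>N. gsrc G k = gtgt G h \<longrightarrow> F' k = F (gmul G k h)"
    have ghV: "gtgt G (gmul G g h) \<in> V" using gV tgt_mul[OF gh] by simp
    obtain W where W: "gmul G g h \<in> W" "holo_fun B F W" using F by (auto simp: holo_near_def)
    obtain W1 f1 where W1: "gmul G g h \<in> W1" "W1 \<subseteq> W \<inter> gtgt G -` V" "holo_fun B f1 W1"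
      "f1 (gmul G g h) = \<xi> (gmul G g h) F" "\<forall>k\<in>W1. gen k F = tcoord k * f1 k"
      using loc[OF ghV W] by blast
    obtain W2 f2 where W2: "g \<in> W2" "W2 \<subseteq> N \<inter> gtgt G -` V" "holo_fun B f2 W2" "f2 g = \<xi> g F'"
      "\<forall>k\<in>W2. gen k F' = tcoord k * f2 k"
      using loc[OF gV N] by blast
    obtain M mu where M: "open M" "(g, h) \<in> M" "continuous_on M mu"
      "\<And>k l. (k, l) \<in> M \<Longrightarrow> gsrc G k = gtgt G l \<Longrightarrow> mu (k, l) = gmul G k l"
      using mul_local[of g h] gh by metis
    show "\<xi> (gmul G g h) F = \<xi> g F'"
    proof (rule ccontr)
      assume ne: "\<xi> (gmul G g h) F \<noteq> \<xi> g F'"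
      \<comment> \<open>The arrows at which both local quotients are defined. Where
        \<open>tcoord k\<close> is non-zero, right invariance of \<open>gen\<close> can be divided
        by \<open>tcoord k\<close>, the same factor on both sides because right translation keeps
        the target.\<close>
      define O1 where "O1 = {k. (k, h) \<in> M \<and> mu (k, h) \<in> W1} \<inter> W2"
      have oO1: "open O1"
        unfolding O1_def using open_mul_preimage[OF M(1,3) holo_fun_open[OF W1(3)]] holo_fun_open[OF W2(3)] by blast
      have cmu: "continuous_on O1 (\<lambda>k. mu (k, h))"
        by (rule continuous_on_compose2[OF M(3), of _ "\<lambda>k. (k, h)"]) (auto simp: O1_def intro!: continuous_intros)
      have "continuous_on O1 (\<lambda>k. f1 (mu (k, h)))"
        by (rule continuous_on_compose2[OF holo_fun_continuous_on[OF atlasB W1(3)] cmu]) (auto simp: O1_def)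
      moreover have "continuous_on O1 f2"
        by (rule continuous_on_subset[OF holo_fun_continuous_on[OF atlasB W2(3)]]) (auto simp: O1_def)
      ultimately have "continuous_on O1 (\<lambda>k. f1 (mu (k, h)) - f2 k)" by (rule continuous_on_diff)
      then have o: "open (O1 \<inter> (\<lambda>k. f1 (mu (k, h)) - f2 k) -` (- {0}))"
        using oO1 by (intro continuous_open_preimage) auto
      have "g \<in> O1 \<inter> (\<lambda>k. f1 (mu (k, h)) - f2 k) -` (- {0})"
        using M(2) M(4)[OF M(2) gh] W1(1,4) W2(1,4) ne by (simp add: O1_def)
      from dense[OF gV o this]
      obtain k where k': "k \<in> O1 \<inter> (\<lambda>k. f1 (mu (k, h)) - f2 k) -` (- {0})"
        "gsrc G k = gsrc G g" "gtgt G k \<in> V" "tcoord k \<noteq> 0"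
        by blast
      have k: "k \<in> O1" "f1 (mu (k, h)) \<noteq> f2 k" "gsrc G k = gsrc G g" "gtgt G k \<in> V" "tcoord k \<noteq> 0"
        using k' by simp_all
      have kh: "gsrc G k = gtgt G h" using k(3) gh by simp
      have mk: "mu (k, h) = gmul G k h" "gmul G k h \<in> W1" using M(4) k(1) kh by (auto simp: O1_def)
      have near: "holo_near B F (gmul G k h)" using holo_fun_imp_near[OF W(2)] mk(2) W1(2) by blast
      have kN: "k \<in> N" using k(1) W2(2) by (auto simp: O1_def)
      have "gen (gmul G k h) F = gen k F'"
        by (rule section_translate[OF V(1) log_field_V k(4) kh near kN N(2)]) (use eq in blast)
      moreover have "gen (gmul G k h) F = tcoord k * f1 (gmul G k h)"
        using W1(5) mk(2) tgt_mul[OF kh] by simp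
      moreover have "gen k F' = tcoord k * f2 k" using W2(5) k(1) by (simp add: O1_def)
      ultimately show False using k(2,5) mk(1) by simp
    qed
  qed
  ultimately have "\<xi> \<in> lie_alg_sections A B G V" by (simp add: lie_alg_sections_def)
  then show ?thesis using that div by blast
qed

text \<open>The quotient comes from a section \<open>(z - z(q))\<^bsup>D(q)-1\<^esup> \<partial>/\<partial>z\<close> of \<open>T\<^sub>X(-D)\<close>, which is absurd.\<close>

lemma target_constant_on_support:
  assumes Dq: "D q \<noteq> 0" and g: "gtgt G g = q"
  shows "tgt_loc_const g"
proof (rule ccontr)
  assume "\<not> tgt_loc_const g"
  \<comment> \<open>The quotient construction needs this at every arrow into \<open>q\<close>;
    translation supplies it from the single arrow \<open>g\<close>.\<close>
  then have "\<not> tgt_loc_const g'" if "gtgt G g' = q" for g'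
    using tgt_loc_const_translate[of g g'] g that by auto
  from gen_quotient[OF Dq this]
  obtain \<xi> where \<xi>: "\<xi> \<in> lie_alg_sections A B G V"
    "\<And>g F. gtgt G g \<in> V \<Longrightarrow> holo_near B F g \<Longrightarrow> gen g F = tcoord g * \<xi> g F"
    by blast
  obtain v where v: "v \<in> log_vfields A D V" "\<Phi> V v = \<xi>" using iso_surj[OF V(1) \<xi>(1)] .
  obtain m where m: "D q = Suc m" using Dq by (cases "D q") auto
  let ?z = "\<lambda>x. \<phi> x $ 1"
  have zV: "holo_fun A ?z V" by (rule holo_fun_subset[OF atlasA chart_coord_holo[OF atlasA C] V(1,2)])
  \<comment> \<open>At an identity, anchors turn the relation between \<open>gen\<close> and
    \<open>\<xi>\<close> into one between \<open>log_field\<close> and \<open>v\<close>; cancelling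
    \<open>z - z(q)\<close> lowers the exponent by one.\<close>
  have vz: "v x ?z = (\<phi> x $ 1 - \<phi> q $ 1) ^ m" if x: "x \<in> V" "x \<noteq> q" for x
  proof -
    let ?F = "\<lambda>k. \<phi> (gtgt G k) $ 1"
    have "holo_near B ?F (gone G x)"
      using holo_fun_imp_near[OF tgt_coord_holo[OF C]] x V(2) by auto
    then have "gen (gone G x) ?F = tcoord (gone G x) * \<xi> (gone G x) ?F" using \<xi>(2) x by simp
    moreover have "\<xi> (gone G x) ?F = v x ?z"
      using iso_anchor[OF V(1) v(1) x(1) holo_fun_imp_near[OF zV x(1)]] v(2) by simp
    moreover have "gen (gone G x) ?F = (\<phi> x $ 1 - \<phi> q $ 1) ^ Suc m"
      using gen_tgt[of "gone G x"] x(1) m by simp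
    moreover have "\<phi> x $ 1 - \<phi> q $ 1 \<noteq> 0" using tcoord_eq_0[of "gone G x"] x by simp
    ultimately show ?thesis by simp
  qed
  have "vanishes_to_order A (D q) (\<lambda>x. v x ?z) q"
    using v(1) V(3) holo_fun_imp_near[OF zV V(3)] unfolding log_vfields_def by simp
  then obtain C' \<theta> W h where W: "(C', \<theta>) \<in> A" "q \<in> W" "W \<subseteq> C'" "holo_fun A h W"
    "\<forall>x\<in>W. v x ?z = (\<theta> x $ 1 - \<theta> q $ 1) ^ D q * h x"
    unfolding vanishes_to_order_def by blast
  have qC: "q \<in> C" "q \<in> C'" using V W by auto
  define c0 where "c0 = \<phi> q $ 1"
  define \<iota> where "\<iota> = (\<lambda>c. inv_into C \<phi> (vec c))"
  have vec0: "(vec c0 :: complex ^ 1) = \<phi> q" by (simp add: cvec1_eq_iff c0_def)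
  have \<iota>0: "\<iota> c0 = q" using atlas_chart(5)[OF atlasA C] qC(1) vec0 by (simp add: \<iota>_def)
  obtain e' where e': "((\<lambda>c. \<theta> (\<iota> c) $ 1) has_field_derivative e') (at c0)"
    using chart1_has_derivative[OF atlasA C qC(1) hdiff_chart_coord[OF atlasA W(1) qC(2)]]
    unfolding \<iota>_def c0_def by blast
  have "hdiff A h q" using W(2,4) unfolding holo_fun_iff[OF atlasA] by blast
  from DERIV_isCont[OF chart1_has_derivative[OF atlasA C qC(1) this]]
  have h': "((\<lambda>c. h (\<iota> c)) \<longlongrightarrow> h q) (at c0)"
    using \<iota>0 by (simp add: isCont_def \<iota>_def c0_def)
  have quot: "((\<lambda>c. (\<theta> (\<iota> c) $ 1 - \<theta> q $ 1) / (c - c0)) \<longlongrightarrow> e') (at c0)"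
    using e' \<iota>0 by (simp add: has_field_derivative_iff)
  \<comment> \<open>Membership in \<open>T\<^sub>X(-D)\<close> gives vanishing to order
    \<open>D q\<close>, possibly in another chart \<open>\<theta>\<close>, against order
    \<open>m\<close> found in \<open>\<phi>\<close>. The ratio of the two is written so that only
    \<open>c - c0\<close> tends to zero while the other factors have limits; yet the product equals
    1 near \<open>c0\<close>.\<close>
  have "((\<lambda>c. (c - c0) * ((\<theta> (\<iota> c) $ 1 - \<theta> q $ 1) / (c - c0)) ^ D q * h (\<iota> c)) \<longlongrightarrow>
      (c0 - c0) * e' ^ D q * h q) (at c0)"
    by (intro tendsto_intros quot h')
  moreover have "\<forall>\<^sub>F c in at c0. (c - c0) * ((\<theta> (\<iota> c) $ 1 - \<theta> q $ 1) / (c - c0)) ^ D q * h (\<iota> c) = 1"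
  proof -
    let ?S = "vec -` (\<phi> ` (C \<inter> (V \<inter> W)))"
    have "open (V \<inter> W)" using V(1) holo_fun_open[OF W(4)] by blast
    then have "open ?S"
      by (intro open_vimage atlas_image_open[OF atlasA C] continuous_at_imp_continuous_on ballI
          has_derivative_continuous[OF vec_has_derivative])
    moreover have "c0 \<in> ?S" using vec0 qC(1) V(3) W(2) by auto
    ultimately have "\<forall>\<^sub>F c in at c0. c \<in> ?S \<and> c \<noteq> c0"
      by (auto simp: eventually_at_topological)
    then show ?thesis
    proof eventually_elim
      case (elim c)
      then obtain x where x: "x \<in> C" "x \<in> V" "x \<in> W" "vec c = \<phi> x" by auto
      have \<iota>: "\<iota> c = x" using x atlas_chart(5)[OF atlasA C] by (simp add: \<iota>_def)
      have c: "\<phi> x $ 1 = c" using x(4) by (metis vec_component)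
      then have "x \<noteq> q" using elim by (auto simp: c0_def)
      from vz[OF x(2) this] W(5) x(3)
      have "(c - c0) ^ m = (\<theta> x $ 1 - \<theta> q $ 1) ^ D q * h x" using c by (simp add: c0_def)
      then have "(c - c0) * (\<theta> x $ 1 - \<theta> q $ 1) ^ D q * h x = (c - c0) * (c - c0) ^ m"
        by (simp only: mult.assoc)
      also have "\<dots> = (c - c0) ^ D q" using m by simp
      finally have "(c - c0) * (\<theta> x $ 1 - \<theta> q $ 1) ^ D q * h x = (c - c0) ^ D q" .
      moreover have "(c - c0) ^ D q \<noteq> 0" using elim by simp
      ultimately have "((c - c0) * (\<theta> x $ 1 - \<theta> q $ 1) ^ D q * h x) / (c - c0) ^ D q = 1"
        by (rule right_inverse_eq[THEN iffD2, rotated])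
      then have "(c - c0) * ((\<theta> x $ 1 - \<theta> q $ 1) ^ D q / (c - c0) ^ D q) * h x = 1"
        by (simp only: times_divide_eq_right times_divide_eq_left)
      then show ?case using \<iota> by (simp only: power_divide)
    qed
  qed
  ultimately have "((\<lambda>c. 1) \<longlongrightarrow> (c0 - c0) * e' ^ D q * h q) (at c0)"
    by (rule Lim_transform_eventually)
  then have "(c0 - c0) * e' ^ D q * h q = 1"
    by (rule tendsto_unique[OF at_neq_bot _ tendsto_const])
  then show False by simp
qed

end

lemma orbit_avoids_support:
  assumes "gsrc G g \<notin> support D"
  shows "gtgt G g \<notin> support D"
proof -
  let ?x = "gsrc G g"
  have "\<exists>N. open N \<and> k \<in> N \<and> (\<forall>l\<in>N \<inter> source_fibre G ?x. (gtgt G l \<notin> support D) = (gtgt G k \<notin> support D))"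
    if k: "k \<in> source_fibre G ?x" for k
  proof (cases "gtgt G k \<in> support D")
    case True
    obtain C \<phi> V where C: "(C, \<phi>) \<in> A" "open V" "gtgt G k \<in> V" "V \<subseteq> C" "V \<inter> support D \<subseteq> {gtgt G k}"
      using adapted_chart[OF open_UNIV UNIV_I] .
    have "tgt_loc_const k"
      using target_constant_on_support[OF C(1,2,4,3,5) _ refl] True by (simp add: support_def)
    then obtain N where N: "open N" "k \<in> N" "\<forall>l\<in>N. gsrc G l = gsrc G k \<longrightarrow> gtgt G l = gtgt G k"
      unfolding tgt_loc_const_def by blast
    have "gtgt G l = gtgt G k" if "l \<in> N \<inter> source_fibre G ?x" for l
      using N(3) that k by (simp add: source_fibre_def)
    then show ?thesis using N(1,2) by (intro exI[of _ N]) auto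
  next
    case False
    have "open (gtgt G -` (- support D))" by (rule open_tgt[OF open_compl_support(1)[OF eff]])
    then show ?thesis using False by (intro exI[of _ "gtgt G -` (- support D)"]) auto
  qed
  from connected_constant_predicate[where P = "\<lambda>l. gtgt G l \<notin> support D",
      OF connected_source_fibre[of ?x] this, of "gone G ?x" g] assms
  show ?thesis by (simp add: source_fibre_def)
qed

end


section \<open>Vector bundles and their homomorphisms in trivialisations\<close>

lemma trivialisation:
  assumes E: "vector_bundle A E" and V: "(V, \<tau>) \<in> btriv E"
  shows "open V" and "x \<in> V \<Longrightarrow> bij_betw \<tau> (fibre E x) UNIV"
proof -
  have "\<forall>(V, \<tau>)\<in>btriv E. open V \<and> (\<forall>x\<in>V. bij_betw \<tau> (fibre E x) UNIV)"
    using E unfolding vector_bundle_def by (elim conjE)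
  from bspec[OF this V] show "open V" "x \<in> V \<Longrightarrow> bij_betw \<tau> (fibre E x) UNIV" by auto
qed

lemma trivialisation_at:
  assumes E: "vector_bundle A E"
  obtains V \<tau> where "(V, \<tau>) \<in> btriv E" "x \<in> V"
proof -
  have "(\<Union>(V, \<tau>)\<in>btriv E. V) = UNIV"
    using E unfolding vector_bundle_def by (elim conjE)
  then have "x \<in> (\<Union>(V, \<tau>)\<in>btriv E. V)" by simp
  then show ?thesis using that by auto
qed

text \<open>Transition functions are linear, so vanishing in one trivialisation is vanishing in all.
  This makes the description in \<open>fib_zero\<close> unique and satisfiable.\<close>

lemma fib_zero_trivialised:
  fixes E :: "('x::topological_space, 'e, 'r::finite) vbundle"
  assumes E: "vector_bundle A E"
  shows "fib_zero E x \<in> fibre E x" and "(W, \<sigma>) \<in> btriv E \<Longrightarrow> x \<in> W \<Longrightarrow> \<sigma> (fib_zero E x) = 0"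
proof -
  obtain V \<tau> where V: "(V, \<tau>) \<in> btriv E" "x \<in> V" using trivialisation_at[OF E] .
  have bij: "bij_betw \<tau> (fibre E x) UNIV" by (rule trivialisation(2)[OF E V])
  then obtain c where c: "c \<in> fibre E x" "\<tau> c = 0" by (metis UNIV_I bij_betw_imp_surj_on imageE)
  have trans: "\<forall>(V, \<tau>)\<in>btriv E. \<forall>(W, \<sigma>)\<in>btriv E. \<exists>M :: 'x \<Rightarrow> complex ^ 'r ^ 'r.
        (\<forall>i j. holo_fun A (\<lambda>x. M x $ i $ j) (V \<inter> W)) \<and>
        (\<forall>x\<in>V \<inter> W. \<forall>e\<in>fibre E x. \<sigma> e = M x *v \<tau> e)"
    using E unfolding vector_bundle_def by (elim conjE)
  have all: "\<forall>(W, \<sigma>)\<in>btriv E. x \<in> W \<longrightarrow> \<sigma> c = 0"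
  proof (clarify)
    fix W \<sigma> assume W: "(W, \<sigma>) \<in> btriv E" "x \<in> W"
    obtain M :: "'x \<Rightarrow> complex ^ 'r ^ 'r" where "\<forall>x\<in>V \<inter> W. \<forall>e\<in>fibre E x. \<sigma> e = M x *v \<tau> e"
      using bspec[OF bspec[OF trans V(1), simplified] W(1)] by auto
    then show "\<sigma> c = 0" using V(2) W(2) c by simp
  qed
  have "fib_zero E x = c"
    unfolding fib_zero_def
  proof (rule the_equality)
    fix d assume d: "d \<in> fibre E x \<and> (\<forall>(W, \<sigma>)\<in>btriv E. x \<in> W \<longrightarrow> \<sigma> d = 0)"
    then have "\<tau> d = 0" using V by auto
    then show "d = c" using bij c d by (metis bij_betw_imp_inj_on inj_onD)
  qed (use c all in auto)
  then show "fib_zero E x \<in> fibre E x" "(W, \<sigma>) \<in> btriv E \<Longrightarrow> x \<in> W \<Longrightarrow> \<sigma> (fib_zero E x) = 0"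
    using c(1) all by auto
qed

lemma holo_homD:
  fixes E :: "('x, 'e, 'r::finite) vbundle"
  assumes H: "holo_hom B G E N \<Theta>"
  shows "g \<in> N \<Longrightarrow> e \<in> fibre E (gsrc G g) \<Longrightarrow> \<Theta> g e \<in> fibre E (gtgt G g)"
    and "(V, \<tau>) \<in> btriv E \<Longrightarrow> (W, \<sigma>) \<in> btriv E \<Longrightarrow> \<exists>M :: 'g::topological_space \<Rightarrow> complex ^ 'r ^ 'r.
        (\<forall>i j. holo_fun B (\<lambda>g. M g $ i $ j) (N \<inter> gsrc G -` V \<inter> gtgt G -` W)) \<and>
        (\<forall>g\<in>N \<inter> gsrc G -` V \<inter> gtgt G -` W. \<forall>e\<in>fibre E (gsrc G g). \<sigma> (\<Theta> g e) = M g *v \<tau> e)"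
proof -
  show "\<Theta> g e \<in> fibre E (gtgt G g)" if "g \<in> N" "e \<in> fibre E (gsrc G g)"
    using H that by (simp add: holo_hom_def)
  have "\<forall>(V, \<tau>)\<in>btriv E. \<forall>(W, \<sigma>)\<in>btriv E. \<exists>M :: 'g \<Rightarrow> complex ^ 'r ^ 'r.
        (\<forall>i j. holo_fun B (\<lambda>g. M g $ i $ j) (N \<inter> gsrc G -` V \<inter> gtgt G -` W)) \<and>
        (\<forall>g\<in>N \<inter> gsrc G -` V \<inter> gtgt G -` W. \<forall>e\<in>fibre E (gsrc G g). \<sigma> (\<Theta> g e) = M g *v \<tau> e)"
    using H unfolding holo_hom_def by (elim conjE)
  then show "\<exists>M :: 'g \<Rightarrow> complex ^ 'r ^ 'r.
        (\<forall>i j. holo_fun B (\<lambda>g. M g $ i $ j) (N \<inter> gsrc G -` V \<inter> gtgt G -` W)) \<and>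
        (\<forall>g\<in>N \<inter> gsrc G -` V \<inter> gtgt G -` W. \<forall>e\<in>fibre E (gsrc G g). \<sigma> (\<Theta> g e) = M g *v \<tau> e)"
    if "(V, \<tau>) \<in> btriv E" "(W, \<sigma>) \<in> btriv E"
    using that by fast
qed

lemma holo_fun_sum:
  "complex_atlas A \<Longrightarrow> finite I \<Longrightarrow> open W \<Longrightarrow> (\<And>i. i \<in> I \<Longrightarrow> holo_fun A (f i) W) \<Longrightarrow>
    holo_fun A (\<lambda>q. \<Sum>i\<in>I. f i q) W"
  by (simp add: holo_fun_iff hdiff_sum)

section \<open>Source and target as local coordinates off the divisor\<close>

context twisted_groupoid
begin

text \<open>The topological features of a product of source and target domains: a corner arrow for
  any two arrows, and connected slices in both directions. They allow passage between any two arrows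
  through one source fibre and one target fibre.\<close>

definition st_box :: "'g set \<Rightarrow> bool" where
  "st_box N \<longleftrightarrow> open N \<and> (\<forall>k\<in>N. \<forall>k'\<in>N. \<exists>l\<in>N. gsrc G l = gsrc G k \<and> gtgt G l = gtgt G k') \<and>
     (\<forall>x. connected (N \<inter> source_fibre G x)) \<and> (\<forall>y. connected (N \<inter> gtgt G -` {y}))"

text \<open>Off the divisor the generator has exponent zero, so its value is 1 on the target
  coordinate and 0 on the source coordinate. A lift of the coordinate vector through the source map
  has value 1 on the source coordinate. Hence the determinant is 1.\<close>

lemma src_tgt_coord_box:
  assumes g: "gtgt G g \<notin> support D" and U: "open U" "g \<in> U" and W: "open W" "gtgt G g \<in> W"
  obtains C' \<theta> C \<phi> V N P Q \<kappa> where "(C', \<theta>) \<in> A" "(C, \<phi>) \<in> A" "open V" "V \<subseteq> C" "gtgt G g \<in> V"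
    "V \<inter> support D \<subseteq> {gtgt G g}" "V \<subseteq> W" "g \<in> N" "N \<subseteq> U" "N \<subseteq> gsrc G -` C'" "N \<subseteq> gtgt G -` V"
    "coord_box B N (\<lambda>k. \<theta> (gsrc G k) $ 1) (\<lambda>k. \<phi> (gtgt G k) $ 1) P Q \<kappa>"
proof -
  obtain C' \<theta> where C': "(C', \<theta>) \<in> A" "gsrc G g \<in> C'" using atlas_cover[OF atlasA] .
  obtain C \<phi> V where C: "(C, \<phi>) \<in> A" "open V" "gtgt G g \<in> V" "V \<subseteq> C" "V \<subseteq> W" "V \<inter> support D \<subseteq> {gtgt G g}"
    using adapted_chart[OF W] .
  let ?s = "\<lambda>k. \<theta> (gsrc G k) $ 1" and ?t = "\<lambda>k. \<phi> (gtgt G k) $ 1"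
  let ?\<xi> = "\<Phi> V (log_field A D (C, \<phi>) (gtgt G g) V) g"
  note lf = C(1,2,4,3,6)
  obtain v where v: "v \<in> tangent_space B g" "v ?s = 1"
    using submersion_coord[OF submersion_src C'] .
  have \<xi>: "?\<xi> \<in> tangent_space B g" by (rule section_tangent[OF C(2) log_field_V[OF lf] C(3)])
  have "?\<xi> ?s = 0" by (rule gen_src[OF lf C'])
  moreover have "?\<xi> ?t = 1" using gen_tgt[OF lf C(3)] g by (simp add: support_def)
  ultimately have det: "v ?s * ?\<xi> ?t - v ?t * ?\<xi> ?s \<noteq> 0" using v(2) by simp
  define U0 where "U0 = U \<inter> gsrc G -` C' \<inter> gtgt G -` V"
  have oU0: "open U0"
    unfolding U0_def using U open_src[OF atlas_chart(1)[OF atlasA C'(1)]] open_tgt[OF C(2)] by blast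
  have g0: "g \<in> U0" using U C C' by (simp add: U0_def)
  have hs: "holo_fun B ?s U0"
    by (rule holo_fun_subset[OF atlasB src_coord_holo[OF C'(1)] oU0]) (auto simp: U0_def)
  have ht: "holo_fun B ?t U0"
    by (rule holo_fun_subset[OF atlasB tgt_coord_holo[OF C(1)] oU0]) (use C(4) in \<open>auto simp: U0_def\<close>)
  obtain N P Q \<kappa> where "g \<in> N" "N \<subseteq> U0" "coord_box B N ?s ?t P Q \<kappa>"
    using coord_box_exists[OF atlasB hs ht g0 v(1) \<xi>, OF det] .
  then show ?thesis using that[OF C'(1) C(1,2,4,3,6,5), of N P Q \<kappa>] by (auto simp: U0_def)
qed

lemma coord_box_st_box:
  assumes C: "(C', \<theta>) \<in> A" "(C, \<phi>) \<in> A" and N: "N \<subseteq> gsrc G -` C'" "N \<subseteq> gtgt G -` C"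
    and box: "coord_box B N (\<lambda>k. \<theta> (gsrc G k) $ 1) (\<lambda>k. \<phi> (gtgt G k) $ 1) P Q \<kappa>"
  shows "st_box N"
proof -
  let ?s = "\<lambda>k. \<theta> (gsrc G k) $ 1" and ?t = "\<lambda>k. \<phi> (gtgt G k) $ 1"
  note b = coord_boxD[OF box]
  have s_eq: "gsrc G k = gsrc G l" if "k \<in> N" "l \<in> N" "?s k = ?s l" for k l
    using chart1_eq[OF atlasA C(1) _ _ that(3)] that(1,2) N(1) by blast
  have t_eq: "gtgt G k = gtgt G l" if "k \<in> N" "l \<in> N" "?t k = ?t l" for k l
    using chart1_eq[OF atlasA C(2) _ _ that(3)] that(1,2) N(2) by blast
  have 1: "\<exists>l\<in>N. gsrc G l = gsrc G k \<and> gtgt G l = gtgt G k'" if k: "k \<in> N" "k' \<in> N" for k k'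
  proof -
    let ?l = "\<kappa> (?s k, ?t k')"
    note kk = b(9)[OF k(1)] b(10)[OF k(2)]
    have l: "?l \<in> N" using b(12)[OF kk] .
    moreover have "gsrc G ?l = gsrc G k" using s_eq[OF l k(1)] b(13)[OF kk] by simp
    moreover have "gtgt G ?l = gtgt G k'" using t_eq[OF l k(2)] b(14)[OF kk] by simp
    ultimately show ?thesis by blast
  qed
  have 2: "connected (N \<inter> source_fibre G x)" for x
  proof (cases "N \<inter> source_fibre G x = {}")
    case False
    then obtain k0 where k0: "k0 \<in> N" "gsrc G k0 = x" by (auto simp: source_fibre_def)
    then have "N \<inter> source_fibre G x = {k \<in> N. ?s k = ?s k0}"
      using s_eq[OF _ k0(1)] by (auto simp: source_fibre_def)
    then show ?thesis using coord_box_slices(1)[OF box] by simp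
  qed simp
  have 3: "connected (N \<inter> gtgt G -` {y})" for y
  proof (cases "N \<inter> gtgt G -` {y} = {}")
    case False
    then obtain k0 where k0: "k0 \<in> N" "gtgt G k0 = y" by auto
    then have "N \<inter> gtgt G -` {y} = {k \<in> N. ?t k = ?t k0}"
      using t_eq[OF _ k0(1)] by auto
    then show ?thesis using coord_box_slices(2)[OF box] by simp
  qed simp
  show ?thesis unfolding st_box_def using b(1) 1 2 3 by blast
qed

lemma st_box_exists:
  assumes "gtgt G g \<notin> support D" "open U" "g \<in> U"
  obtains N where "st_box N" "g \<in> N" "N \<subseteq> U"
proof -
  obtain C' \<theta> C \<phi> V N P Q \<kappa> where N: "(C', \<theta>) \<in> A" "(C, \<phi>) \<in> A" "open V" "V \<subseteq> C" "gtgt G g \<in> V"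
    "V \<inter> support D \<subseteq> {gtgt G g}" "V \<subseteq> UNIV" "g \<in> N" "N \<subseteq> U" "N \<subseteq> gsrc G -` C'" "N \<subseteq> gtgt G -` V"
    "coord_box B N (\<lambda>k. \<theta> (gsrc G k) $ 1) (\<lambda>k. \<phi> (gtgt G k) $ 1) P Q \<kappa>"
    using src_tgt_coord_box[OF assms open_UNIV UNIV_I] .
  have "N \<subseteq> gtgt G -` C" using N(4,11) by blast
  from coord_box_st_box[OF N(1,2,10) this N(12)] show ?thesis using that N(8,9) by blast
qed

text \<open>The pulled-back coordinate is part of a coordinate box, so it takes every value of an
  open set of complex numbers, which is not a single point; other points of \<open>V\<close> are off
  the divisor.\<close>

lemma submersion_off_support:
  assumes F: "submersion B A F" and U: "open U" "g \<in> U"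
  shows "\<exists>k\<in>U. F k \<notin> support D"
proof -
  have map: "holo_map B A F UNIV" using F by (simp add: submersion_def)
  obtain C \<phi> V where C: "(C, \<phi>) \<in> A" "open V" "F g \<in> V" "V \<subseteq> C" "V \<inter> support D \<subseteq> {F g}"
    using adapted_chart[OF open_UNIV UNIV_I] .
  define f where "f = (\<lambda>k. \<phi> (F k) $ 1)"
  have hf: "holo_fun B f (F -` C)" using holo_mapD(3)[OF map C(1)] by (simp add: f_def)
  have FgC: "F g \<in> C" using C by blast
  obtain v where v: "v \<in> tangent_space B g" "v (\<lambda>k. \<phi> (F k) $ 1) = 1"
    using submersion_coord[OF F C(1) FgC] .
  have near: "holo_near B f g" by (rule holo_fun_imp_near[OF hf]) (use FgC in simp)
  have vf: "v f \<noteq> 0" using v(2) by (simp add: f_def)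
  obtain w X u u' where w: "g \<in> X" "holo_fun B w X" "u \<in> tangent_space B g" "u' \<in> tangent_space B g"
    "u f * u' w - u w * u' f \<noteq> 0"
    using complete_coordinate[OF atlasB near v(1) vf] .
  define U0 where "U0 = U \<inter> X \<inter> F -` V"
  have "open (F -` V)" using holo_mapD(2)[OF map] C(2) by (auto intro: open_vimage)
  then have oU0: "open U0" using U(1) holo_fun_open[OF w(2)] by (auto simp: U0_def)
  have h0: "holo_fun B f U0" "holo_fun B w U0" "g \<in> U0"
    using holo_fun_subset[OF atlasB hf oU0] holo_fun_subset[OF atlasB w(2) oU0] C U w(1)
    by (auto simp: U0_def)
  obtain N P Q \<kappa> where N: "g \<in> N" "N \<subseteq> U0" "coord_box B N f w P Q \<kappa>"
    using coord_box_exists[OF atlasB h0 w(3,4), OF w(5)] .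
  note b = coord_boxD[OF N(3)]
  have "P \<noteq> {f g}" using b(2) not_open_singleton by metis
  then obtain z where z: "z \<in> P" "z \<noteq> f g" using b(9)[OF N(1)] by blast
  let ?k = "\<kappa> (z, w g)"
  note kk = z(1) b(10)[OF N(1)]
  have "?k \<in> U0" using b(12)[OF kk] N(2) by blast
  moreover have "F ?k \<noteq> F g" using b(13)[OF kk] z(2) by (auto simp: f_def)
  ultimately show ?thesis using C(5) by (auto simp: U0_def)
qed

text \<open>The source is moved off the divisor before the target: the condition on the source is
  open, so it survives the second move.\<close>

lemma restricted_arrows_dense:
  assumes U: "open U" "g \<in> U"
  shows "\<exists>k\<in>U. k \<in> restricted_arrows D G"
proof -
  have o: "open (gsrc G -` (- support D))" by (rule open_src[OF open_compl_support(1)[OF eff]])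
  obtain k where k: "k \<in> U" "gsrc G k \<notin> support D"
    using submersion_off_support[OF submersion_src U] by blast
  have "open (U \<inter> gsrc G -` (- support D))" using U(1) o by blast
  from submersion_off_support[OF submersion_tgt this, of k] k
  show ?thesis by (auto simp: restricted_arrows_def)
qed

text \<open>With this the connected set available for propagation is the whole source fibre. A
  source fibre with some arrows removed could fall apart, and its pieces could miss the
  identity.\<close>

lemma src_fibre_restricted:
  "x \<notin> support D \<Longrightarrow> k \<in> source_fibre G x \<Longrightarrow> k \<in> restricted_arrows D G"
  using orbit_avoids_support[of k] by (simp add: restricted_arrows_def source_fibre_def)

end

section \<open>Representations and fundamental solutions\<close>

locale integrated_connection = twisted_groupoid A D B G \<Phi>
  for A :: "('x::t2_space, 1) atlas"
    and D :: "'x \<Rightarrow> nat"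
    and B :: "('g::topological_space, 2) atlas"
    and G :: "('x, 'g) groupoid"
    and \<Phi> :: "'x set \<Rightarrow> 'x vfield \<Rightarrow> 'g vfield" +
  fixes E :: "('x, 'e, 'r::finite) vbundle"
    and nab :: "('x, 'e) conn"
    and \<Psi> :: "'g \<Rightarrow> 'e \<Rightarrow> 'e"
    and p :: "'u::topological_space \<Rightarrow> 'x"
    and \<psi> :: "'u \<Rightarrow> complex ^ 'r \<Rightarrow> 'e"
  assumes vb: "vector_bundle A E"
    and rep: "groupoid_rep B G E \<Psi>"
    and int: "integrates A D G \<Phi> E nab \<Psi>"
    and cover: "universal_cover p (- support D)"
    and fund: "fundamental_solution A D E nab p \<psi>"
begin

lemma rep_hom: "holo_hom B G E UNIV \<Psi>"
  and rep_bij: "bij_betw (\<Psi> g) (fibre E (gsrc G g)) (fibre E (gtgt G g))"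
  and rep_mul: "gsrc G g = gtgt G h \<Longrightarrow> e \<in> fibre E (gsrc G h) \<Longrightarrow> \<Psi> (gmul G g h) e = \<Psi> g (\<Psi> h e)"
  using rep by (simp_all add: groupoid_rep_def)

lemma rep_in: "e \<in> fibre E (gsrc G g) \<Longrightarrow> \<Psi> g e \<in> fibre E (gtgt G g)"
  using bij_betw_apply[OF rep_bij] .

lemma rep_inj: "e \<in> fibre E (gsrc G g) \<Longrightarrow> e' \<in> fibre E (gsrc G g) \<Longrightarrow> \<Psi> g e = \<Psi> g e' \<Longrightarrow> e = e'"
  using bij_betw_imp_inj_on[OF rep_bij[of g]] by (simp add: inj_on_def)

text \<open>Multiplicativity makes the map at an identity idempotent, and an injective idempotent
  map is the identity.\<close>

lemma rep_one:
  assumes "e \<in> fibre E x" shows "\<Psi> (gone G x) e = e"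
proof -
  let ?i = "gone G x"
  have e: "e \<in> fibre E (gsrc G ?i)" using assms by simp
  have "gmul G ?i ?i = ?i" using one_mul[of ?i] by simp
  then have "\<Psi> ?i (\<Psi> ?i e) = \<Psi> ?i e" using rep_mul[of ?i ?i e] e by simp
  then show ?thesis using rep_inj[of "\<Psi> ?i e" ?i e] rep_in[OF e] e by simp
qed

lemma rep_inv1: "e \<in> fibre E (gsrc G g) \<Longrightarrow> \<Psi> (ginv G g) (\<Psi> g e) = e"
  using rep_mul[of "ginv G g" g e] rep_one[of e "gsrc G g"] by (simp add: inv_mul)

lemma rep_inv2: "e \<in> fibre E (gtgt G g) \<Longrightarrow> \<Psi> g (\<Psi> (ginv G g) e) = e"
  using rep_mul[of g "ginv G g" e] rep_one[of e "gtgt G g"] by (simp add: mul_inv)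

lemma rep_inv_into:
  assumes "e \<in> fibre E (gtgt G g)"
  shows "inv_into (fibre E (gsrc G g)) (\<Psi> g) e = \<Psi> (ginv G g) e"
proof (rule inv_into_f_eq)
  show "inj_on (\<Psi> g) (fibre E (gsrc G g))" using bij_betw_imp_inj_on[OF rep_bij] .
  show "\<Psi> (ginv G g) e \<in> fibre E (gsrc G g)" using rep_in[of e "ginv G g"] assms by simp
  show "\<Psi> g (\<Psi> (ginv G g) e) = e" by (rule rep_inv2[OF assms])
qed

text \<open>The inverse of \<open>\<Psi> k\<close> is \<open>\<Psi> (ginv G k)\<close>, so its
  matrix is the holomorphic matrix of \<open>\<Psi>\<close> composed with inversion of arrows; no
  matrix has to be inverted.\<close>

lemma pullback_holo:
  assumes e: "holo_section A E V e" and W: "(W, \<tau>) \<in> btriv E"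
  shows "holo_fun B (\<lambda>k. \<tau> (inv_into (fibre E (gsrc G k)) (\<Psi> k) (e (gtgt G k))) $ i)
    (gsrc G -` W \<inter> gtgt G -` V)"
proof (rule holo_fun_locally[OF atlasB])
  have V: "open V" and eV: "\<And>x. x \<in> V \<Longrightarrow> e x \<in> fibre E x"
    using e by (simp_all add: holo_section_def)
  have oW: "open W" by (rule trivialisation(1)[OF vb W])
  show "open (gsrc G -` W \<inter> gtgt G -` V)" using open_src[OF oW] open_tgt[OF V] by blast
  fix k0 assume k0: "k0 \<in> gsrc G -` W \<inter> gtgt G -` V"
  obtain W1 \<tau>1 where W1: "(W1, \<tau>1) \<in> btriv E" "gtgt G k0 \<in> W1" using trivialisation_at[OF vb] .
  obtain M :: "'g \<Rightarrow> complex ^ 'r ^ 'r" where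
    M: "\<And>i j. holo_fun B (\<lambda>g. M g $ i $ j) (UNIV \<inter> gsrc G -` W1 \<inter> gtgt G -` W)"
      "\<And>g e. g \<in> UNIV \<inter> gsrc G -` W1 \<inter> gtgt G -` W \<Longrightarrow> e \<in> fibre E (gsrc G g) \<Longrightarrow> \<tau> (\<Psi> g e) = M g *v \<tau>1 e"
    using holo_homD(2)[OF rep_hom W1(1) W] by blast
  define N where "N = gsrc G -` W \<inter> gtgt G -` (V \<inter> W1)"
  have oN: "open N"
    unfolding N_def using open_src[OF oW] open_tgt[of "V \<inter> W1"] V trivialisation(1)[OF vb W1(1)] by blast
  have "holo_fun B (\<lambda>k. M (ginv G k) $ i $ j) N" for j
    by (rule holo_fun_subset[OF atlasB holo_fun_compose_map[OF atlasB atlasB map_inv M(1)] oN])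
      (auto simp: N_def)
  moreover have "holo_fun B (\<lambda>k. \<tau>1 (e (gtgt G k)) $ j) N" for j
  proof -
    have "\<forall>(W, \<tau>)\<in>btriv E. \<forall>i. holo_fun A (\<lambda>x. \<tau> (e x) $ i) (V \<inter> W)"
      using e unfolding holo_section_def by (elim conjE)
    then have "holo_fun A (\<lambda>x. \<tau>1 (e x) $ j) (V \<inter> W1)" using W1(1) by fast
    from holo_fun_subset[OF atlasB tgt_compose_holo[OF this] oN] show ?thesis by (auto simp: N_def)
  qed
  ultimately have "holo_fun B (\<lambda>k. \<Sum>j\<in>UNIV. M (ginv G k) $ i $ j * \<tau>1 (e (gtgt G k)) $ j) N"
    by (intro holo_fun_sum holo_fun_mult atlasB oN) auto
  then have "holo_fun B (\<lambda>k. \<tau> (inv_into (fibre E (gsrc G k)) (\<Psi> k) (e (gtgt G k))) $ i) N"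
  proof (rule holo_fun_cong[OF atlasB])
    fix k assume k: "k \<in> N"
    then have ek: "e (gtgt G k) \<in> fibre E (gtgt G k)" using eV by (simp add: N_def)
    have "\<tau> (\<Psi> (ginv G k) (e (gtgt G k))) = M (ginv G k) *v \<tau>1 (e (gtgt G k))"
      by (rule M(2)) (use k ek in \<open>auto simp: N_def\<close>)
    then show "(\<Sum>j\<in>UNIV. M (ginv G k) $ i $ j * \<tau>1 (e (gtgt G k)) $ j) =
        \<tau> (inv_into (fibre E (gsrc G k)) (\<Psi> k) (e (gtgt G k))) $ i"
      unfolding rep_inv_into[OF ek] by (simp add: matrix_vector_mult_def)
  qed
  moreover have "k0 \<in> N" using k0 W1(2) by (simp add: N_def)
  ultimately show "\<exists>W'. k0 \<in> W' \<and> holo_fun B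
      (\<lambda>k. \<tau> (inv_into (fibre E (gsrc G k)) (\<Psi> k) (e (gtgt G k))) $ i) W'" by blast
qed

section \<open>Flat transport along source fibres\<close>

lemma psi_bij: "bij_betw (\<psi> y) UNIV (fibre E (p y))"
  using fund by (simp add: fundamental_solution_def)

lemma psi_in: "\<psi> y c \<in> fibre E (p y)"
  using bij_betw_apply[OF psi_bij, of c] by simp

definition section_on :: "'x set \<Rightarrow> ('x \<Rightarrow> 'u) \<Rightarrow> bool" where
  "section_on W \<rho> \<longleftrightarrow> open W \<and> W \<subseteq> - support D \<and> continuous_on W \<rho> \<and> (\<forall>x\<in>W. p (\<rho> x) = x)"

lemma section_on_subset: "section_on W \<rho> \<Longrightarrow> open V \<Longrightarrow> V \<subseteq> W \<Longrightarrow> section_on V \<rho>"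
  unfolding section_on_def by (auto intro: continuous_on_subset)

lemma psi_section_in: "section_on W \<rho> \<Longrightarrow> x \<in> W \<Longrightarrow> \<psi> (\<rho> x) c \<in> fibre E x"
  using psi_in[of "\<rho> x" c] by (simp add: section_on_def)

lemma branch_holo_flat:
  assumes "section_on W \<rho>"
  shows "holo_section A E W (\<lambda>x. \<psi> (\<rho> x) c)"
    and "x \<in> W \<Longrightarrow> w \<in> tangent_space A x \<Longrightarrow> nab (\<lambda>y. \<psi> (\<rho> y) c) x w = fib_zero E x"
proof -
  have "\<forall>W \<rho>. open W \<and> W \<subseteq> - support D \<and> continuous_on W \<rho> \<and> (\<forall>x\<in>W. p (\<rho> x) = x) \<longrightarrow>
        (\<forall>c. holo_section A E W (\<lambda>x. \<psi> (\<rho> x) c) \<and>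
           (\<forall>x\<in>W. \<forall>w\<in>tangent_space A x. nab (\<lambda>y. \<psi> (\<rho> y) c) x w = fib_zero E x))"
    using fund unfolding fundamental_solution_def by (elim conjE)
  then show "holo_section A E W (\<lambda>x. \<psi> (\<rho> x) c)"
    "x \<in> W \<Longrightarrow> w \<in> tangent_space A x \<Longrightarrow> nab (\<lambda>y. \<psi> (\<rho> y) c) x w = fib_zero E x"
    using assms unfolding section_on_def by auto
qed

text \<open>At the identities this is the definition of the integrated representation; elsewhere it follows
  by right translation.\<close>

lemma transport_flat:
  assumes v: "v \<in> log_vfields A D V" and \<rho>: "section_on V \<rho>" and g: "gtgt G g \<in> V"
    and W0: "(W0, \<tau>0) \<in> btriv E" "gsrc G g \<in> W0"
  shows "\<Phi> V v g (\<lambda>k. \<tau>0 (inv_into (fibre E (gsrc G k)) (\<Psi> k) (\<psi> (\<rho> (gtgt G k)) c)) $ i) = 0"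
proof -
  define e where "e = (\<lambda>x. \<psi> (\<rho> x) c)"
  have V: "open V" "V \<subseteq> - support D" using \<rho> by (auto simp: section_on_def)
  have eh: "holo_section A E V e" unfolding e_def by (rule branch_holo_flat(1)[OF \<rho>])
  have eV: "e x \<in> fibre E x" if "x \<in> V" for x unfolding e_def by (rule psi_section_in[OF \<rho> that])
  define y where "y = gtgt G g"
  have y: "y \<in> V" using g by (simp add: y_def)
  obtain W \<tau> where W: "(W, \<tau>) \<in> btriv E" "y \<in> W" using trivialisation_at[OF vb] .
  define F where "F = (\<lambda>\<tau> i k. (\<tau> (inv_into (fibre E (gsrc G k)) (\<Psi> k) (e (gtgt G k))) :: complex ^ 'r) $ i)"
  have Fh: "holo_fun B (F \<tau> i) (gsrc G -` W \<inter> gtgt G -` V)" if "(W, \<tau>) \<in> btriv E" for W \<tau> i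
    unfolding F_def by (rule pullback_holo[OF eh that])
  have vt: "v x \<in> tangent_space A x" if "x \<in> V" for x
    using v that by (simp add: log_vfields_def holo_vfield_def)
  \<comment> \<open>Flatness of the branch makes the zero section the derivative of \<open>e\<close>
    along \<open>v\<close>; \<open>alg_conn\<close> asks in addition that this section be
    holomorphic on all of \<open>V\<close>.\<close>
  have "holo_section A E V (fib_zero E)"
    unfolding holo_section_def
  proof (intro conjI ballI)
    show "\<And>x. fib_zero E x \<in> fibre E x" by (rule fib_zero_trivialised(1)[OF vb])
    fix T assume "T \<in> btriv E"
    then obtain X \<sigma> where T: "T = (X, \<sigma>)" "(X, \<sigma>) \<in> btriv E" by (cases T) auto
    have "holo_fun A (\<lambda>x. \<sigma> (fib_zero E x) $ i) (V \<inter> X)" for i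
    proof (rule holo_fun_cong[OF atlasA holo_fun_const[OF atlasA, of _ 0]])
      show "open (V \<inter> X)" using V trivialisation(1)[OF vb T(2)] by blast
      show "0 = \<sigma> (fib_zero E x) $ i" if "x \<in> V \<inter> X" for x
        using fib_zero_trivialised(2)[OF vb T(2)] that by simp
    qed
    then show "case T of (W, \<tau>) \<Rightarrow> \<forall>i. holo_fun A (\<lambda>x. \<tau> (fib_zero E x) $ i) (V \<inter> W)"
      using T by simp
  qed fact
  then have "alg_conn A D E nab V v e (fib_zero E)"
    unfolding alg_conn_def using v eh branch_holo_flat(2)[OF \<rho> _ vt] by (auto simp: e_def)
  then have "\<forall>x\<in>V. \<forall>(W, \<tau>)\<in>btriv E. x \<in> W \<longrightarrow> (\<forall>i. \<tau> (fib_zero E x) $ i =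
      \<Phi> V v (gone G x) (\<lambda>g. \<tau> (inv_into (fibre E (gsrc G g)) (\<Psi> g) (e (gtgt G g))) $ i))"
    using int unfolding integrates_def by blast
  then have "\<tau> (fib_zero E y) $ j = \<Phi> V v (gone G y) (F \<tau> j)" for j
    unfolding F_def using y W by fast
  then have one: "\<Phi> V v (gone G y) (F \<tau> j) = 0" for j
    using fib_zero_trivialised(2)[OF vb W] by simp
  obtain M :: "'g \<Rightarrow> complex ^ 'r ^ 'r" where
    M: "\<And>g e. g \<in> UNIV \<inter> gsrc G -` W \<inter> gtgt G -` W0 \<Longrightarrow> e \<in> fibre E (gsrc G g) \<Longrightarrow> \<tau>0 (\<Psi> g e) = M g *v \<tau> e"
    using holo_homD(2)[OF rep_hom W(1) W0(1)] by blast
  define K where "K = M (ginv G g)"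
  have K: "\<tau>0 (\<Psi> (ginv G g) u) = K *v \<tau> u" if "u \<in> fibre E y" for u
    unfolding K_def by (rule M) (use that W(2) W0(2) in \<open>auto simp: y_def\<close>)
  \<comment> \<open>On the source fibre over \<open>y\<close>, the inverse of
    \<open>\<Psi>(l g)\<close> is that of \<open>\<Psi>(l)\<close> followed by that of
    \<open>\<Psi>(g)\<close>. The latter is the constant matrix \<open>K\<close>, so there
    \<open>F'\<close> is \<open>F \<tau>0 i\<close> after right translation by \<open>g\<close>; off
    that fibre it is just a holomorphic extension.\<close>
  define F' where "F' = (\<lambda>l. \<Sum>j\<in>UNIV. K $ i $ j * F \<tau> j l)"
  let ?N = "gsrc G -` W \<inter> gtgt G -` V"
  have oneN: "gone G y \<in> ?N" using y W(2) by simp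
  have hF': "holo_fun B F' ?N"
    unfolding F'_def
    using holo_fun_open[OF Fh[OF W(1)]]
    by (intro holo_fun_sum holo_fun_mult holo_fun_const atlasB Fh W(1)) auto
  have "\<Phi> V v (gmul G (gone G y) g) (F \<tau>0 i) = \<Phi> V v (gone G y) F'"
  proof (rule section_translate[OF V(1) v _ _ _ oneN hF'])
    show "gtgt G (gone G y) \<in> V" "gsrc G (gone G y) = gtgt G g" using y by (simp_all add: y_def)
    have "g \<in> gsrc G -` W0 \<inter> gtgt G -` V" using W0(2) g by simp
    from holo_fun_imp_near[OF Fh[OF W0(1)] this]
    show "holo_near B (F \<tau>0 i) (gmul G (gone G y) g)" by (simp add: y_def)
    fix l assume l: "l \<in> ?N" "gsrc G l = gtgt G g"
    let ?e = "e (gtgt G l)"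
    have el: "?e \<in> fibre E (gtgt G l)" using eV l(1) by simp
    let ?u = "\<Psi> (ginv G l) ?e"
    have u: "?u \<in> fibre E (gtgt G g)" using rep_in[of ?e "ginv G l"] el l(2) by simp
    have u': "\<Psi> (ginv G g) ?u \<in> fibre E (gsrc G g)" using rep_in[of ?u "ginv G g"] u by simp
    have "\<Psi> (gmul G l g) (\<Psi> (ginv G g) ?u) = ?e"
      using rep_mul[OF l(2) u'] rep_inv2[OF u] rep_inv2[OF el] by simp
    then have "inv_into (fibre E (gsrc G (gmul G l g))) (\<Psi> (gmul G l g)) (e (gtgt G (gmul G l g))) = \<Psi> (ginv G g) ?u"
      using u' src_mul[OF l(2)] tgt_mul[OF l(2)] bij_betw_imp_inj_on[OF rep_bij[of "gmul G l g"]]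
      by (intro inv_into_f_eq) auto
    then have "F \<tau>0 i (gmul G l g) = (K *v \<tau> ?u) $ i"
      using K[of ?u] u by (simp add: F_def y_def)
    also have "\<dots> = F' l"
      using rep_inv_into[OF el] by (simp add: F'_def F_def matrix_vector_mult_def)
    finally show "F' l = F \<tau>0 i (gmul G l g)" by simp
  qed
  also have "\<dots> = (\<Sum>j\<in>UNIV. K $ i $ j * \<Phi> V v (gone G y) (F \<tau> j))"
    unfolding F'_def
    by (rule tangent_linear_comb(2)[OF atlasB section_tangent[OF V(1) v]])
      (use y holo_fun_imp_near[OF Fh[OF W(1)] oneN] in auto)
  also have "\<dots> = 0" using one by simp
  finally show ?thesis by (simp add: F_def e_def y_def)
qed

text \<open>Off the divisor the chosen field has value 0 on the source coordinate and 1 on the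
  target coordinate, so in the box it is differentiation in the second coordinate. Its vanishing on
  the transported section makes the latter constant over the convex side \<open>Q\<close>.\<close>

lemma transport_locally_constant:
  assumes \<rho>: "section_on W \<rho>" and g: "gtgt G g \<in> W"
  shows "\<exists>N. open N \<and> g \<in> N \<and> (\<forall>k\<in>N. gsrc G k = gsrc G g \<longrightarrow> (\<forall>c.
    inv_into (fibre E (gsrc G k)) (\<Psi> k) (\<psi> (\<rho> (gtgt G k)) c) =
    inv_into (fibre E (gsrc G g)) (\<Psi> g) (\<psi> (\<rho> (gtgt G g)) c)))"
proof -
  have W: "open W" "W \<subseteq> - support D" using \<rho> by (auto simp: section_on_def)
  obtain W0 \<tau>0 where W0: "(W0, \<tau>0) \<in> btriv E" "gsrc G g \<in> W0" using trivialisation_at[OF vb] .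
  have oU: "open (gsrc G -` W0)" by (rule open_src[OF trivialisation(1)[OF vb W0(1)]])
  have gs: "gtgt G g \<notin> support D" "g \<in> gsrc G -` W0" using W g W0(2) by auto
  obtain C' \<theta> C \<phi> V N P Q \<kappa> where N: "(C', \<theta>) \<in> A" "(C, \<phi>) \<in> A" "open V" "V \<subseteq> C" "gtgt G g \<in> V"
    "V \<inter> support D \<subseteq> {gtgt G g}" "V \<subseteq> W" "g \<in> N" "N \<subseteq> gsrc G -` W0" "N \<subseteq> gsrc G -` C'" "N \<subseteq> gtgt G -` V"
    "coord_box B N (\<lambda>k. \<theta> (gsrc G k) $ 1) (\<lambda>k. \<phi> (gtgt G k) $ 1) P Q \<kappa>"
    using src_tgt_coord_box[OF gs(1) oU gs(2) W(1) g] .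
  let ?s = "\<lambda>k. \<theta> (gsrc G k) $ 1" and ?t = "\<lambda>k. \<phi> (gtgt G k) $ 1"
  let ?v = "log_field A D (C, \<phi>) (gtgt G g) V"
  note b = coord_boxD[OF N(12)] and lf = N(2,3,4,5,6)
  have \<rho>V: "section_on V \<rho>" by (rule section_on_subset[OF \<rho> N(3,7)])
  define F where "F = (\<lambda>c i k. \<tau>0 (inv_into (fibre E (gsrc G k)) (\<Psi> k) (\<psi> (\<rho> (gtgt G k)) c)) $ i)"
  have Fh: "holo_fun B (F c i) N" for c i
    unfolding F_def
    by (rule holo_fun_subset[OF atlasB pullback_holo[OF branch_holo_flat(1)[OF \<rho>V] W0(1)] b(1)])
      (use N(9,11) in auto)
  have dom: "P \<times> Q \<inter> \<kappa> -` N = P \<times> Q" using b(12) by auto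
  have F2: "holo2 (F c i \<circ> \<kappa>) (P \<times> Q)" for c i using b(15)[OF Fh[of c i]] dom by simp
  have D0: "D (gtgt G g) = 0" using gs(1) by (simp add: support_def)
  have pd0: "pd2 (F c i \<circ> \<kappa>) (?s g, y) = 0" if y: "y \<in> Q" for c i y
  proof -
    let ?k = "\<kappa> (?s g, y)"
    note kk = b(9)[OF N(8)] y
    have k: "?k \<in> N" by (rule b(12)[OF kk])
    have kV: "gtgt G ?k \<in> V" "gsrc G ?k \<in> C'" "gsrc G ?k \<in> W0" using k N(9,10,11) by auto
    have tan: "\<Phi> V ?v ?k \<in> tangent_space B ?k"
      by (rule section_tangent[OF N(3) log_field_V[OF lf] kV(1)])
    have "\<Phi> V ?v ?k (F c i) = 0"
      unfolding F_def by (rule transport_flat[OF log_field_V[OF lf] \<rho>V kV(1) W0(1) kV(3)])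
    moreover have "\<Phi> V ?v ?k ?s = 0" by (rule gen_src[OF lf N(1) kV(2)])
    moreover have "\<Phi> V ?v ?k ?t = 1" using gen_tgt[OF lf kV(1)] D0 by simp
    ultimately have "pd2 (F c i \<circ> \<kappa>) (?s ?k, ?t ?k) = 0"
      using coord_box_value[OF atlasB N(12) k k tan Fh[of c i]] by simp
    then show ?thesis using b(13,14)[OF kk] by simp
  qed
  have const: "F c i k = F c i g" if k: "k \<in> N" "gsrc G k = gsrc G g" for c i k
  proof -
    have "((\<lambda>y. (F c i \<circ> \<kappa>) (?s g, y)) has_field_derivative 0) (at y within Q)" if "y \<in> Q" for y
      using has_field_derivative_at_within[OF holo2_pd2[OF F2[of c i], of "?s g" y]] pd0[OF that] b(9)[OF N(8)] that
      by simp
    from has_field_derivative_zero_constant[OF b(5) this]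
    obtain a where a: "\<forall>y\<in>Q. (F c i \<circ> \<kappa>) (?s g, y) = a" by blast
    have "\<kappa> (?s g, ?t k) = k" "\<kappa> (?s g, ?t g) = g"
      using b(11)[OF k(1)] b(11)[OF N(8)] k(2) by simp_all
    then show ?thesis using a[rule_format, OF b(10)[OF k(1)]] a[rule_format, OF b(10)[OF N(8)]] by simp
  qed
  have "inv_into (fibre E (gsrc G k)) (\<Psi> k) (\<psi> (\<rho> (gtgt G k)) c) =
    inv_into (fibre E (gsrc G g)) (\<Psi> g) (\<psi> (\<rho> (gtgt G g)) c)" (is "?a = ?b")
    if k: "k \<in> N" "gsrc G k = gsrc G g" for k c
  proof -
    have kt: "gtgt G k \<in> W" using k(1) N(7,11) by blast
    have *: "inv_into (fibre E (gsrc G l)) (\<Psi> l) (\<psi> (\<rho> (gtgt G l)) c) \<in> fibre E (gsrc G l)"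
      if "gtgt G l \<in> W" for l
    proof -
      have "\<psi> (\<rho> (gtgt G l)) c \<in> fibre E (gtgt G l)" by (rule psi_section_in[OF \<rho> that])
      then show ?thesis using inv_into_into[of _ "\<Psi> l" "fibre E (gsrc G l)"] bij_betw_imp_surj_on[OF rep_bij[of l]] by simp
    qed
    have "\<tau>0 ?a = \<tau>0 ?b" using const[OF k] by (simp add: F_def vec_eq_iff)
    moreover have "?a \<in> fibre E (gsrc G g)" "?b \<in> fibre E (gsrc G g)" using *[OF kt] *[OF g] k(2) by simp_all
    ultimately show ?thesis
      using bij_betw_imp_inj_on[OF trivialisation(2)[OF vb W0]] by (simp add: inj_on_def)
  qed
  then show ?thesis using b(1) N(8) by blast
qed

text \<open>The branch \<open>\<rho>\<close> is fixed, so only connected pieces with targets in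
  \<open>W\<close> are covered. Whole source fibres are treated later by changing the branch from
  box to box.\<close>

lemma transport_constant:
  assumes \<rho>: "section_on W \<rho>" and K: "connected K" "K \<subseteq> source_fibre G x" "K \<subseteq> gtgt G -` W"
    and k: "k \<in> K" "k' \<in> K"
  shows "inv_into (fibre E x) (\<Psi> k) (\<psi> (\<rho> (gtgt G k)) c) = inv_into (fibre E x) (\<Psi> k') (\<psi> (\<rho> (gtgt G k')) c)"
proof -
  let ?val = "\<lambda>l. inv_into (fibre E x) (\<Psi> l) (\<psi> (\<rho> (gtgt G l)) c)"
  have "?val k' = ?val k"
  proof (rule connected_constant_predicate[where P = "\<lambda>l. ?val l = ?val k" and S = K and a = k])
    fix g assume g: "g \<in> K"
    then have gx: "gsrc G g = x" "gtgt G g \<in> W" using K by (auto simp: source_fibre_def)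
    obtain N where N: "open N" "g \<in> N" "\<forall>k\<in>N. gsrc G k = gsrc G g \<longrightarrow> (\<forall>c.
      inv_into (fibre E (gsrc G k)) (\<Psi> k) (\<psi> (\<rho> (gtgt G k)) c) =
      inv_into (fibre E (gsrc G g)) (\<Psi> g) (\<psi> (\<rho> (gtgt G g)) c))"
      using transport_locally_constant[OF \<rho> gx(2)] by blast
    have "?val l = ?val g" if "l \<in> N \<inter> K" for l
    proof -
      have "gsrc G l = x" using that K(2) by (auto simp: source_fibre_def)
      then show ?thesis using N(3) that gx(1) by simp
    qed
    then show "\<exists>N. open N \<and> g \<in> N \<and> (\<forall>l\<in>N \<inter> K. (?val l = ?val k) = (?val g = ?val k))"
      using N(1,2) by (intro exI[of _ N]) auto
  qed (use K k in auto)
  then show ?thesis by simp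
qed

text \<open>The transport is constant along source fibres, and by inversion along target fibres; together
  these directions connect any two points of a box.\<close>

lemma branch_constant:
  assumes \<rho>: "section_on Wa \<rho>a" "section_on Wb \<rho>b"
    and N: "st_box N" "N \<subseteq> gsrc G -` Wa" "N \<subseteq> gtgt G -` Wb" and k: "k \<in> N" "k' \<in> N"
    and br: "\<forall>c. \<Psi> k (\<psi> (\<rho>a (gsrc G k)) c) = \<psi> (\<rho>b (gtgt G k)) c"
  shows "\<forall>c. \<Psi> k' (\<psi> (\<rho>a (gsrc G k')) c) = \<psi> (\<rho>b (gtgt G k')) c"
proof
  fix c
  obtain l where l: "l \<in> N" "gsrc G l = gsrc G k" "gtgt G l = gtgt G k'"
    using N(1) k unfolding st_box_def by blast
  have src: "gsrc G m \<in> Wa" and tgt: "gtgt G m \<in> Wb" if "m \<in> N" for m using that N by auto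
  let ?u = "\<psi> (\<rho>a (gsrc G k)) c"
  have u: "?u \<in> fibre E (gsrc G k)" by (rule psi_section_in[OF \<rho>(1) src[OF k(1)]])
  have conn: "connected (N \<inter> source_fibre G (gsrc G k))" using N(1) by (simp add: st_box_def)
  have "inv_into (fibre E (gsrc G k)) (\<Psi> k) (\<psi> (\<rho>b (gtgt G k)) c) =
    inv_into (fibre E (gsrc G k)) (\<Psi> l) (\<psi> (\<rho>b (gtgt G l)) c)"
    by (rule transport_constant[OF \<rho>(2) conn]) (use N(3) k l in \<open>auto simp: source_fibre_def\<close>)
  moreover have "inv_into (fibre E (gsrc G k)) (\<Psi> k) (\<psi> (\<rho>b (gtgt G k)) c) = ?u"
    using br u bij_betw_imp_inj_on[OF rep_bij[of k]] by (intro inv_into_f_eq) auto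
  moreover have "\<Psi> l (inv_into (fibre E (gsrc G l)) (\<Psi> l) (\<psi> (\<rho>b (gtgt G l)) c)) = \<psi> (\<rho>b (gtgt G l)) c"
    using psi_section_in[OF \<rho>(2) tgt[OF l(1)]] bij_betw_imp_surj_on[OF rep_bij[of l]]
    by (intro f_inv_into_f) simp
  ultimately have brl: "\<Psi> l (\<psi> (\<rho>a (gsrc G l)) c) = \<psi> (\<rho>b (gtgt G l)) c" using l(2) by simp
  \<comment> \<open>Inversion turns a slice of a target fibre into part of a source fibre whose
    targets lie in \<open>Wa\<close>, so the same constancy applies with \<open>\<rho>a\<close> as
    the branch.\<close>
  let ?K = "ginv G ` (N \<inter> gtgt G -` {gtgt G k'})"
  have "connected (N \<inter> gtgt G -` {gtgt G k'})" using N(1) by (simp add: st_box_def)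
  then have connK: "connected ?K"
    using holo_mapD(2)[OF map_inv] by (intro connected_continuous_image) (auto intro: continuous_on_subset)
  have "inv_into (fibre E (gtgt G k')) (\<Psi> (ginv G l)) (\<psi> (\<rho>a (gtgt G (ginv G l))) c) =
    inv_into (fibre E (gtgt G k')) (\<Psi> (ginv G k')) (\<psi> (\<rho>a (gtgt G (ginv G k'))) c)"
    by (rule transport_constant[OF \<rho>(1) connK]) (use src k l in \<open>auto simp: source_fibre_def\<close>)
  moreover have "inv_into (fibre E (gtgt G m)) (\<Psi> (ginv G m)) (\<psi> (\<rho>a (gtgt G (ginv G m))) c) =
      \<Psi> m (\<psi> (\<rho>a (gsrc G m)) c)" if "m \<in> N" for m
  proof -
    have e: "\<psi> (\<rho>a (gsrc G m)) c \<in> fibre E (gsrc G m)" by (rule psi_section_in[OF \<rho>(1) src[OF that]])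
    show ?thesis
      using rep_inv1[OF e] rep_in[OF e] bij_betw_imp_inj_on[OF rep_bij[of "ginv G m"]]
      by (intro inv_into_f_eq) auto
  qed
  ultimately have "\<Psi> l (\<psi> (\<rho>a (gsrc G l)) c) = \<Psi> k' (\<psi> (\<rho>a (gsrc G k')) c)" using l k(2) by metis
  then show "\<Psi> k' (\<psi> (\<rho>a (gsrc G k')) c) = \<psi> (\<rho>b (gtgt G k')) c" using brl l(3) by simp
qed

text \<open>Through each point over \<open>T\<close> passes a section defined on all of
  \<open>T\<close>. The open set \<open>v\<close> is recorded so that a continuous lift through
  \<open>y\<close> can be identified nearby with the section applied to its projection.\<close>

definition evenly_covered :: "'x set \<Rightarrow> bool" where
  "evenly_covered T \<longleftrightarrow> (\<forall>y. p y \<in> T \<longrightarrow> (\<exists>\<rho> v. section_on T \<rho> \<and> open v \<and> y \<in> v \<and>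
     (\<forall>z\<in>v. p z \<in> T \<and> \<rho> (p z) = z)))"

lemma evenly_coveredE:
  assumes "evenly_covered T" "p y \<in> T"
  obtains \<rho> v where "section_on T \<rho>" "open v" "y \<in> v" "\<forall>z\<in>v. p z \<in> T \<and> \<rho> (p z) = z"
proof -
  have "\<exists>\<rho> v. section_on T \<rho> \<and> open v \<and> y \<in> v \<and> (\<forall>z\<in>v. p z \<in> T \<and> \<rho> (p z) = z)"
    using assms(1)[unfolded evenly_covered_def, THEN spec, THEN mp, OF assms(2)] .
  then show ?thesis by (elim exE conjE) (rule that)
qed

lemma evenly_covered_at:
  assumes "x \<notin> support D"
  obtains T where "open T" "x \<in> T" "evenly_covered T"
proof -
  have cs: "covering_space UNIV p (- support D)" using cover by (simp add: universal_cover_def)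
  have oU: "open (- support D)" by (rule open_compl_support(1)[OF eff])
  obtain T vs where T: "x \<in> T" "openin (top_of_set (- support D)) T" "\<Union>vs = UNIV \<inter> p -` T"
    "\<forall>u\<in>vs. openin (top_of_set UNIV) u" "\<forall>u\<in>vs. \<exists>q. homeomorphism u T p q"
    using cs assms unfolding covering_space_def by (metis ComplI)
  have oT: "open T" "T \<subseteq> - support D" using T(2) oU by (auto simp: openin_open_eq)
  have "evenly_covered T"
    unfolding evenly_covered_def
  proof (intro allI impI)
    fix y assume "p y \<in> T"
    then have "y \<in> \<Union>vs" using T(3) by simp
    then obtain v where v: "v \<in> vs" "y \<in> v" by blast
    obtain \<rho> where h: "homeomorphism v T p \<rho>" using T(5) v(1) by blast
    have "section_on T \<rho>"
      unfolding section_on_def using oT homeomorphism_cont2[OF h] homeomorphism_apply2[OF h] by blast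
    moreover have "open v" using T(4) v(1) by (simp add: openin_open_eq)
    moreover have "\<forall>z\<in>v. p z \<in> T \<and> \<rho> (p z) = z"
      using homeomorphism_image1[OF h] homeomorphism_apply1[OF h] by blast
    ultimately show "\<exists>\<rho> v. section_on T \<rho> \<and> open v \<and> y \<in> v \<and> (\<forall>z\<in>v. p z \<in> T \<and> \<rho> (p z) = z)"
      using v(2) by blast
  qed
  then show ?thesis using that oT(1) T(1) by blast
qed

lemma covered_box:
  assumes "g \<in> restricted_arrows D G"
  obtains Ta Tb N where "evenly_covered Ta" "evenly_covered Tb" "st_box N" "g \<in> N"
    "N \<subseteq> gsrc G -` Ta" "N \<subseteq> gtgt G -` Tb"
proof -
  have gR: "gsrc G g \<notin> support D" "gtgt G g \<notin> support D" using assms by (auto simp: restricted_arrows_def)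
  obtain Ta where Ta: "open Ta" "gsrc G g \<in> Ta" "evenly_covered Ta" using evenly_covered_at[OF gR(1)] .
  obtain Tb where Tb: "open Tb" "gtgt G g \<in> Tb" "evenly_covered Tb" using evenly_covered_at[OF gR(2)] .
  have "open (gsrc G -` Ta \<inter> gtgt G -` Tb)" "g \<in> gsrc G -` Ta \<inter> gtgt G -` Tb"
    using open_src[OF Ta(1)] open_tgt[OF Tb(1)] Ta Tb by auto
  from st_box_exists[OF gR(2) this]
  obtain N where "st_box N" "g \<in> N" "N \<subseteq> gsrc G -` Ta \<inter> gtgt G -` Tb" .
  then show ?thesis using that[OF Ta(3) Tb(3)] by blast
qed

lemma lift_exists:
  assumes "x \<notin> support D" obtains y where "p y = x"
proof -
  have "covering_space UNIV p (- support D)" using cover by (simp add: universal_cover_def)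
  from covering_space_imp_surjective[OF this] have "x \<in> range p" using assms by auto
  then show ?thesis using that by auto
qed

text \<open>The locus where \<open>\<Psi>\<close> is given by some branch of \<open>\<delta>\<psi>\<close> is open and closed in each source fibre.\<close>

lemma rep_is_branch:
  assumes "g \<in> restricted_arrows D G"
  shows "\<exists>a b. p a = gsrc G g \<and> p b = gtgt G g \<and> (\<forall>c. \<Psi> g (\<psi> a c) = \<psi> b c)"
proof -
  let ?P = "\<lambda>g. \<exists>a b. p a = gsrc G g \<and> p b = gtgt G g \<and> (\<forall>c. \<Psi> g (\<psi> a c) = \<psi> b c)"
  let ?x = "gsrc G g"
  have x: "?x \<notin> support D" using assms by (simp add: restricted_arrows_def)
  show ?thesis
  proof (rule connected_constant_predicate[where P = ?P, OF connected_source_fibre[of ?x]])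
    fix k assume k: "k \<in> source_fibre G ?x"
    then have "k \<in> restricted_arrows D G" by (rule src_fibre_restricted[OF x])
    from covered_box[OF this] obtain Ta Tb N where T: "evenly_covered Ta" "evenly_covered Tb"
      and N: "st_box N" "k \<in> N" "N \<subseteq> gsrc G -` Ta" "N \<subseteq> gtgt G -` Tb" .
    \<comment> \<open>Sections through the lifts at \<open>l\<close> provide lifts at
      \<open>m\<close>, and the equality persists by \<open>branch_constant\<close>; so the
      predicate has one truth value on the box.\<close>
    have step: "?P m" if lm: "l \<in> N" "m \<in> N" and "?P l" for l m
    proof -
      obtain a b where ab: "p a = gsrc G l" "p b = gtgt G l" "\<forall>c. \<Psi> l (\<psi> a c) = \<psi> b c"
        using \<open>?P l\<close> by blast
      have pa: "p a \<in> Ta" and pb: "p b \<in> Tb" using ab lm(1) N(3,4) by auto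
      obtain \<rho>a va where "section_on Ta \<rho>a" "open va" "a \<in> va"
          "\<forall>z\<in>va. p z \<in> Ta \<and> \<rho>a (p z) = z"
        using evenly_coveredE[OF T(1) pa] .
      then have \<rho>a: "section_on Ta \<rho>a" "\<rho>a (p a) = a" by auto
      obtain \<rho>b vb where "section_on Tb \<rho>b" "open vb" "b \<in> vb"
          "\<forall>z\<in>vb. p z \<in> Tb \<and> \<rho>b (p z) = z"
        using evenly_coveredE[OF T(2) pb] .
      then have \<rho>b: "section_on Tb \<rho>b" "\<rho>b (p b) = b" by auto
      have "\<forall>c. \<Psi> l (\<psi> (\<rho>a (gsrc G l)) c) = \<psi> (\<rho>b (gtgt G l)) c"
        using ab(3) \<rho>a(2) \<rho>b(2) unfolding ab(1,2) by simp
      note br = branch_constant[OF \<rho>a(1) \<rho>b(1) N(1,3,4) lm this]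
      have "gsrc G m \<in> Ta" "gtgt G m \<in> Tb" using lm(2) N(3,4) by auto
      then have "p (\<rho>a (gsrc G m)) = gsrc G m" "p (\<rho>b (gtgt G m)) = gtgt G m"
        using \<rho>a(1) \<rho>b(1) by (auto simp: section_on_def)
      then show ?thesis using br by blast
    qed
    have "\<forall>m\<in>N \<inter> source_fibre G ?x. ?P m = ?P k" using step N(2) by blast
    then show "\<exists>N. open N \<and> k \<in> N \<and> (\<forall>m\<in>N \<inter> source_fibre G ?x. ?P m = ?P k)"
      using N(1,2) unfolding st_box_def by blast
  next
    show "gone G ?x \<in> source_fibre G ?x" "g \<in> source_fibre G ?x" by (simp_all add: source_fibre_def)
    \<comment> \<open>At an identity a single lift serves for both source and target.\<close>
    obtain a where a: "p a = ?x" using lift_exists[OF x] .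
    have "\<Psi> (gone G ?x) (\<psi> a c) = \<psi> a c" for c using rep_one psi_in[of a c] a by simp
    then show "?P (gone G ?x)" using a by (intro exI[of _ a]) simp
  qed
qed

section \<open>Existence and uniqueness of the normalised branch and of its extension\<close>

lemma psi_inv_into [simp]: "inv_into UNIV (\<psi> y) (\<psi> y c) = c"
  using bij_betw_imp_inj_on[OF psi_bij[of y]] by simp

lemma psi_surj:
  assumes "e \<in> fibre E (p y)" obtains c where "e = \<psi> y c"
  using bij_betw_imp_surj_on[OF psi_bij[of y]] assms by blast

text \<open>Lifts that are right at one arrow are extended by sections over evenly covered sets;
  \<open>branch_constant\<close> keeps them right on the whole box, and composing with source and
  target gives continuous lifts.\<close>

lemma rep_delta_branch: "delta_branch G E p \<psi> (restricted_arrows D G) \<Psi>"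
  unfolding delta_branch_def
proof
  fix g assume g: "g \<in> restricted_arrows D G"
  obtain a0 b0 where ab: "p a0 = gsrc G g" "p b0 = gtgt G g" "\<forall>c. \<Psi> g (\<psi> a0 c) = \<psi> b0 c"
    using rep_is_branch[OF g] by blast
  from covered_box[OF g] obtain Ta Tb N where T: "evenly_covered Ta" "evenly_covered Tb"
    and N: "st_box N" "g \<in> N" "N \<subseteq> gsrc G -` Ta" "N \<subseteq> gtgt G -` Tb" .
  have pab: "p a0 \<in> Ta" "p b0 \<in> Tb" using ab N(2-4) by auto
  obtain \<rho>a va where \<rho>a: "section_on Ta \<rho>a" "open va" "a0 \<in> va" "\<forall>z\<in>va. p z \<in> Ta \<and> \<rho>a (p z) = z"
    using evenly_coveredE[OF T(1) pab(1)] .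
  obtain \<rho>b vb where \<rho>b: "section_on Tb \<rho>b" "open vb" "b0 \<in> vb" "\<forall>z\<in>vb. p z \<in> Tb \<and> \<rho>b (p z) = z"
    using evenly_coveredE[OF T(2) pab(2)] .
  have \<rho>: "section_on Ta \<rho>a" "\<rho>a (p a0) = a0" "section_on Tb \<rho>b" "\<rho>b (p b0) = b0"
    using \<rho>a \<rho>b by auto
  have oN: "open N" using N(1) by (simp add: st_box_def)
  have brg: "\<forall>c. \<Psi> g (\<psi> (\<rho>a (gsrc G g)) c) = \<psi> (\<rho>b (gtgt G g)) c" using ab \<rho> by simp
  have br: "\<Psi> k (\<psi> (\<rho>a (gsrc G k)) c) = \<psi> (\<rho>b (gtgt G k)) c" if k: "k \<in> N" for k c
    using branch_constant[OF \<rho>(1,3) N(1,3,4,2) k brg] by blast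
  have sub: "Ta \<subseteq> - support D" "Tb \<subseteq> - support D" using \<rho> by (auto simp: section_on_def)
  show "\<exists>N' a b. open N' \<and> g \<in> N' \<and> N' \<subseteq> restricted_arrows D G \<and> continuous_on N' a \<and> continuous_on N' b \<and>
        (\<forall>k\<in>N'. p (a k) = gsrc G k \<and> p (b k) = gtgt G k \<and>
           (\<forall>e\<in>fibre E (gsrc G k). \<Psi> k e = \<psi> (b k) (inv_into UNIV (\<psi> (a k)) e)))"
  proof (intro exI conjI ballI)
    show "open N" "g \<in> N" by fact+
    show "N \<subseteq> restricted_arrows D G" using N(3,4) sub by (auto simp: restricted_arrows_def)
    have cs: "continuous_on N (gsrc G)" "continuous_on N (gtgt G)"
      using holo_mapD(2)[OF map_src] holo_mapD(2)[OF map_tgt] continuous_on_subset by blast+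
    show "continuous_on N (\<lambda>k. \<rho>a (gsrc G k))"
      by (rule continuous_on_compose2[OF _ cs(1)]) (use \<rho>(1) N(3) in \<open>auto simp: section_on_def\<close>)
    show "continuous_on N (\<lambda>k. \<rho>b (gtgt G k))"
      by (rule continuous_on_compose2[OF _ cs(2)]) (use \<rho>(3) N(4) in \<open>auto simp: section_on_def\<close>)
    fix k assume k: "k \<in> N"
    then show pk: "p (\<rho>a (gsrc G k)) = gsrc G k" "p (\<rho>b (gtgt G k)) = gtgt G k"
      using \<rho>(1,3) N(3,4) by (auto simp: section_on_def)
    fix e assume "e \<in> fibre E (gsrc G k)"
    then obtain c where "e = \<psi> (\<rho>a (gsrc G k)) c" using psi_surj[of e "\<rho>a (gsrc G k)"] pk by metis
    then show "\<Psi> k e = \<psi> (\<rho>b (gtgt G k)) (inv_into UNIV (\<psi> (\<rho>a (gsrc G k))) e)"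
      using br[OF k] by simp
  qed
qed

lemma rep_normalised: "normalised D G E \<Psi>"
  unfolding normalised_def using rep_one by blast

text \<open>Where \<open>\<delta>\<close> is given by local branches, agreement with
  \<open>\<Psi>\<close> means that \<open>\<Psi>\<close> is given by the same branches, and this
  spreads over boxes. Normalisation gives agreement at the identity, and connectedness of the source
  fibre does the rest.\<close>

lemma delta_branch_unique:
  assumes \<delta>: "delta_branch G E p \<psi> (restricted_arrows D G) \<delta>" and norm: "normalised D G E \<delta>"
  shows "hom_eq_on G E (restricted_arrows D G) \<delta> \<Psi>"
  unfolding hom_eq_on_def
proof
  let ?P = "\<lambda>g. \<forall>e\<in>fibre E (gsrc G g). \<delta> g e = \<Psi> g e"
  fix g assume g: "g \<in> restricted_arrows D G"
  let ?x = "gsrc G g"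
  have x: "?x \<notin> support D" using g by (simp add: restricted_arrows_def)
  show "?P g"
  proof (rule connected_constant_predicate[where P = ?P, OF connected_source_fibre[of ?x]])
    fix k assume k: "k \<in> source_fibre G ?x"
    have kr: "k \<in> restricted_arrows D G" by (rule src_fibre_restricted[OF x k])
    then have kR: "gsrc G k \<notin> support D" "gtgt G k \<notin> support D" by (auto simp: restricted_arrows_def)
    obtain N' a b where N': "open N'" "k \<in> N'" "continuous_on N' a" "continuous_on N' b"
      "\<And>l. l \<in> N' \<Longrightarrow> p (a l) = gsrc G l" "\<And>l. l \<in> N' \<Longrightarrow> p (b l) = gtgt G l"
      "\<And>l e. l \<in> N' \<Longrightarrow> e \<in> fibre E (gsrc G l) \<Longrightarrow> \<delta> l e = \<psi> (b l) (inv_into UNIV (\<psi> (a l)) e)"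
      using bspec[OF \<delta>[unfolded delta_branch_def] kr] by auto
    obtain Ta where Ta: "open Ta" "gsrc G k \<in> Ta" "evenly_covered Ta" using evenly_covered_at[OF kR(1)] .
    obtain Tb where Tb: "open Tb" "gtgt G k \<in> Tb" "evenly_covered Tb" using evenly_covered_at[OF kR(2)] .
    have pab: "p (a k) \<in> Ta" "p (b k) \<in> Tb" using N'(2,5,6) Ta Tb by auto
    obtain \<rho>a va where \<rho>a: "section_on Ta \<rho>a" "open va" "a k \<in> va" "\<forall>z\<in>va. p z \<in> Ta \<and> \<rho>a (p z) = z"
      using evenly_coveredE[OF Ta(3) pab(1)] .
    obtain \<rho>b vb where \<rho>b: "section_on Tb \<rho>b" "open vb" "b k \<in> vb" "\<forall>z\<in>vb. p z \<in> Tb \<and> \<rho>b (p z) = z"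
      using evenly_coveredE[OF Tb(3) pab(2)] .
    \<comment> \<open>On \<open>U\<close> the lifts \<open>a\<close> and \<open>b\<close> stay in
      the chosen sheets, so they coincide with the sections applied to source and target;
      \<open>branch_constant\<close> speaks only of the latter.\<close>
    define U where "U = (N' \<inter> a -` va) \<inter> (N' \<inter> b -` vb)"
    have "open U" unfolding U_def using N' \<rho>a(2) \<rho>b(2) by (intro open_Int continuous_open_preimage)
    moreover have "k \<in> U" using N'(2) \<rho>a(3) \<rho>b(3) by (simp add: U_def)
    ultimately obtain N where N: "st_box N" "k \<in> N" "N \<subseteq> U" using st_box_exists[OF kR(2)] by blast
    have lift: "\<rho>a (gsrc G l) = a l" "\<rho>b (gtgt G l) = b l" "gsrc G l \<in> Ta" "gtgt G l \<in> Tb" "l \<in> N'" if "l \<in> N" for l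
    proof -
      have l: "l \<in> N'" "a l \<in> va" "b l \<in> vb" using that N(3) by (auto simp: U_def)
      from bspec[OF \<rho>a(4) l(2)] bspec[OF \<rho>b(4) l(3)] N'(5,6)[OF l(1)] l(1)
      show "\<rho>a (gsrc G l) = a l" "\<rho>b (gtgt G l) = b l" "gsrc G l \<in> Ta" "gtgt G l \<in> Tb" "l \<in> N'"
        by simp_all
    qed
    have P_iff: "?P l \<longleftrightarrow> (\<forall>c. \<Psi> l (\<psi> (\<rho>a (gsrc G l)) c) = \<psi> (\<rho>b (gtgt G l)) c)" if l: "l \<in> N" for l
    proof -
      note li = lift[OF l]
      have val: "\<delta> l (\<psi> (a l) c) = \<psi> (b l) c" for c
        using N'(7)[OF li(5), of "\<psi> (a l) c"] psi_in[of "a l" c] N'(5)[OF li(5)] by simp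
      have "?P l \<longleftrightarrow> (\<forall>c. \<delta> l (\<psi> (a l) c) = \<Psi> l (\<psi> (a l) c))"
        using psi_surj[of _ "a l"] psi_in[of "a l"] N'(5)[OF li(5)] by metis
      then show ?thesis using val li(1,2) by metis
    qed
    have sub: "N \<subseteq> gsrc G -` Ta" "N \<subseteq> gtgt G -` Tb" using lift by auto
    have "?P m" if lm: "l \<in> N" "m \<in> N" and "?P l" for l m
      using branch_constant[OF \<rho>a(1) \<rho>b(1) N(1) sub lm] P_iff[OF lm(1)] P_iff[OF lm(2)] that(3) by blast
    then have "\<forall>m\<in>N \<inter> source_fibre G ?x. ?P m = ?P k" using N(2) by blast
    then show "\<exists>N. open N \<and> k \<in> N \<and> (\<forall>m\<in>N \<inter> source_fibre G ?x. ?P m = ?P k)"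
      using N(1,2) unfolding st_box_def by blast
  next
    show "gone G ?x \<in> source_fibre G ?x" "g \<in> source_fibre G ?x" by (simp_all add: source_fibre_def)
    show "?P (gone G ?x)" using norm x rep_one by (simp add: normalised_def)
  qed
qed

text \<open>The total space carries no topology here, so the comparison is made on matrix entries in
  trivialisations: an entry that differs at \<open>g\<close> differs on an open set, which contains
  restricted arrows.\<close>

lemma extension_unique:
  assumes \<Theta>: "holo_hom B G E UNIV \<Theta>" and eq: "hom_eq_on G E (restricted_arrows D G) \<Theta> \<Psi>"
  shows "hom_eq_on G E UNIV \<Theta> \<Psi>"
  unfolding hom_eq_on_def
proof (intro ballI)
  fix g e assume e: "e \<in> fibre E (gsrc G g)"
  obtain V \<tau> where V: "(V, \<tau>) \<in> btriv E" "gsrc G g \<in> V" using trivialisation_at[OF vb] .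
  obtain W \<sigma> where W: "(W, \<sigma>) \<in> btriv E" "gtgt G g \<in> W" using trivialisation_at[OF vb] .
  let ?N = "UNIV \<inter> gsrc G -` V \<inter> gtgt G -` W"
  obtain M :: "'g \<Rightarrow> complex ^ 'r ^ 'r" where M: "\<And>i j. holo_fun B (\<lambda>g. M g $ i $ j) ?N"
    "\<And>g e. g \<in> ?N \<Longrightarrow> e \<in> fibre E (gsrc G g) \<Longrightarrow> \<sigma> (\<Theta> g e) = M g *v \<tau> e"
    using holo_homD(2)[OF \<Theta> V(1) W(1)] by blast
  obtain M' :: "'g \<Rightarrow> complex ^ 'r ^ 'r" where M': "\<And>i j. holo_fun B (\<lambda>g. M' g $ i $ j) ?N"
    "\<And>g e. g \<in> ?N \<Longrightarrow> e \<in> fibre E (gsrc G g) \<Longrightarrow> \<sigma> (\<Psi> g e) = M' g *v \<tau> e"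
    using holo_homD(2)[OF rep_hom V(1) W(1)] by blast
  have gN: "g \<in> ?N" using V W by simp
  \<comment> \<open>The fibre coordinate is onto, so equality of the homomorphisms on the fibre is
    equality of the matrices on all vectors.\<close>
  have same: "M k = M' k" if k: "k \<in> ?N" "k \<in> restricted_arrows D G" for k
    unfolding matrix_eq
  proof
    fix z
    have "gsrc G k \<in> V" using k by simp
    from bij_betw_imp_surj_on[OF trivialisation(2)[OF vb V(1) this]]
    obtain e where e: "e \<in> fibre E (gsrc G k)" "z = \<tau> e" by blast
    have "\<Theta> k e = \<Psi> k e" using eq k(2) e(1) by (simp add: hom_eq_on_def)
    then show "M k *v z = M' k *v z" using M(2)[OF k(1) e(1)] M'(2)[OF k(1) e(1)] e(2) by simp
  qed
  have "M g $ i $ j = M' g $ i $ j" for i j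
  proof (rule ccontr)
    assume ne: "M g $ i $ j \<noteq> M' g $ i $ j"
    have "g \<in> {k \<in> ?N \<inter> ?N. M k $ i $ j \<noteq> M' k $ i $ j}" using gN ne by simp
    from restricted_arrows_dense[OF holo_fun_neq_open[OF atlasB M(1) M'(1)] this]
    obtain k where k: "k \<in> ?N" "k \<in> restricted_arrows D G" "M k $ i $ j \<noteq> M' k $ i $ j" by blast
    then show False using same[OF k(1,2)] by simp
  qed
  then have "M g = M' g" by (simp add: vec_eq_iff)
  then have "\<sigma> (\<Theta> g e) = \<sigma> (\<Psi> g e)" using M(2)[OF gN e] M'(2)[OF gN e] by simp
  moreover have "\<Theta> g e \<in> fibre E (gtgt G g)" "\<Psi> g e \<in> fibre E (gtgt G g)"
    using holo_homD(1)[OF \<Theta> UNIV_I e] rep_in[OF e] by auto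
  ultimately show "\<Theta> g e = \<Psi> g e"
    using bij_betw_imp_inj_on[OF trivialisation(2)[OF vb W]] by (simp add: inj_on_def)
qed

end

theorem proposition5p1:
  fixes A :: "('x::t2_space, 1) atlas"
    and D :: "'x \<Rightarrow> nat"
    and E :: "('x, 'e, 'r::finite) vbundle"
    and nab :: "('x, 'e) conn"
    and B :: "('g::topological_space, 2) atlas"
    and G :: "('x, 'g) groupoid"
    and \<Phi> :: "'x set \<Rightarrow> 'x vfield \<Rightarrow> 'g vfield"
    and \<Psi> :: "'g \<Rightarrow> 'e \<Rightarrow> 'e"
    and p :: "'u::topological_space \<Rightarrow> 'x"
    and \<psi> :: "'u \<Rightarrow> complex ^ 'r \<Rightarrow> 'e"
  assumes "complex_atlas A"
    and "effective_divisor D"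
    and "vector_bundle A E"
    and "meromorphic_connection A D E nab"
    and "twisted_fundamental_groupoid A D B G \<Phi>"
    and "groupoid_rep B G E \<Psi>"
    and "integrates A D G \<Phi> E nab \<Psi>"
    and "universal_cover p (- support D)"
    and "fundamental_solution A D E nab p \<psi>"
  shows "\<exists>\<delta>. delta_branch G E p \<psi> (restricted_arrows D G) \<delta> \<and> normalised D G E \<delta> \<and>
      (\<forall>\<delta>'. delta_branch G E p \<psi> (restricted_arrows D G) \<delta>' \<and> normalised D G E \<delta>' \<longrightarrow>
         hom_eq_on G E (restricted_arrows D G) \<delta>' \<delta>) \<and>
      (\<exists>\<Theta>. holo_hom B G E UNIV \<Theta> \<and> hom_eq_on G E (restricted_arrows D G) \<Theta> \<delta>) \<and>
      (\<forall>\<Theta>. holo_hom B G E UNIV \<Theta> \<and> hom_eq_on G E (restricted_arrows D G) \<Theta> \<delta> \<longrightarrow>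
         hom_eq_on G E UNIV \<Theta> \<Psi>)"
proof -
  interpret integrated_connection A D B G \<Phi> E nab \<Psi> p \<psi>
    using assms(2,3,5-9) by unfold_locales
  show ?thesis
  proof (intro exI[of _ \<Psi>] conjI)
    show "delta_branch G E p \<psi> (restricted_arrows D G) \<Psi>" by (rule rep_delta_branch)
    show "normalised D G E \<Psi>" by (rule rep_normalised)
    show "\<forall>\<delta>'. delta_branch G E p \<psi> (restricted_arrows D G) \<delta>' \<and> normalised D G E \<delta>' \<longrightarrow>
         hom_eq_on G E (restricted_arrows D G) \<delta>' \<Psi>"
      by (intro allI impI, elim conjE) (rule delta_branch_unique)
    show "holo_hom B G E UNIV \<Psi>" by (rule rep_hom)
    show "hom_eq_on G E (restricted_arrows D G) \<Psi> \<Psi>" by (simp add: hom_eq_on_def)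
    show "\<forall>\<Theta>. holo_hom B G E UNIV \<Theta> \<and> hom_eq_on G E (restricted_arrows D G) \<Theta> \<Psi> \<longrightarrow>
         hom_eq_on G E UNIV \<Theta> \<Psi>"
      by (intro allI impI, elim conjE) (rule extension_unique)
  qed
qed

end
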